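(* Let $M$ be a smooth manifold, let $n,m\ge 0$, and let $Q$ be a smooth function on $M$ with values in orthogonal involutive real $(n+m)\times(n+m)$ matrices ($Q^2=1$, $Q^\top=Q$), whose $(-1)$-eigenspaces form a subbundle $V\subset M\times\mathbb R^{n+m}$ of rank $n$ and whose $(+1)$-eigenspaces form a subbundle $W\subset M\times\mathbb R^{n+m}$ of rank $m$, so that $V\oplus W= M\times\mathbb R^{n+m}$. Let $\pi_1:M\times\mathbb R^{n+m}=V\oplus W\to V$ be the projection to the first factor. Let $y=[y_i]$ be the column vector of the standard coordinates of $\mathbb R^{n+m}$, and let $V$ carry the metric obtained by restricting $y^2=\sum_i y_i^2$. Let $\nabla_0$ be the connection on $M\times\mathbb R^{n+m}$ whose covariant derivative in the coordinates $y$ is $d+\frac12 Q\,dQ\,\cdot$ ; it is compatible with the metric and leaves $V$ and $W$ invariant; let $\nabla_0|_V$ be its restriction to $V$. Let $$\Phi_0=\pi^{-(n+m)/2}e^{-y^2}\,dy_1\wedge\ldots\wedge dy_{n+m}.$$ If $V$ is oriented, then the form $\mathrm{TMQ}(V,\nabla_0|_V)$ on the total space of $V$ is well-defined (i.e. its defining local expressions in the various compatible trivializations of $V$ agree), and $$\mathrm{TMQ}(V,\nabla_0|_V)=(\pi_1)_*\Phi_0,$$ where the fiberwise integration $(\pi_1)_*$ is taken according to the complementary orientation on $W$.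
   Context: Compatible trivializations: for an oriented real vector bundle $V\to M$ of rank $n$ with a metric, a local trivialization with fiber coordinates $x=[x_i]_{i=1}^n$ (a column vector) is called compatible if $dx_1\wedge\ldots\wedge dx_n$ is the orientation form and $x^2=x^\top x=\sum x_i^2$ is the metric. Connection and curvature forms: if $\nabla$ is a connection on $V$ compatible with the metric, then in such a trivialization $\theta=[\theta_{ij}]$ denotes the matrix of connection $1$-forms, i.e. $\nabla$ is $d+\theta\,\cdot$ as a covariant differential in the coordinates $x$, and $\Omega=d\theta+\theta\theta=[\Omega_{ij}]$ is the matrix of curvature $2$-forms. Mathai-Quillen form: $\mathrm{TMQ}(V,\nabla)$ is the differential form on the total space of $V$ given in any compatible trivialization by $$\pi^{-n/2}e^{-x^2}\sum_{\substack{I\cup I'=\{1,\ldots, n\},\\ |I'|\text{ even}}}(-1)^{(I,I')}(dx+\theta x)_{i_1}\ldots(dx+\theta x)_{i_{|I|}}\;\frac{1}{2^{|I'|}(|I'|/2)!}\sum_{\sigma\in\Sigma_{|I'|}}(-1)^\sigma\,\Omega_{i'_{\sigma(1)},i'_{\sigma(2)}}\ldots\Omega_{i'_{\sigma(|I'|-1)},i'_{\sigma(|I'|)}}.$$ Here products are wedge products; the sum is over disjoint $I,I'$ with union $\{1,\ldots,n\}$; $I=\{i_1,\ldots,i_{|I|}\}$ with elements in increasing order, similarly $I'=\{i'_1,\ldots,i'_{|I'|}\}$; $(-1)^{(I,I')}$ is the sign of the permutation which puts the elements of $I$ in front of the elements of $I'$; $\Sigma_k$ is the symmetric group; $u_i$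 denotes the $i$-th entry of a column vector $u$; the scalar $\pi$ in $\pi^{-n/2}$ is the number $\pi$. Complementary orientation: the orientation on $W$ such that the orientation of $V$ followed by that of $W$ is the orientation of the trivial bundle $M\times\mathbb R^{n+m}$ given by $dy_1\wedge\ldots\wedge dy_{n+m}$. Fiberwise integration: if locally $x_1,\dots,x_n$ are linear fiber coordinates on $V$ and $x_{n+1},\ldots,x_{n+m}$ are oriented linear fiber coordinates on $W$, then $(\pi_1)_*$ sends $f\,\pi_1^*\beta\wedge dx_{n+1}\wedge\ldots\wedge dx_{n+m}$ ($\beta$ a form on $V$, $f$ a function rapidly decreasing along the fibers) to $\left(\int f\,dx_{n+1}\cdots dx_{n+m}\right)\beta$, and sends terms containing fewer than $m$ of the differentials $dx_{n+1},\ldots,dx_{n+m}$ to $0$. *)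

theory Defs
  imports
    "HOL-Analysis.Analysis"
    "HOL-Combinatorics.Combinatorics"
    "Jordan_Normal_Form.Determinant"
begin

text \<open>
  Dimensions are natural numbers and may be 0. Following \<^const>\<open>Euclidean_space\<close>, a vector of
  R^d is a function \<open>nat \<Rightarrow> real\<close> vanishing from index \<open>d\<close> on; all indices start at 0. A vector
  of R^(d+n) carries the R^d part in the indices \<open>i < d\<close> and the R^n part in \<open>d \<le> i < d+n\<close>.
\<close>

type_synonym rvec = "nat \<Rightarrow> real"

abbreviation Rn :: "nat \<Rightarrow> rvec set"
  where "Rn d \<equiv> topspace (Euclidean_space d)"

definition proj :: "nat \<Rightarrow> rvec \<Rightarrow> rvec"
  where "proj d z = (\<lambda>i. if i < d then z i else 0)"

definition std_vec :: "nat \<Rightarrow> rvec"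
  where "std_vec i = (\<lambda>j. if j = i then 1 else 0)"


section \<open>Smooth functions on open subsets of R^d\<close>

definition partial :: "nat \<Rightarrow> (rvec \<Rightarrow> real) \<Rightarrow> rvec \<Rightarrow> real"
  where "partial i f x = deriv (\<lambda>t. f (x(i := t))) (x i)"

definition smooth_on :: "nat \<Rightarrow> rvec set \<Rightarrow> (rvec \<Rightarrow> real) \<Rightarrow> bool"
  where "smooth_on d S f \<longleftrightarrow>
    (\<forall>js. set js \<subseteq> {..<d} \<longrightarrow>
      continuous_on S (foldr partial js f) \<and>
      (\<forall>i<d. \<forall>x\<in>S. (\<lambda>t. foldr partial js f (x(i := t))) differentiable (at (x i))))"


section \<open>Differential forms on open subsets of R^d\<close>

text \<open>
  A form takes a point and a list of tangent vectors; its values on lists of length \<open>k\<close> are its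
  component of degree \<open>k\<close>.
\<close>

type_synonym dform = "rvec \<Rightarrow> rvec list \<Rightarrow> real"

definition fun_form :: "(rvec \<Rightarrow> real) \<Rightarrow> dform"
  where "fun_form f = (\<lambda>x vs. if vs = [] then f x else 0)"

text \<open>
  The sign of the permutation of \<open>{..<n}\<close> that puts the elements of \<open>I\<close>, in increasing order,
  in front of the remaining ones, also in increasing order.
\<close>

definition shuffle_sign :: "nat \<Rightarrow> nat set \<Rightarrow> real"
  where "shuffle_sign n I = of_int (sign (\<lambda>i. if i < n
    then (sorted_list_of_set I @ sorted_list_of_set ({..<n} - I)) ! i else i))"

text \<open>
  The sum over shuffles; the normalization is the one with
  \<open>(\<alpha> \<and> \<beta>)(v, w) = \<alpha>(v) \<beta>(w) - \<alpha>(w) \<beta>(v)\<close> on 1-forms.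
\<close>

definition wedge :: "dform \<Rightarrow> dform \<Rightarrow> dform"
  where "wedge \<alpha> \<beta> = (\<lambda>x vs. \<Sum>I\<in>Pow {..<length vs}. shuffle_sign (length vs) I *
    \<alpha> x (nths vs I) * \<beta> x (nths vs ({..<length vs} - I)))"

definition wedge_list :: "dform list \<Rightarrow> dform"
  where "wedge_list \<alpha>s = foldr wedge \<alpha>s (fun_form (\<lambda>_. 1))"

text \<open>
  The exterior derivative on R^k, evaluated on constant vector fields: the alternating sum of the
  derivatives along \<open>v\<^sub>j\<close> of the form evaluated on the list with \<open>v\<^sub>j\<close> left out.
\<close>

definition ext_d :: "nat \<Rightarrow> dform \<Rightarrow> dform"
  where "ext_d k \<omega> = (\<lambda>x vs. \<Sum>j<length vs. (-1) ^ j *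
    (\<Sum>i<k. (vs ! j) i * partial i (\<lambda>z. \<omega> z (take j vs @ drop (Suc j) vs)) x))"

definition pullback :: "nat \<Rightarrow> nat \<Rightarrow> (rvec \<Rightarrow> rvec) \<Rightarrow> dform \<Rightarrow> dform"
  where "pullback a b F \<omega> = (\<lambda>x vs. \<omega> (F x)
    (map (\<lambda>v j. if j < b then (\<Sum>i<a. partial i (\<lambda>z. F z j) x * v i) else 0) vs))"

definition coord_form :: "nat \<Rightarrow> nat \<Rightarrow> dform"
  where "coord_form k i = ext_d k (fun_form (\<lambda>z. z i))"


section \<open>Smooth manifolds\<close>

type_synonym 'p chart = "'p set \<times> ('p \<Rightarrow> rvec)"

definition chart_inv :: "'p chart \<Rightarrow> rvec \<Rightarrow> 'p"
  where "chart_inv c = inv_into (fst c) (snd c)"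

definition transition :: "'p chart \<Rightarrow> 'p chart \<Rightarrow> rvec \<Rightarrow> rvec"
  where "transition c c' = snd c' \<circ> chart_inv c"

definition smooth_manifold :: "'p topology \<Rightarrow> nat \<Rightarrow> 'p chart set \<Rightarrow> bool"
  where "smooth_manifold M d A \<longleftrightarrow>
    Hausdorff_space M \<and> second_countable M \<and>
    \<Union>(fst ` A) = topspace M \<and>
    (\<forall>(U, \<phi>)\<in>A. openin M U \<and> openin (Euclidean_space d) (\<phi> ` U) \<and>
      homeomorphic_map (subtopology M U) (subtopology (Euclidean_space d) (\<phi> ` U)) \<phi>) \<and>
    (\<forall>c\<in>A. \<forall>c'\<in>A. \<forall>i<d.
      smooth_on d (snd c ` (fst c \<inter> fst c')) (\<lambda>z. transition c c' z i))"

definition smooth_fun :: "nat \<Rightarrow> 'p chart set \<Rightarrow> 'p set \<Rightarrow> ('p \<Rightarrow> real) \<Rightarrow> bool"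
  where "smooth_fun d A U f \<longleftrightarrow>
    (\<forall>c\<in>A. smooth_on d (snd c ` (U \<inter> fst c)) (\<lambda>z. f (chart_inv c z)))"

text \<open>Two local expressions, in the charts \<open>c\<close> and \<open>c'\<close>, of a form on a \<open>k\<close>-dimensional manifold.\<close>

definition forms_agree :: "nat \<Rightarrow> 'p chart \<Rightarrow> dform \<Rightarrow> 'p chart \<Rightarrow> dform \<Rightarrow> bool"
  where "forms_agree k c \<omega> c' \<omega>' \<longleftrightarrow>
    (\<forall>z \<in> snd c ` (fst c \<inter> fst c'). \<forall>vs. set vs \<subseteq> Rn k \<longrightarrow>
      \<omega> z vs = pullback k k (transition c c') \<omega>' z vs)"


section \<open>Subbundles of the trivial bundle with fiber R^N\<close>

definition lincomb :: "rvec list \<Rightarrow> rvec \<Rightarrow> rvec"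
  where "lincomb b x = (\<lambda>k. \<Sum>i<length b. x i * (b ! i) k)"

definition basis_of :: "nat \<Rightarrow> rvec set \<Rightarrow> rvec list \<Rightarrow> bool"
  where "basis_of n S b \<longleftrightarrow> length b = n \<and> bij_betw (lincomb b) (Rn n) S"

definition coords :: "rvec list \<Rightarrow> rvec \<Rightarrow> rvec"
  where "coords b = inv_into (Rn (length b)) (lincomb b)"

definition smooth_section ::
    "nat \<Rightarrow> 'p chart set \<Rightarrow> nat \<Rightarrow> 'p set \<Rightarrow> ('p \<Rightarrow> rvec) \<Rightarrow> bool"
  where "smooth_section d A N U s \<longleftrightarrow>
    (\<forall>p\<in>U. s p \<in> Rn N) \<and> (\<forall>k<N. smooth_fun d A U (\<lambda>p. s p k))"

definition smooth_frame :: "'p topology \<Rightarrow> nat \<Rightarrow> 'p chart set \<Rightarrow> nat \<Rightarrow> nat \<Rightarrow>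
    ('p \<Rightarrow> rvec set) \<Rightarrow> 'p set \<Rightarrow> ('p \<Rightarrow> rvec list) \<Rightarrow> bool"
  where "smooth_frame M d A N n V U e \<longleftrightarrow>
    openin M U \<and> (\<forall>p\<in>U. basis_of n (V p) (e p)) \<and>
    (\<forall>i<n. smooth_section d A N U (\<lambda>p. e p ! i))"

definition subbundle :: "'p topology \<Rightarrow> nat \<Rightarrow> 'p chart set \<Rightarrow> nat \<Rightarrow> nat \<Rightarrow>
    ('p \<Rightarrow> rvec set) \<Rightarrow> bool"
  where "subbundle M d A N n V \<longleftrightarrow>
    (\<forall>p\<in>topspace M. V p \<subseteq> Rn N) \<and>
    (\<forall>p\<in>topspace M. \<exists>U e. p \<in> U \<and> smooth_frame M d A N n V U e)"

definition eigspace :: "nat \<Rightarrow> real mat \<Rightarrow> real \<Rightarrow> rvec set"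
  where "eigspace N B a =
    {y \<in> Rn N. B *\<^sub>v Matrix.vec N y = a \<cdot>\<^sub>v Matrix.vec N y}"

text \<open>
  An orientation assigns to every basis of every fiber a sign, with the usual change of basis
  rule, such that the signs of continuously varying bases are locally constant. In rank 0 the
  empty basis may have either sign.
\<close>

definition bundle_orientation :: "'p topology \<Rightarrow> nat \<Rightarrow> 'p chart set \<Rightarrow> nat \<Rightarrow> nat \<Rightarrow>
    ('p \<Rightarrow> rvec set) \<Rightarrow> ('p \<Rightarrow> rvec list \<Rightarrow> real) \<Rightarrow> bool"
  where "bundle_orientation M d A N n V ori \<longleftrightarrow>
    (\<forall>p\<in>topspace M. \<forall>b. basis_of n (V p) b \<longrightarrow>
      ori p b \<in> {-1, 1} \<and>
      (\<forall>b'. basis_of n (V p) b' \<longrightarrow>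
        ori p b' = sgn (Determinant.det (Matrix.mat n n (\<lambda>(i, j). coords b (b' ! j) i))) * ori p b)) \<and>
    (\<forall>U e. smooth_frame M d A N n V U e \<longrightarrow>
      continuous_map (subtopology M U) euclideanreal (\<lambda>p. ori p (e p)))"

text \<open>
  The orientation of \<open>V\<close> followed by that of \<open>W\<close> is the standard orientation of R^(n+m).
\<close>

definition complementary_orientation :: "'p topology \<Rightarrow> nat \<Rightarrow> nat \<Rightarrow>
    ('p \<Rightarrow> rvec set) \<Rightarrow> ('p \<Rightarrow> rvec list \<Rightarrow> real) \<Rightarrow>
    ('p \<Rightarrow> rvec set) \<Rightarrow> ('p \<Rightarrow> rvec list \<Rightarrow> real) \<Rightarrow> bool"
  where "complementary_orientation M n m V oV W oW \<longleftrightarrow>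
    (\<forall>p\<in>topspace M. \<forall>b b'. basis_of n (V p) b \<and> basis_of m (W p) b' \<longrightarrow>
      oV p b * oW p b' =
        sgn (Determinant.det (Matrix.mat (n + m) (n + m) (\<lambda>(k, i). ((b @ b') ! i) k))))"

text \<open>
  A local trivialization is given by the frame \<open>e\<close> dual to its fiber coordinates, so that
  \<open>(p, y) = (p, lincomb (e p) x)\<close>. It is taken over an open subset \<open>U\<close> of the domain of a
  chart \<open>c\<close> of \<open>M\<close>, so that together they give a chart of the total space.
\<close>

definition compatible_triv :: "'p topology \<Rightarrow> nat \<Rightarrow> 'p chart set \<Rightarrow> nat \<Rightarrow> nat \<Rightarrow>
    ('p \<Rightarrow> rvec set) \<Rightarrow> ('p \<Rightarrow> rvec list \<Rightarrow> real) \<Rightarrow>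
    'p chart \<Rightarrow> 'p set \<Rightarrow> ('p \<Rightarrow> rvec list) \<Rightarrow> bool"
  where "compatible_triv M d A N n V ori c U e \<longleftrightarrow>
    c \<in> A \<and> U \<subseteq> fst c \<and> smooth_frame M d A N n V U e \<and>
    (\<forall>p\<in>U. ori p (e p) = 1 \<and>
      (\<forall>x\<in>Rn n. (\<Sum>k<N. (lincomb (e p) x k)\<^sup>2) = (\<Sum>i<n. (x i)\<^sup>2)))"

definition total_chart :: "nat \<Rightarrow> ('p \<Rightarrow> rvec set) \<Rightarrow>
    'p chart \<Rightarrow> 'p set \<Rightarrow> ('p \<Rightarrow> rvec list) \<Rightarrow> ('p \<times> rvec) chart"
  where "total_chart d V c U e =
    ({(p, y). p \<in> U \<and> y \<in> V p},
     \<lambda>(p, y) i. if i < d then snd c p i else coords (e p) y (i - d))"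


section \<open>Connections and curvature\<close>

text \<open>
  The covariant derivative \<open>d + 1/2 Q dQ\<close> of a section of the trivial bundle with fiber R^N, as an
  R^N-valued 1-form in the chart \<open>c\<close>.
\<close>

definition nabla0 :: "nat \<Rightarrow> nat \<Rightarrow> ('p \<Rightarrow> real mat) \<Rightarrow> 'p chart \<Rightarrow> ('p \<Rightarrow> rvec) \<Rightarrow>
    rvec \<Rightarrow> rvec list \<Rightarrow> rvec"
  where "nabla0 d N Q c s = (\<lambda>z vs k. if k < N then
      ext_d d (fun_form (\<lambda>z. s (chart_inv c z) k)) z vs +
      1/2 * (\<Sum>l<N. \<Sum>r<N. Q (chart_inv c z) $$ (k, l) *
        ext_d d (fun_form (\<lambda>z. Q (chart_inv c z) $$ (l, r))) z vs * s (chart_inv c z) r)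
    else 0)"

definition nabla0_metric :: "'p topology \<Rightarrow> nat \<Rightarrow> 'p chart set \<Rightarrow> nat \<Rightarrow> ('p \<Rightarrow> real mat) \<Rightarrow> bool"
  where "nabla0_metric M d A N Q \<longleftrightarrow>
    (\<forall>c\<in>A. \<forall>U s t. openin M U \<and> U \<subseteq> fst c \<and>
      smooth_section d A N U s \<and> smooth_section d A N U t \<longrightarrow>
      (\<forall>z\<in>snd c ` U. \<forall>v\<in>Rn d.
        ext_d d (fun_form (\<lambda>z. \<Sum>k<N. s (chart_inv c z) k * t (chart_inv c z) k)) z [v] =
        (\<Sum>k<N. nabla0 d N Q c s z [v] k * t (chart_inv c z) k) +
        (\<Sum>k<N. s (chart_inv c z) k * nabla0 d N Q c t z [v] k)))"

definition nabla0_preserves :: "'p topology \<Rightarrow> nat \<Rightarrow> 'p chart set \<Rightarrow> nat \<Rightarrow> ('p \<Rightarrow> real mat) \<Rightarrow>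
    ('p \<Rightarrow> rvec set) \<Rightarrow> bool"
  where "nabla0_preserves M d A N Q V \<longleftrightarrow>
    (\<forall>c\<in>A. \<forall>U s. openin M U \<and> U \<subseteq> fst c \<and>
      smooth_section d A N U s \<and> (\<forall>p\<in>U. s p \<in> V p) \<longrightarrow>
      (\<forall>z\<in>snd c ` U. \<forall>v\<in>Rn d. nabla0 d N Q c s z [v] \<in> V (chart_inv c z)))"

text \<open>
  The connection forms \<open>\<theta>\<^sub>i\<^sub>j\<close> of the restricted connection in the frame \<open>e\<close>, characterized by
  \<open>\<nabla>\<^sub>0 e\<^sub>j = \<Sum>\<^sub>i \<theta>\<^sub>i\<^sub>j e\<^sub>i\<close>; equivalently the connection is \<open>d + \<theta>\<close> in the fiber coordinates.
\<close>

definition theta0 :: "nat \<Rightarrow> nat \<Rightarrow> ('p \<Rightarrow> real mat) \<Rightarrow> 'p chart \<Rightarrow> ('p \<Rightarrow> rvec list) \<Rightarrow>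
    nat \<Rightarrow> nat \<Rightarrow> dform"
  where "theta0 d N Q c e i j = (\<lambda>z vs.
    coords (e (chart_inv c z)) (nabla0 d N Q c (\<lambda>p. e p ! j) z vs) i)"

definition curvature :: "nat \<Rightarrow> nat \<Rightarrow> (nat \<Rightarrow> nat \<Rightarrow> dform) \<Rightarrow> nat \<Rightarrow> nat \<Rightarrow> dform"
  where "curvature d n \<theta> i j = (\<lambda>z vs.
    ext_d d (\<theta> i j) z vs + (\<Sum>k<n. wedge (\<theta> i k) (\<theta> k j) z vs))"


section \<open>The Mathai-Quillen form\<close>

definition lift_form :: "nat \<Rightarrow> nat \<Rightarrow> dform \<Rightarrow> dform"
  where "lift_form d n \<omega> = pullback (d + n) d (proj d) \<omega>"

definition dx_theta :: "nat \<Rightarrow> nat \<Rightarrow> (nat \<Rightarrow> nat \<Rightarrow> dform) \<Rightarrow> nat \<Rightarrow> dform"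
  where "dx_theta d n \<theta> i = (\<lambda>z vs. coord_form (d + n) (d + i) z vs +
    (\<Sum>j<n. lift_form d n (\<theta> i j) z vs * z (d + j)))"

definition Omega_part :: "nat \<Rightarrow> nat \<Rightarrow> (nat \<Rightarrow> nat \<Rightarrow> dform) \<Rightarrow> nat set \<Rightarrow> dform"
  where "Omega_part d n \<Omega> I' = (\<lambda>z vs.
    1 / (2 ^ card I' * fact (card I' div 2)) *
    (\<Sum>\<sigma> | \<sigma> permutes {..<card I'}. of_int (sign \<sigma>) *
      wedge_list (map (\<lambda>k. lift_form d n
          (\<Omega> (sorted_list_of_set I' ! \<sigma> (2 * k)) (sorted_list_of_set I' ! \<sigma> (2 * k + 1))))
        [0..<card I' div 2]) z vs))"

text \<open>
  The local expression on R^(d+n), in the trivialization with matrix of connection forms \<open>\<theta>\<close>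
  (forms on an open subset of R^d).
\<close>

definition TMQ :: "nat \<Rightarrow> nat \<Rightarrow> (nat \<Rightarrow> nat \<Rightarrow> dform) \<Rightarrow> dform"
  where "TMQ d n \<theta> = (\<lambda>z vs.
    pi powr (- real n / 2) * exp (- (\<Sum>i<n. (z (d + i))\<^sup>2)) *
    (\<Sum>I | I \<subseteq> {..<n} \<and> even (card ({..<n} - I)). shuffle_sign n I *
      wedge (wedge_list (map (dx_theta d n \<theta>) (sorted_list_of_set I)))
        (Omega_part d n (curvature d n \<theta>) ({..<n} - I)) z vs))"


section \<open>The Gaussian form and fiberwise integration\<close>

text \<open>The expression of the form in a chart of \<open>M\<close> and the standard coordinates of R^N.\<close>

definition Phi0 :: "nat \<Rightarrow> nat \<Rightarrow> dform"
  where "Phi0 d N = (\<lambda>z vs.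
    pi powr (- real N / 2) * exp (- (\<Sum>i<N. (z (d + i))\<^sup>2)) *
    wedge_list (map (\<lambda>i. coord_form (d + N) (d + i)) [0..<N]) z vs)"

text \<open>
  Integration over the last \<open>m\<close> coordinates of R^(k+m). The last \<open>m\<close> arguments are the coordinate
  vectors of these coordinates, which extracts the coefficient \<open>f \<beta>\<close> from
  \<open>f \<beta> \<and> dx\<^sub>k \<and> \<dots> \<and> dx\<^sub>k\<^sub>+\<^sub>m\<^sub>-\<^sub>1\<close>; see
  \<open>fiber_integral_top\<close> and \<open>fiber_integral_lower\<close>.
\<close>

definition fiber_integral :: "nat \<Rightarrow> nat \<Rightarrow> dform \<Rightarrow> dform"
  where "fiber_integral k m \<Psi> = (\<lambda>z vs.
    LINT w | (\<Pi>\<^sub>M i\<in>{k..<k+m}. lborel).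
      \<Psi> (override_on z w {k..<k+m}) (vs @ map std_vec [k..<k+m]))"

lemma coord_form_eq:
  assumes "i < K"
  shows "coord_form K i x us = (case us of [v] \<Rightarrow> v i | _ \<Rightarrow> 0)"
proof -
  have p1: "partial j (\<lambda>z. z i) x = (if j = i then 1 else 0)" for j
    by (simp add: partial_def fun_upd_def)
  have p0: "partial j (\<lambda>z. 0) x = 0" for j
    by (simp add: partial_def)
  show ?thesis
  proof (cases "\<exists>v. us = [v]")
    case True
    then obtain v where us: "us = [v]" by blast
    have "(\<Sum>j<K. v j * (if j = i then 1 else 0)) = v i"
      using assms by (simp add: if_distrib cong: if_cong)
    then show ?thesis
      by (simp add: us coord_form_def ext_d_def fun_form_def p1)
  next
    case False
    have "take j us @ drop (Suc j) us \<noteq> []" if "j < length us" for j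
    proof
      assume "take j us @ drop (Suc j) us = []"
      then have "j = 0" "length us \<le> 1" using that by auto
      then have "length us = 1" using that by simp
      then show False using False by (auto simp: length_Suc_conv)
    qed
    then have "fun_form (\<lambda>z. z i) z (take j us @ drop (Suc j) us) = 0" if "j < length us" for j z
      unfolding fun_form_def using that by meson
    then have "ext_d K (fun_form (\<lambda>z. z i)) x us = 0"
      unfolding ext_d_def by (intro sum.neutral ballI) (simp add: p0)
    moreover have "(case us of [v] \<Rightarrow> v i | _ \<Rightarrow> 0) = 0"
      using False by (auto split: list.split)
    ultimately show ?thesis by (simp add: coord_form_def)
  qed
qed

lemma pullback_proj:
  "pullback (k + m) k (proj k) \<beta> x us = \<beta> (proj k x) (map (proj k) us)"
proof -
  have p: "partial i (\<lambda>z. proj k z j) x = (if i = j then 1 else 0)" if "j < k" for i j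
    using that by (simp add: partial_def proj_def fun_upd_def)
  have "(\<Sum>i<k + m. partial i (\<lambda>z. proj k z j) x * v i) = v j" if "j < k" for j v
  proof -
    have "(\<Sum>i<k + m. partial i (\<lambda>z. proj k z j) x * v i) = (\<Sum>i<k + m. if i = j then v i else 0)"
      by (intro sum.cong) (auto simp: p[OF that])
    then show ?thesis using that by simp
  qed
  then have "(\<lambda>j. if j < k then \<Sum>i<k + m. partial i (\<lambda>z. proj k z j) x * v i else 0) = proj k v" for v
    unfolding proj_def[of k v] by auto
  then show ?thesis by (simp add: pullback_def)
qed

lemma shuffle_sign_initial: "shuffle_sign (p + q) {..<p} = 1"
proof -
  have "{..<p + q} - {..<p} = {p..<p + q}" by auto
  then have "sorted_list_of_set {..<p} @ sorted_list_of_set ({..<p + q} - {..<p}) = [0..<p + q]"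
    using upt_add_eq_append[of 0 p q] by (simp add: lessThan_atLeast0)
  then have "(\<lambda>i. if i < p + q then
      (sorted_list_of_set {..<p} @ sorted_list_of_set ({..<p + q} - {..<p})) ! i else i) = id"
    by auto
  then show ?thesis by (simp add: shuffle_sign_def sign_id)
qed

lemma wedge_append:
  assumes "\<And>I. I \<subseteq> {..<length (us @ ws)} \<Longrightarrow> I \<noteq> {..<length us} \<Longrightarrow>
    \<alpha> x (nths (us @ ws) I) = 0 \<or> \<beta> x (nths (us @ ws) ({..<length (us @ ws)} - I)) = 0"
  shows "wedge \<alpha> \<beta> x (us @ ws) = \<alpha> x us * \<beta> x ws"
proof -
  let ?p = "length us" and ?L = "us @ ws"
  let ?t = "\<lambda>I. shuffle_sign (length ?L) I * \<alpha> x (nths ?L I) * \<beta> x (nths ?L ({..<length ?L} - I))"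
  have "wedge \<alpha> \<beta> x ?L = sum ?t (Pow {..<length ?L})"
    by (simp add: wedge_def)
  also have "\<dots> = sum ?t {{..<?p}}"
    using assms by (intro sum.mono_neutral_right) auto
  also have "\<dots> = \<alpha> x us * \<beta> x ws"
  proof -
    have a: "nths ?L {..<?p} = us"
      by (simp add: nths_append nths_all)
    have b: "nths ?L ({..<length ?L} - {..<?p}) = ws"
    proof -
      have "set (nths us ({..<length ?L} - {..<?p})) = {}"
        unfolding set_nths by auto
      then have "nths us ({..<length ?L} - {..<?p}) = []" by (simp only: set_empty)
      then show ?thesis by (simp add: nths_append nths_all)
    qed
    show ?thesis using a b by (simp add: shuffle_sign_initial)
  qed
  finally show ?thesis .
qed

lemma wedge_list_coord_eq_0:
  assumes "u \<in> set us" and "\<And>j. j \<in> set J \<Longrightarrow> j < K \<and> u j = 0"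
  shows "wedge_list (map (coord_form K) J) x us = 0"
  using assms
proof (induction J arbitrary: us)
  case Nil
  then show ?case by (auto simp: wedge_list_def fun_form_def)
next
  case (Cons j J)
  from Cons.prems(1) obtain i where i: "i < length us" "us ! i = u"
    by (auto simp: in_set_conv_nth)
  have "coord_form K j x (nths us I) = 0 \<or>
      wedge_list (map (coord_form K) J) x (nths us ({..<length us} - I)) = 0" for I
  proof (cases "i \<in> I")
    case True
    then have "u \<in> set (nths us I)" using i by (auto simp: set_nths)
    then show ?thesis using Cons.prems(2)[of j]
      by (auto simp: coord_form_eq split: list.split)
  next
    case False
    then have "u \<in> set (nths us ({..<length us} - I))" using i by (auto simp: set_nths)
    then show ?thesis using Cons.IH Cons.prems(2) by simp
  qed
  then show ?case by (auto simp: wedge_list_def wedge_def intro!: sum.neutral)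
qed

lemma wedge_list_coord_std_vec:
  assumes "k + m \<le> K"
  shows "wedge_list (map (coord_form K) [k..<k+m]) x (map std_vec [k..<k+m]) = 1"
  using assms
proof (induction m arbitrary: k)
  case 0
  then show ?case by (simp add: wedge_list_def fun_form_def)
next
  case (Suc m)
  let ?R = "[Suc k..<Suc k + m]" and ?\<beta> = "wedge_list (map (coord_form K) [Suc k..<Suc k + m])"
  let ?L = "[std_vec k] @ map std_vec ?R"
  have upt: "[k..<k + Suc m] = k # ?R" by (simp add: upt_conv_Cons)
  have "wedge (coord_form K k) ?\<beta> x ?L = coord_form K k x [std_vec k] * ?\<beta> x (map std_vec ?R)"
  proof (rule wedge_append)
    fix I assume I: "I \<subseteq> {..<length ?L}" "I \<noteq> {..<length [std_vec k]}"
    show "coord_form K k x (nths ?L I) = 0 \<or> ?\<beta> x (nths ?L ({..<length ?L} - I)) = 0"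
    proof (cases "0 \<in> I")
      case True
      have "I \<noteq> {0}" using I(2) by (simp add: lessThan_Suc)
      then have "card I \<noteq> 1" using True by (auto simp: card_1_singleton_iff)
      moreover have "{i. i < length ?L \<and> i \<in> I} = I" using I(1) by auto
      ultimately have "length (nths ?L I) \<noteq> 1" by (simp add: length_nths del: length_append)
      then show ?thesis using Suc.prems by (auto simp: coord_form_eq split: list.split)
    next
      case False
      have "?L ! 0 \<in> set (nths ?L ({..<length ?L} - I))"
        unfolding set_nths using False by (intro CollectI exI[of _ 0]) simp
      then have "std_vec k \<in> set (nths ?L ({..<length ?L} - I))" by simp
      then show ?thesis using Suc.prems
        by (intro disjI2 wedge_list_coord_eq_0) (auto simp: std_vec_def)
    qed
  qed
  also have "\<dots> = 1"
  proof -
    have "coord_form K k x [std_vec k] = 1"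
      using Suc.prems by (simp add: coord_form_eq std_vec_def)
    moreover have "?\<beta> x (map std_vec ?R) = 1"
      by (rule Suc.IH) (use Suc.prems in simp)
    ultimately show ?thesis by simp
  qed
  finally show ?case unfolding upt by (simp add: wedge_list_def del: upt_Suc)
qed

text \<open>
  The two rules defining fiberwise integration. The assumption on \<open>\<beta>\<close> holds for multilinear \<open>\<beta>\<close>.
\<close>

lemma fiber_integral_top:
  assumes \<beta>: "\<And>us. (\<lambda>_. 0) \<in> set us \<Longrightarrow> \<beta> z us = 0"
    and z: "z \<in> Rn k" and vs: "set vs \<subseteq> Rn k"
  shows "fiber_integral k m
      (\<lambda>x us. f x * wedge (pullback (k + m) k (proj k) \<beta>)
        (wedge_list (map (coord_form (k + m)) [k..<k+m])) x us) z vs =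
    (LINT w | (\<Pi>\<^sub>M i\<in>{k..<k+m}. lborel). f (override_on z w {k..<k+m})) * \<beta> z vs"
proof -
  let ?ws = "map std_vec [k..<k+m]" and ?\<gamma> = "wedge_list (map (coord_form (k + m)) [k..<k+m])"
  let ?L = "vs @ ?ws"
  have "wedge (pullback (k + m) k (proj k) \<beta>) ?\<gamma> (override_on z w {k..<k+m}) ?L = \<beta> z vs" for w
  proof -
    let ?x = "override_on z w {k..<k+m}"
    have px: "proj k ?x = z"
      using z by (auto simp: proj_def override_on_def topspace_Euclidean_space)
    have pv: "map (proj k) vs = vs"
      using vs by (intro map_idI) (force simp: proj_def topspace_Euclidean_space)
    have "wedge (pullback (k + m) k (proj k) \<beta>) ?\<gamma> ?x ?L =
        pullback (k + m) k (proj k) \<beta> ?x vs * ?\<gamma> ?x ?ws"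
    proof (rule wedge_append)
      fix I assume I: "I \<subseteq> {..<length ?L}" "I \<noteq> {..<length vs}"
      show "pullback (k + m) k (proj k) \<beta> ?x (nths ?L I) = 0 \<or>
          ?\<gamma> ?x (nths ?L ({..<length ?L} - I)) = 0"
      proof (cases "I \<subseteq> {..<length vs}")
        case True
        then obtain i where i: "i < length vs" "i \<notin> I" using I(2) by auto
        then have "?L ! i \<in> set (nths ?L ({..<length ?L} - I))"
          unfolding set_nths by (intro CollectI exI[of _ i]) simp
        then have "vs ! i \<in> set (nths ?L ({..<length ?L} - I))"
          using i by (simp add: nth_append)
        moreover have "vs ! i \<in> Rn k" using i vs by auto
        ultimately show ?thesis
          by (intro disjI2 wedge_list_coord_eq_0[of "vs ! i"]) (auto simp: topspace_Euclidean_space)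
      next
        case False
        then obtain i where i: "i \<in> I" "\<not> i < length vs" by auto
        then have iL: "i < length ?L" using I(1) by blast
        have "?L ! i \<in> set (nths ?L I)" unfolding set_nths using i iL by blast
        moreover have "?L ! i = std_vec (k + (i - length vs))"
          using i iL by (simp add: nth_append)
        moreover have "proj k (std_vec (k + l)) = (\<lambda>_. 0)" for l
          by (auto simp: proj_def std_vec_def)
        ultimately have "(\<lambda>_. 0) \<in> set (map (proj k) (nths ?L I))"
          by (metis (no_types, lifting) image_eqI list.set_map)
        then show ?thesis by (simp add: pullback_proj px \<beta> del: set_map)
      qed
    qed
    then show ?thesis
      by (simp add: pullback_proj px pv wedge_list_coord_std_vec)
  qed
  then show ?thesis by (simp add: fiber_integral_def)
qed

lemma fiber_integral_lower:
  assumes \<beta>: "\<And>us. (\<lambda>_. 0) \<in> set us \<Longrightarrow> \<beta> z us = 0"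
    and z: "z \<in> Rn k" and J: "set J \<subset> {k..<k+m}"
  shows "fiber_integral k m
      (\<lambda>x us. f x * wedge (pullback (k + m) k (proj k) \<beta>)
        (wedge_list (map (coord_form (k + m)) J)) x us) z vs = 0"
proof -
  obtain j where j: "k \<le> j" "j < k + m" "j \<notin> set J" using psubset_imp_ex_mem[OF J] by auto
  let ?ws = "map std_vec [k..<k+m]" and ?\<gamma> = "wedge_list (map (coord_form (k + m)) J)"
  let ?L = "vs @ ?ws" and ?i = "length vs + (j - k)"
  have iL: "?i < length ?L" and Li: "?L ! ?i = std_vec j" using j by (auto simp: nth_append)
  have "wedge (pullback (k + m) k (proj k) \<beta>) ?\<gamma> (override_on z w {k..<k+m}) ?L = 0" for w
  proof -
    let ?x = "override_on z w {k..<k+m}"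
    have px: "proj k ?x = z"
      using z by (auto simp: proj_def override_on_def topspace_Euclidean_space)
    have "pullback (k + m) k (proj k) \<beta> ?x (nths ?L I) = 0 \<or>
        ?\<gamma> ?x (nths ?L ({..<length ?L} - I)) = 0" for I
    proof (cases "?i \<in> I")
      case True
      then have "?L ! ?i \<in> set (nths ?L I)" unfolding set_nths using iL by blast
      then have "proj k (std_vec j) \<in> set (map (proj k) (nths ?L I))" using Li by auto
      moreover have "proj k (std_vec j) = (\<lambda>_. 0)" using j by (auto simp: proj_def std_vec_def)
      ultimately show ?thesis by (simp add: pullback_proj px \<beta> del: set_map)
    next
      case False
      then have "?L ! ?i \<in> set (nths ?L ({..<length ?L} - I))" unfolding set_nths using iL by blast
      then show ?thesis using Li j J
        by (intro disjI2 wedge_list_coord_eq_0[of "std_vec j"]) (auto simp: std_vec_def)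
    qed
    then show ?thesis unfolding wedge_def by (intro sum.neutral) auto
  qed
  then show ?thesis by (simp add: fiber_integral_def)
qed

text \<open>
  The point with coordinates \<open>(u, x)\<close> with respect to the chart \<open>c\<close> and the frame \<open>b\<close> of R^N,
  in the coordinates \<open>(u, y)\<close>.
\<close>

definition frame_to_std :: "nat \<Rightarrow> nat \<Rightarrow> 'p chart \<Rightarrow> ('p \<Rightarrow> rvec list) \<Rightarrow> rvec \<Rightarrow> rvec"
  where "frame_to_std d N c b z = (\<lambda>i. if i < d then z i
    else if i < d + N then lincomb (b (chart_inv c (proj d z))) (\<lambda>j. z (d + j)) (i - d)
    else 0)"

text \<open>
  The local expression of the fiber integral along \<open>V \<oplus> W \<rightarrow> V\<close> in the trivializations given by
  frames \<open>e\<close> of \<open>V\<close> and \<open>g\<close> of \<open>W\<close>; \<open>\<Phi>\<close> is a form in the coordinates \<open>(u, y)\<close>. The sign is 1 if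
  \<open>g\<close> is oriented; it matters for \<open>m = 0\<close>, when \<open>W\<close> may have no oriented frame.
\<close>

definition pushforward :: "nat \<Rightarrow> nat \<Rightarrow> nat \<Rightarrow> ('p \<Rightarrow> rvec list \<Rightarrow> real) \<Rightarrow> dform \<Rightarrow>
    'p chart \<Rightarrow> ('p \<Rightarrow> rvec list) \<Rightarrow> ('p \<Rightarrow> rvec list) \<Rightarrow> dform"
  where "pushforward d n m oW \<Phi> c e g = (\<lambda>z vs.
    oW (chart_inv c (proj d z)) (g (chart_inv c (proj d z))) *
    fiber_integral (d + n) m
      (pullback (d + (n + m)) (d + (n + m)) (frame_to_std d (n + m) c (\<lambda>p. e p @ g p)) \<Phi>) z vs)"

end

theory Submission
  imports Defs "HOL-Probability.Distributions"
begin

text \<open>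
  Both forms are computed at a point, in an orthonormal oriented frame \<open>e\<close> of \<open>V\<close> and an
  arbitrary frame \<open>g\<close> of \<open>W\<close>, with coordinates \<open>x\<close> and \<open>w\<close>. The position vector in R^N is
  \<open>y = \<Sum> x\<^sub>i e\<^sub>i + \<Sum> w\<^sub>j g\<^sub>j\<close>. On tangent vectors \<open>v\<^sub>b\<close> of \<open>V\<close> followed by the coordinate
  vectors of \<open>w\<close>, the form \<open>dy\<^sub>1 \<and> \<dots> \<and> dy\<^sub>N\<close> is the determinant with columns \<open>dy(v\<^sub>b)\<close> and
  \<open>g\<^sub>j\<close>. Since \<open>e\<close> is orthogonal to \<open>W\<close>, it equals \<open>det (e | g)\<close> times the determinant of the
  matrix \<open>\<langle>e\<^sub>i, dy(v\<^sub>b)\<rangle>\<close> (\<open>det_project\<close>).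

  On sections of \<open>V\<close> the connection \<open>d + 1/2 Q dQ\<close> is \<open>d\<close> followed by the projection to \<open>V\<close>
  (\<open>cov_deriv_eigen\<close>), so that \<open>\<theta>\<^sub>i\<^sub>j = \<langle>e\<^sub>i, de\<^sub>j\<rangle>\<close>. As \<open>\<langle>e\<^sub>i, g\<^sub>j\<rangle> = 0\<close>, also
  \<open>\<langle>e\<^sub>i, dg\<^sub>j\<rangle> = - \<langle>de\<^sub>i, g\<^sub>j\<rangle>\<close>, and the matrix entries are
  \<open>(dx + \<theta> x)\<^sub>i - \<langle>de\<^sub>i, y\<^sub>W\<rangle>\<close> with \<open>y\<^sub>W = \<Sum> w\<^sub>j g\<^sub>j\<close>. Fiber integration is therefore
  the expectation of a determinant of affine functions of the Gaussian vector \<open>y\<^sub>W\<close>. Expanding it,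
  and evaluating the moments by Wick's formula (\<open>wick\<close>), gives a sum over subsets \<open>I\<close> and over
  pairings of the complement of \<open>I\<close>. A pair \<open>i, j\<close> contributes the covariance, which is half the
  inner product of the projections of \<open>de\<^sub>i\<close> and \<open>de\<^sub>j\<close> to \<open>W\<close>. In the curvature
  \<open>\<Omega> = d\<theta> + \<theta> \<theta>\<close> the second derivatives of \<open>e\<close> cancel, and \<open>\<Omega>\<^sub>i\<^sub>j\<close> is the
  antisymmetrization of the same inner product (\<open>curvature_eq\<close>). Hence the two sums agree term by
  term: the permutations in the Mathai-Quillen form list every pairing \<open>2\<^sup>k k!\<close> times, and the
  remaining factor \<open>2\<^sup>k\<close> comes from the antisymmetrizations (\<open>Omega_part_alternate\<close>).

  The wedge products are handled by writing every form at the point as an alternating sum over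
  permutations, on which the wedge product becomes an ordinary product (\<open>wedge_alternate\<close>). An
  arbitrary frame \<open>g\<close> is reduced to an orthogonal one by shears of the coordinates \<open>w\<close>, which
  preserve Lebesgue measure and \<open>det (e | g)\<close> (\<open>orthogonalization\<close>).

  The agreement of the local expressions is a consequence. Two of them are, near a given point,
  fiber integrals of the same form in frames of \<open>V \<oplus> W\<close> with the same \<open>g\<close>. The
  transition function is thus the identity in \<open>w\<close>, and the integrands agree because both frames
  describe the same position vector (\<open>total_change\<close>).
\<close>

section \<open>Partial derivatives on open subsets of R^d\<close>

text \<open>
  A neighbourhood in the product topology constrains only finitely many coordinates, and points of
  \<open>Rn d\<close> vary in \<open>d\<close> coordinates only, so that cubes form a neighbourhood basis.
\<close>

lemma openin_Euclidean_space_cube: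
  assumes S: "openin (Euclidean_space d) S" and x: "x \<in> S"
  obtains \<epsilon> where "\<epsilon> > 0"
    and "\<And>y. y \<in> Rn d \<Longrightarrow> (\<And>i. i < d \<Longrightarrow> \<bar>y i - x i\<bar> < \<epsilon>) \<Longrightarrow> y \<in> S"
proof -
  obtain T where T: "openin (powertop_real UNIV) T" and ST: "S = T \<inter> {x. \<forall>i\<ge>d. x i = 0}"
    using S by (auto simp: Euclidean_space_def openin_subtopology)
  have "x \<in> T" using x ST by auto
  from product_topology_open_contains_basis[OF T this] obtain X where
    X: "x \<in> Pi\<^sub>E UNIV X" "\<And>i. open (X i)" "Pi\<^sub>E UNIV X \<subseteq> T" by auto
  have "\<exists>e>0. \<forall>t. \<bar>t - x i\<bar> < e \<longrightarrow> t \<in> X i" for i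
  proof -
    have "x i \<in> X i" using X(1) by (auto simp: PiE_iff)
    then show ?thesis using X(2)[of i] by (auto simp: open_dist dist_real_def)
  qed
  then obtain e where e: "\<And>i. e i > 0" "\<And>i t. \<bar>t - x i\<bar> < e i \<Longrightarrow> t \<in> X i" by metis
  let ?\<epsilon> = "Min (insert 1 (e ` {..<d}))"
  have "?\<epsilon> > 0" using e(1) by (auto simp: Min_gr_iff)
  moreover have "y \<in> S" if y: "y \<in> Rn d" "\<And>i. i < d \<Longrightarrow> \<bar>y i - x i\<bar> < ?\<epsilon>" for y
  proof -
    have "y i \<in> X i" for i
    proof (cases "i < d")
      case True
      then have "?\<epsilon> \<le> e i" by (intro Min_le) auto
      then show ?thesis using y(2)[OF True] e(2)[of "y i" i] by linarith
    next
      case False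
      then have "y i = x i" using y(1) x ST by (auto simp: topspace_Euclidean_space)
      then show ?thesis using X(1) by (auto simp: PiE_iff)
    qed
    then have "y \<in> T" using X(3) by (auto simp: PiE_iff)
    then show ?thesis using y(1) ST by (auto simp: topspace_Euclidean_space)
  qed
  ultimately show thesis using that by blast
qed

lemma continuous_on_cube:
  fixes f :: "rvec \<Rightarrow> real"
  assumes S: "openin (Euclidean_space d) S" and x: "x \<in> S" and f: "continuous_on S f" and e: "e > 0"
  obtains \<epsilon> where "\<epsilon> > 0"
    and "\<And>y. y \<in> Rn d \<Longrightarrow> (\<And>i. i < d \<Longrightarrow> \<bar>y i - x i\<bar> < \<epsilon>) \<Longrightarrow> y \<in> S \<and> \<bar>f y - f x\<bar> < e"
proof -
  have E: "Euclidean_space d = top_of_set {x. \<forall>i\<ge>d. x i = 0}"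
    by (simp add: Euclidean_space_def euclidean_product_topology)
  have "openin (top_of_set S) (S \<inter> f -` ball (f x) e)"
    using f by (intro continuous_openin_preimage_gen) auto
  then have "openin (Euclidean_space d) (S \<inter> f -` ball (f x) e)"
    using S unfolding E by (rule openin_trans)
  moreover have "x \<in> S \<inter> f -` ball (f x) e" using x e by simp
  ultimately obtain \<epsilon> where "\<epsilon> > 0"
    "\<And>y. y \<in> Rn d \<Longrightarrow> (\<And>i. i < d \<Longrightarrow> \<bar>y i - x i\<bar> < \<epsilon>) \<Longrightarrow> y \<in> S \<inter> f -` ball (f x) e"
    by (rule openin_Euclidean_space_cube) blast
  note \<epsilon> = this
  have "y \<in> S \<and> \<bar>f y - f x\<bar> < e" if "y \<in> Rn d" "\<And>i. i < d \<Longrightarrow> \<bar>y i - x i\<bar> < \<epsilon>" for y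
    using \<epsilon>(2)[OF that] by (simp add: dist_real_def abs_minus_commute)
  with \<epsilon>(1) show thesis by (rule that)
qed

lemma openin_Euclidean_space_subset: "openin (Euclidean_space d) S \<Longrightarrow> S \<subseteq> Rn d"
  by (rule openin_subset)

lemma upd_in_Rn: "x \<in> Rn d \<Longrightarrow> i < d \<Longrightarrow> x(i := t) \<in> Rn d"
  by (auto simp: topspace_Euclidean_space)

lemma eventually_upd_mem:
  assumes S: "openin (Euclidean_space d) S" and x: "x \<in> S" and i: "i < d"
  shows "\<forall>\<^sub>F t in nhds (x i). x(i := t) \<in> S"
proof -
  obtain \<epsilon> where e: "\<epsilon> > 0"
    "\<And>y. y \<in> Rn d \<Longrightarrow> (\<And>i. i < d \<Longrightarrow> \<bar>y i - x i\<bar> < \<epsilon>) \<Longrightarrow> y \<in> S"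
    using openin_Euclidean_space_cube[OF S x] by blast
  have xR: "x \<in> Rn d" using openin_Euclidean_space_subset[OF S] x by auto
  show ?thesis unfolding eventually_nhds_metric
    using e upd_in_Rn[OF xR i] by (intro exI[of _ \<epsilon>]) (auto simp: dist_real_def)
qed

text \<open>
  The constant \<^const>\<open>partial\<close> has a value even where the derivative does not exist; here the
  existence is part of the statement.
\<close>

definition has_partial :: "nat \<Rightarrow> (rvec \<Rightarrow> real) \<Rightarrow> rvec \<Rightarrow> real \<Rightarrow> bool"
  where "has_partial i f x D \<longleftrightarrow> ((\<lambda>t. f (x(i := t))) has_real_derivative D) (at (x i))"

lemma has_partial_partial: "has_partial i f x D \<Longrightarrow> partial i f x = D"
  unfolding has_partial_def partial_def by (rule DERIV_imp_deriv)

lemma has_partial_const: "has_partial i (\<lambda>_. c) x 0"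
  by (simp add: has_partial_def)

lemma has_partial_add:
  "has_partial i f x D \<Longrightarrow> has_partial i g x E \<Longrightarrow> has_partial i (\<lambda>z. f z + g z) x (D + E)"
  unfolding has_partial_def by (rule DERIV_add)

lemma has_partial_mult:
  "has_partial i f x D \<Longrightarrow> has_partial i g x E \<Longrightarrow>
    has_partial i (\<lambda>z. f z * g z) x (D * g x + f x * E)"
  unfolding has_partial_def
  by (drule (1) DERIV_mult) (simp add: mult.commute add.commute)



lemma has_partial_sum:
  assumes "\<And>k. k \<in> K \<Longrightarrow> has_partial i (f k) x (D k)"
  shows "has_partial i (\<lambda>z. \<Sum>k\<in>K. f k z) x (\<Sum>k\<in>K. D k)"
  using assms unfolding has_partial_def by (intro DERIV_sum) auto

lemma has_partial_cong_ev:
  assumes "\<forall>\<^sub>F t in nhds (x i). f (x(i := t)) = g (x(i := t))"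
  shows "has_partial i f x D \<longleftrightarrow> has_partial i g x D"
  unfolding has_partial_def by (intro DERIV_cong_ev assms) auto

lemma partial_cong_ev:
  assumes "\<forall>\<^sub>F t in nhds (x i). f (x(i := t)) = g (x(i := t))"
  shows "partial i f x = partial i g x"
  unfolding partial_def by (intro deriv_cong_ev assms refl)

lemma partial_cong_open:
  assumes "openin (Euclidean_space d) S" "x \<in> S" "i < d" and "\<And>z. z \<in> S \<Longrightarrow> f z = g z"
  shows "partial i f x = partial i g x"
  by (rule partial_cong_ev, rule eventually_mono[OF eventually_upd_mem[OF assms(1-3)]]) (rule assms(4))

lemma has_partial_cong_open:
  assumes "openin (Euclidean_space d) S" "x \<in> S" "i < d" and "\<And>z. z \<in> S \<Longrightarrow> f z = g z"
  shows "has_partial i f x D \<longleftrightarrow> has_partial i g x D"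
  by (rule has_partial_cong_ev, rule eventually_mono[OF eventually_upd_mem[OF assms(1-3)]])
    (rule assms(4))

lemma smooth_on_continuous: "smooth_on d S f \<Longrightarrow> continuous_on S f"
  unfolding smooth_on_def by (drule spec[of _ "[]"]) simp

lemma smooth_on_has_partial:
  assumes "smooth_on d S f" "x \<in> S" "i < d"
  shows "has_partial i f x (partial i f x)"
proof -
  have "(\<lambda>t. f (x(i := t))) differentiable (at (x i))"
    using assms unfolding smooth_on_def by (auto dest: spec[of _ "[]"])
  then show ?thesis
    unfolding has_partial_def partial_def by (simp add: DERIV_deriv_iff_real_differentiable)
qed

lemma smooth_on_partial:
  assumes "smooth_on d S f" "i < d"
  shows "smooth_on d S (partial i f)"
  unfolding smooth_on_def
proof (intro allI impI)
  fix js assume "set js \<subseteq> {..<d}"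
  then have "set (js @ [i]) \<subseteq> {..<d}" using assms(2) by auto
  then show "continuous_on S (foldr partial js (partial i f)) \<and>
      (\<forall>ia<d. \<forall>x\<in>S. (\<lambda>t. foldr partial js (partial i f) (x(ia := t))) differentiable at (x ia))"
    using assms(1) unfolding smooth_on_def by (auto dest!: spec[of _ "js @ [i]"])
qed

lemma smooth_on_subset: "smooth_on d S f \<Longrightarrow> T \<subseteq> S \<Longrightarrow> smooth_on d T f"
  unfolding smooth_on_def by (meson continuous_on_subset subsetD)

lemma smooth_on_DERIV:
  assumes "smooth_on d S f" "i < d" "x(i := t) \<in> S"
  shows "((\<lambda>s. f (x(i := s))) has_real_derivative partial i f (x(i := t))) (at t)"
  using smooth_on_has_partial[OF assms(1,3,2)] by (simp add: has_partial_def)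

text \<open>
  Both orders of differentiation compute the same second difference of \<open>f\<close> over a small square:
  applying the mean value theorem twice gives \<open>h\<^sup>2\<close> times a mixed partial derivative at a point
  of the square.
\<close>

lemma second_difference:
  assumes f: "smooth_on d S f" and ij: "i < d" "j < d" "i \<noteq> j" and h: "0 < h" and x: "x \<in> Rn d"
    and cube: "\<And>y. y \<in> Rn d \<Longrightarrow> (\<And>k. k < d \<Longrightarrow> \<bar>y k - x k\<bar> \<le> h) \<Longrightarrow> y \<in> S"
  obtains y where "y \<in> Rn d" "\<And>k. k < d \<Longrightarrow> \<bar>y k - x k\<bar> \<le> h"
    "f (x(i := x i + h, j := x j + h)) - f (x(i := x i + h)) - f (x(j := x j + h)) + f x =
      h * (h * partial j (partial i f) y)"
proof -
  let ?F = "\<lambda>s t. f (x(j := t, i := s))"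
  let ?Fi = "\<lambda>s t. partial i f (x(j := t, i := s))"
  have mem: "x(j := t, i := s) \<in> S" if "x i \<le> s" "s \<le> x i + h" "x j \<le> t" "t \<le> x j + h" for s t
    using that ij x h by (intro cube upd_in_Rn) auto
  have mem4: "x(i := s) \<in> S" if "x i \<le> s" "s \<le> x i + h" for s
    using mem[of s "x j"] that h by simp
  have "\<exists>z>x i. z < x i + h \<and> (?F (x i + h) (x j + h) - ?F (x i + h) (x j)) -
      (?F (x i) (x j + h) - ?F (x i) (x j)) = (x i + h - x i) * (?Fi z (x j + h) - ?Fi z (x j))"
    by (rule MVT2) (use h in \<open>auto intro!: DERIV_diff smooth_on_DERIV[OF f] mem mem4 ij simp del: fun_upd_apply\<close>)
  then obtain s where s: "x i < s" "s < x i + h" and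
    1: "(?F (x i + h) (x j + h) - ?F (x i + h) (x j)) -
      (?F (x i) (x j + h) - ?F (x i) (x j)) = h * (?Fi s (x j + h) - ?Fi s (x j))" by auto
  have tw: "x(j := t, i := s) = (x(i := s))(j := t)" for t using ij(3) by (simp add: fun_upd_twist)
  have mem3: "(x(i := s))(j := t) \<in> S" if "x j \<le> t" "t \<le> x j + h" for t
    using mem[of s t] s that unfolding tw by simp
  have "\<exists>z>x j. z < x j + h \<and> ?Fi s (x j + h) - ?Fi s (x j) =
      (x j + h - x j) * partial j (partial i f) ((x(i := s))(j := z))"
    unfolding tw
    by (rule MVT2) (use h in \<open>auto intro!: smooth_on_DERIV[OF smooth_on_partial[OF f]] ij mem3 simp del: fun_upd_apply\<close>)
  then obtain t where t: "x j < t" "t < x j + h" and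
    2: "?Fi s (x j + h) - ?Fi s (x j) = h * partial j (partial i f) (x(j := t, i := s))"
    by (auto simp: tw)
  show thesis
  proof (rule that[of "x(j := t, i := s)"])
    show "x(j := t, i := s) \<in> Rn d" using x ij by (intro upd_in_Rn)
    show "\<bar>(x(j := t, i := s)) k - x k\<bar> \<le> h" for k using s t h by auto
    have "x(j := x j, i := s) = x(i := s)" "x(j := t, i := x i) = x(j := t)" for s t
      using ij(3) by auto
    then show "f (x(i := x i + h, j := x j + h)) - f (x(i := x i + h)) - f (x(j := x j + h)) + f x =
      h * (h * partial j (partial i f) (x(j := t, i := s)))"
      using 1 2 ij(3) by (simp add: fun_upd_twist)
  qed
qed

text \<open>
  The second difference is symmetric in \<open>i\<close> and \<open>j\<close>, so that the two mixed partial derivatives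
  agree at two points of an arbitrarily small cube; continuity does the rest.
\<close>

lemma partial_commute:
  assumes S: "openin (Euclidean_space d) S" and f: "smooth_on d S f" and x: "x \<in> S"
    and ij: "i < d" "j < d"
  shows "partial i (partial j f) x = partial j (partial i f) x"
proof (cases "i = j")
  case False
  let ?P = "partial i (partial j f)" and ?R = "partial j (partial i f)"
  have xR: "x \<in> Rn d" using openin_Euclidean_space_subset[OF S] x by auto
  have cP: "continuous_on S ?P" "continuous_on S ?R"
    by (intro smooth_on_continuous[OF smooth_on_partial[OF smooth_on_partial[OF f]]] ij)+
  have "\<bar>?P x - ?R x\<bar> \<le> e" if "e > 0" for e
  proof -
    have e': "e / 2 > 0" using that by simp
    obtain \<epsilon>1 where e1: "\<epsilon>1 > 0" "\<And>y. y \<in> Rn d \<Longrightarrow> (\<And>i. i < d \<Longrightarrow> \<bar>y i - x i\<bar> < \<epsilon>1) \<Longrightarrow>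
        y \<in> S \<and> \<bar>?P y - ?P x\<bar> < e / 2"
      using continuous_on_cube[OF S x cP(1) e'] by blast
    obtain \<epsilon>2 where e2: "\<epsilon>2 > 0" "\<And>y. y \<in> Rn d \<Longrightarrow> (\<And>i. i < d \<Longrightarrow> \<bar>y i - x i\<bar> < \<epsilon>2) \<Longrightarrow>
        y \<in> S \<and> \<bar>?R y - ?R x\<bar> < e / 2"
      using continuous_on_cube[OF S x cP(2) e'] by blast
    define h where "h = min \<epsilon>1 \<epsilon>2 / 2"
    have h: "0 < h" "h < \<epsilon>1" "h < \<epsilon>2" using e1(1) e2(1) by (auto simp: h_def)
    have cube: "y \<in> S" if "y \<in> Rn d" "\<And>k. k < d \<Longrightarrow> \<bar>y k - x k\<bar> \<le> h" for y
      using e1(2)[OF that(1)] that(2) h(2) by (meson le_less_trans)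
    obtain y where y: "y \<in> Rn d" "\<And>k. k < d \<Longrightarrow> \<bar>y k - x k\<bar> \<le> h"
      "f (x(i := x i + h, j := x j + h)) - f (x(i := x i + h)) - f (x(j := x j + h)) + f x =
        h * (h * ?R y)"
      using second_difference[OF f ij False h(1) xR cube] by blast
    obtain y' where y': "y' \<in> Rn d" "\<And>k. k < d \<Longrightarrow> \<bar>y' k - x k\<bar> \<le> h"
      "f (x(j := x j + h, i := x i + h)) - f (x(j := x j + h)) - f (x(i := x i + h)) + f x =
        h * (h * ?P y')"
      using second_difference[OF f ij(2,1) False[symmetric] h(1) xR cube] by blast
    have "f (x(j := x j + h, i := x i + h)) = f (x(i := x i + h, j := x j + h))"
      using False by (simp add: fun_upd_twist)
    then have "h * (h * ?P y') = h * (h * ?R y)" using y(3) y'(3) by linarith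
    then have "?P y' = ?R y" using h(1) by simp
    moreover have "\<bar>?P y' - ?P x\<bar> < e / 2" using e1(2)[OF y'(1)] y'(2) h(2) by (meson le_less_trans)
    moreover have "\<bar>?R y - ?R x\<bar> < e / 2" using e2(2)[OF y(1)] y(2) h(3) by (meson le_less_trans)
    ultimately show ?thesis by linarith
  qed
  then have "\<bar>?P x - ?R x\<bar> \<le> 0" by (rule field_le_epsilon[of _ 0, simplified]) auto
  then show ?thesis by simp
qed simp

lemma MVT_between:
  fixes f :: "real \<Rightarrow> real"
  assumes "\<And>s. min a b \<le> s \<Longrightarrow> s \<le> max a b \<Longrightarrow> (f has_real_derivative f' s) (at s)"
  obtains s where "min a b \<le> s" "s \<le> max a b" "f b - f a = (b - a) * f' s"
proof -
  consider "a < b" | "a = b" | "b < a" by linarith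
  then show thesis
  proof cases
    case 1
    then obtain z where "z > a" "z < b" "f b - f a = (b - a) * f' z"
      using MVT2[of a b f f'] assms by (auto simp: min_def max_def)
    then show thesis using 1 by (intro that[of z]) auto
  next
    case 2
    then show thesis using that[of a] by simp
  next
    case 3
    then obtain z where "z > b" "z < a" "f a - f b = (a - b) * f' z"
      using MVT2[of b a f f'] assms by (auto simp: min_def max_def)
    then show thesis using 3 by (intro that[of z]) (auto simp: algebra_simps)
  qed
qed

text \<open>
  Chain rule: the path from \<open>\<gamma> t\<^sub>0\<close> to \<open>\<gamma> t\<close> is replaced by one that changes a coordinate at
  a time; the change of \<open>f\<close> along each edge is given by the mean value theorem.
\<close>

lemma DERIV_along_curve:
  assumes S: "openin (Euclidean_space d) S" and f: "smooth_on d S f"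
    and x: "\<gamma> t0 \<in> S"
    and \<gamma>: "\<And>k. k < d \<Longrightarrow> ((\<lambda>t. \<gamma> t k) has_real_derivative \<gamma>' k) (at t0)"
    and R: "\<forall>\<^sub>F t in nhds t0. \<gamma> t \<in> Rn d"
  shows "((\<lambda>t. f (\<gamma> t)) has_real_derivative (\<Sum>k<d. partial k f (\<gamma> t0) * \<gamma>' k)) (at t0)"
proof -
  define x where "x = \<gamma> t0"
  have xS: "x \<in> S" and xR: "x \<in> Rn d"
    using x openin_Euclidean_space_subset[OF S] by (auto simp: x_def)
  define mix where "mix m t = (\<lambda>k. if k < m then \<gamma> t k else x k)" for m t
  have "((\<lambda>t. f (mix m t)) has_real_derivative (\<Sum>k<m. partial k f x * \<gamma>' k)) (at t0)"
    if "m \<le> d" for m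
    using that
  proof (induction m)
    case 0
    then show ?case by (simp add: mix_def)
  next
    case (Suc m)
    then have m: "m < d" by simp
    \<comment> \<open>The value where the increment vanishes makes \<open>r\<close> continuous at \<open>t\<^sub>0\<close>.\<close>
    define r where "r t = (if \<gamma> t m = x m then partial m f x
      else (f (mix (Suc m) t) - f (mix m t)) / (\<gamma> t m - x m))" for t
    have mixS: "mix (Suc m) t = (mix m t)(m := \<gamma> t m)" "mix m t = (mix m t)(m := x m)" for t
      by (auto simp: mix_def)
    have r: "f (mix (Suc m) t) - f (mix m t) = r t * (\<gamma> t m - x m)" for t
      using mixS[of t] by (auto simp: r_def)
    have "isCont r t0"
      unfolding continuous_at_eps_delta
    proof (intro allI impI)
      fix e :: real assume "e > 0"
      then obtain \<delta> where \<delta>: "\<delta> > 0" "\<And>y. y \<in> Rn d \<Longrightarrow> (\<And>i. i < d \<Longrightarrow> \<bar>y i - x i\<bar> < \<delta>) \<Longrightarrow>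
          y \<in> S \<and> \<bar>partial m f y - partial m f x\<bar> < e"
        using continuous_on_cube[OF S xS smooth_on_continuous[OF smooth_on_partial[OF f m]]] by blast
      have "\<forall>\<^sub>F t in nhds t0. \<bar>\<gamma> t k - x k\<bar> < \<delta>" if "k < d" for k
      proof -
        have "isCont (\<lambda>t. \<gamma> t k) t0" using \<gamma>[OF that] by (rule DERIV_isCont)
        then have "((\<lambda>t. \<gamma> t k) \<longlongrightarrow> x k) (nhds t0)"
          by (simp add: x_def isCont_def tendsto_nhds_iff)
        then show ?thesis using \<delta>(1) by (auto dest: tendstoD simp: dist_real_def)
      qed
      then have "\<forall>\<^sub>F t in nhds t0. \<forall>k\<in>{..<d}. \<bar>\<gamma> t k - x k\<bar> < \<delta>"
        by (intro eventually_ball_finite) auto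
      then have "\<forall>\<^sub>F t in nhds t0. \<bar>r t - r t0\<bar> < e"
        using R
      proof eventually_elim
        case (elim t)
        have mem: "(mix m t)(m := s) \<in> Rn d \<and> (\<forall>k<d. \<bar>((mix m t)(m := s)) k - x k\<bar> < \<delta>)"
          if "min (x m) (\<gamma> t m) \<le> s" "s \<le> max (x m) (\<gamma> t m)" for s
        proof
          show "(mix m t)(m := s) \<in> Rn d"
            using xR m by (auto simp: mix_def topspace_Euclidean_space)
          have "\<bar>\<gamma> t m - x m\<bar> < \<delta>" using elim(1) m by simp
          then have "\<bar>s - x m\<bar> < \<delta>" using that by linarith
          then show "\<forall>k<d. \<bar>((mix m t)(m := s)) k - x k\<bar> < \<delta>"
            using elim(1) \<delta>(1) by (auto simp: mix_def)
        qed
        obtain s where s: "min (x m) (\<gamma> t m) \<le> s" "s \<le> max (x m) (\<gamma> t m)"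
          and fs: "f ((mix m t)(m := \<gamma> t m)) - f ((mix m t)(m := x m)) =
            (\<gamma> t m - x m) * partial m f ((mix m t)(m := s))"
          by (rule MVT_between[of "x m" "\<gamma> t m" "\<lambda>s. f ((mix m t)(m := s))"
                "\<lambda>s. partial m f ((mix m t)(m := s))"])
            (use mem \<delta>(2) in \<open>auto intro!: smooth_on_DERIV[OF f m]\<close>)
        have "r t0 = partial m f x" by (simp add: r_def x_def)
        moreover have "r t = partial m f x \<or> r t = partial m f ((mix m t)(m := s))"
          using fs mixS[of t] by (auto simp: r_def)
        moreover have "\<bar>partial m f ((mix m t)(m := s)) - partial m f x\<bar> < e"
          using \<delta>(2) mem[OF s] by blast
        ultimately show ?case using \<open>e > 0\<close> by auto
      qed
      then show "\<exists>d>0. \<forall>x'. dist x' t0 < d \<longrightarrow> dist (r x') (r t0) < e"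
        by (simp add: eventually_nhds_metric dist_real_def)
    qed
    moreover obtain q where q: "\<And>t. \<gamma> t m - \<gamma> t0 m = q t * (t - t0)" "isCont q t0" "q t0 = \<gamma>' m"
      using \<gamma>[OF m] unfolding CARAT_DERIV by blast
    ultimately have "((\<lambda>t. f (mix (Suc m) t) - f (mix m t)) has_real_derivative r t0 * q t0) (at t0)"
      unfolding CARAT_DERIV using r
      by (intro exI[of _ "\<lambda>t. r t * q t"]) (auto simp: x_def r intro!: continuous_intros)
    from DERIV_add[OF this Suc.IH] show ?case
      using m q(3) by (simp add: r_def x_def add.commute)
  qed
  from this[of d] have "((\<lambda>t. f (mix d t)) has_real_derivative (\<Sum>k<d. partial k f x * \<gamma>' k)) (at t0)"
    by simp
  moreover have "\<forall>\<^sub>F t in nhds t0. f (mix d t) = f (\<gamma> t)"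
    using R
  proof eventually_elim
    case (elim t)
    then have "mix d t = \<gamma> t" using xR by (auto simp: mix_def topspace_Euclidean_space)
    then show ?case by simp
  qed
  ultimately show ?thesis unfolding x_def by (simp cong: DERIV_cong_ev)
qed

section \<open>Alternating sums and wedge products\<close>

text \<open>
  The normalization, without \<open>1 / p!\<close>, is the one of a wedge product of \<open>p\<close> 1-forms; with it the
  wedge product of two alternating sums has no numerical factor.
\<close>

definition alternate :: "nat \<Rightarrow> ('a list \<Rightarrow> real) \<Rightarrow> 'a list \<Rightarrow> real"
  where "alternate p f vs = (if length vs = p
    then \<Sum>\<sigma> | \<sigma> permutes {..<p}. of_int (sign \<sigma>) * f (permute_list \<sigma> vs) else 0)"

lemma alternate_cong:
  assumes "\<And>us. length us = p \<Longrightarrow> set us = set vs \<Longrightarrow> f us = g us"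
  shows "alternate p f vs = alternate p g vs"
  unfolding alternate_def using assms by (auto intro!: sum.cong)

lemma alternate_length: "length vs \<noteq> p \<Longrightarrow> alternate p f vs = 0"
  by (simp add: alternate_def)

lemma alternate_cmult: "alternate p (\<lambda>us. c * f us) vs = c * alternate p f vs"
  by (simp add: alternate_def sum_distrib_left mult_ac)

lemma alternate_sum: "alternate p (\<lambda>us. \<Sum>k\<in>K. f k us) vs = (\<Sum>k\<in>K. alternate p (f k) vs)"
  by (auto simp: alternate_def sum_distrib_left intro: sum.swap)

lemma alternate_map:
  "alternate p f (map h vs) = alternate p (\<lambda>us. f (map h us)) vs"
  by (auto simp: alternate_def permute_list_map intro!: sum.cong)

lemma permutes_lessThan_permutation: "\<sigma> permutes {..<n::nat} \<Longrightarrow> permutation \<sigma>"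
  by (rule permutes_imp_permutation) auto

lemma alternate_permute:
  assumes \<sigma>: "\<sigma> permutes {..<p}"
  shows "alternate p (\<lambda>us. f (permute_list \<sigma> us)) vs = of_int (sign \<sigma>) * alternate p f vs"
proof (cases "length vs = p")
  case True
  have "(\<Sum>\<tau> | \<tau> permutes {..<p}. of_int (sign \<tau>) * f (permute_list \<tau> vs)) =
      (\<Sum>\<tau> | \<tau> permutes {..<p}. of_int (sign (\<tau> \<circ> \<sigma>)) * f (permute_list (\<tau> \<circ> \<sigma>) vs))"
    by (rule sum_permutations_compose_right[OF \<sigma>])
  also have "\<dots> = (\<Sum>\<tau> | \<tau> permutes {..<p}. of_int (sign \<sigma>) *
      (of_int (sign \<tau>) * f (permute_list \<sigma> (permute_list \<tau> vs))))"
    using \<sigma> by (intro sum.cong)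
      (auto simp: sign_compose permutes_lessThan_permutation permute_list_compose True)
  finally have "alternate p f vs = of_int (sign \<sigma>) * alternate p (\<lambda>us. f (permute_list \<sigma> us)) vs"
    by (simp add: alternate_def True sum_distrib_left)
  then show ?thesis by (simp flip: mult.assoc of_int_mult)
qed (simp add: alternate_def)

definition shuffle_perm :: "nat \<Rightarrow> nat set \<Rightarrow> nat \<Rightarrow> nat"
  where "shuffle_perm n I = (\<lambda>i. if i < n
    then (sorted_list_of_set I @ sorted_list_of_set ({..<n} - I)) ! i else i)"

lemma shuffle_sign_perm: "shuffle_sign n I = of_int (sign (shuffle_perm n I))"
  by (simp add: shuffle_sign_def shuffle_perm_def)

lemma shuffle_perm_permutes:
  assumes "I \<subseteq> {..<n}"
  shows "shuffle_perm n I permutes {..<n}"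
proof (rule bij_imp_permutes)
  let ?L = "sorted_list_of_set I @ sorted_list_of_set ({..<n} - I)"
  have fin: "finite I" using assms by (rule finite_subset) simp
  have "card I \<le> n" using card_mono[OF _ assms] by simp
  then have len: "length ?L = n" using assms fin by (simp add: card_Diff_subset)
  have "bij_betw ((!) ?L) {..<length ?L} (set ?L)"
    by (rule bij_betw_nth) (use fin in auto)
  moreover have "set ?L = {..<n}" using assms fin by auto
  ultimately have "bij_betw ((!) ?L) {..<n} {..<n}" using len by simp
  then show "bij_betw (shuffle_perm n I) {..<n} {..<n}"
    by (rule bij_betw_cong[THEN iffD1, rotated]) (simp add: shuffle_perm_def)
qed (simp add: shuffle_perm_def)

lemma shuffle_perm_image:
  assumes "I \<subseteq> {..<n}"
  shows "shuffle_perm n I ` {..<card I} = I"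
proof -
  have fin: "finite I" using assms by (rule finite_subset) simp
  have "card I \<le> n" using card_mono[OF _ assms] by simp
  then have "shuffle_perm n I ` {..<card I} = (!) (sorted_list_of_set I) ` {..<length (sorted_list_of_set I)}"
    using fin by (intro image_cong) (auto simp: shuffle_perm_def nth_append)
  also have "\<dots> = set (sorted_list_of_set I)" by (auto simp: set_conv_nth)
  finally show ?thesis using fin by simp
qed

lemma nths_sorted_list:
  assumes "I \<subseteq> {..<length vs}"
  shows "nths vs I = map ((!) vs) (sorted_list_of_set I)"
proof -
  have "sorted_list_of_set I = filter (\<lambda>i. i \<in> I) [0..<length vs]"
  proof (rule sorted_distinct_set_unique[symmetric])
    show "set (filter (\<lambda>i. i \<in> I) [0..<length vs]) = set (sorted_list_of_set I)"
      using assms finite_subset[OF assms] by auto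
  qed (auto intro!: sorted_wrt_filter)
  moreover have "nths vs I = map ((!) vs) (filter (\<lambda>i. i \<in> I) [0..<length vs])"
    unfolding nths_def
    by (subst (2) map_nth[symmetric], subst zip_map1) (simp add: filter_map o_def zip_same_conv_map)
  ultimately show ?thesis by simp
qed

lemma permute_list_shuffle:
  assumes I: "I \<subseteq> {..<length vs}"
  shows "permute_list (shuffle_perm (length vs) I) vs = nths vs I @ nths vs ({..<length vs} - I)"
proof -
  have fin: "finite I" using I by (rule finite_subset) simp
  have le: "card I \<le> length vs" using card_mono[OF _ I] by simp
  let ?L = "sorted_list_of_set I @ sorted_list_of_set ({..<length vs} - I)"
  have len: "length ?L = length vs"
    using le fin I by (simp add: card_Diff_subset)
  have "permute_list (shuffle_perm (length vs) I) vs = map ((!) vs) ?L"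
    by (rule nth_equalityI) (use len in \<open>auto simp: permute_list_def shuffle_perm_def simp del: map_append\<close>)
  then show ?thesis using I by (simp add: nths_sorted_list)
qed

text \<open>
  The Young subgroup. Its elements are determined by their restrictions to the two segments; the
  second one is renumbered to start at 0.
\<close>

lemma bij_betw_Young:
  fixes p q :: nat
  shows "bij_betw (\<lambda>(\<sigma>1, \<sigma>2). \<sigma>1 \<circ> map_permutation {..<q} (\<lambda>i. p + i) \<sigma>2)
    ({\<sigma>. \<sigma> permutes {..<p}} \<times> {\<sigma>. \<sigma> permutes {..<q}})
    {\<rho>. \<rho> permutes {..<p + q} \<and> \<rho> ` {..<p} = {..<p}}"
proof -
  let ?m = "map_permutation {..<q} (\<lambda>i. p + i)"
  let ?B = "{p..<p+q}"
  have b: "bij_betw (\<lambda>i. p + i) {..<q} ?B"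
    by (rule bij_betwI[where g="\<lambda>i. i - p"]) auto
  then have im: "(\<lambda>i. p + i) ` {..<q} = ?B" by (simp add: bij_betw_def)
  have bm: "bij_betw ?m {\<sigma>. \<sigma> permutes {..<q}} {\<sigma>. \<sigma> permutes ?B}"
    using bij_betw_permutations[OF b]
    by (simp add: map_permutation_def[abs_def] restrict_id_def[abs_def] o_def im)
  have bY: "bij_betw (\<lambda>(\<sigma>1, \<sigma>2). \<sigma>1 \<circ> \<sigma>2) ({\<sigma>. \<sigma> permutes {..<p}} \<times> {\<sigma>. \<sigma> permutes ?B})
    {\<rho>. \<rho> permutes {..<p + q} \<and> \<rho> ` {..<p} = {..<p}}"
  proof (rule bij_betwI[where g="\<lambda>\<rho>. (restrict_id \<rho> {..<p}, restrict_id \<rho> ?B)"])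
    show "(\<lambda>(\<sigma>1, \<sigma>2). \<sigma>1 \<circ> \<sigma>2) \<in> {\<sigma>. \<sigma> permutes {..<p}} \<times> {\<sigma>. \<sigma> permutes ?B} \<rightarrow>
        {\<rho>. \<rho> permutes {..<p + q} \<and> \<rho> ` {..<p} = {..<p}}"
    proof (clarsimp)
      fix \<sigma>1 \<sigma>2 assume 1: "\<sigma>1 permutes {..<p}" and 2: "\<sigma>2 permutes ?B"
      have "\<sigma>2 ` {..<p} = {..<p}" using 2 by (force simp: permutes_not_in)
      then have "\<sigma>1 ` \<sigma>2 ` {..<p} = {..<p}" using permutes_image[OF 1] by simp
      moreover have "\<sigma>1 \<circ> \<sigma>2 permutes {..<p + q}"
        by (intro permutes_compose permutes_subset[OF 1] permutes_subset[OF 2]) auto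
      ultimately show "\<sigma>1 \<circ> \<sigma>2 permutes {..<p + q} \<and> (\<lambda>x. \<sigma>1 (\<sigma>2 x)) ` {..<p} = {..<p}"
        by (simp add: image_image)
    qed
    show "(\<lambda>\<rho>. (restrict_id \<rho> {..<p}, restrict_id \<rho> ?B)) \<in>
        {\<rho>. \<rho> permutes {..<p + q} \<and> \<rho> ` {..<p} = {..<p}} \<rightarrow>
        {\<sigma>. \<sigma> permutes {..<p}} \<times> {\<sigma>. \<sigma> permutes ?B}"
    proof (clarsimp, intro conjI permutes_restrict_id)
      fix \<rho> assume r: "\<rho> permutes {..<p + q}" "\<rho> ` {..<p} = {..<p}"
      have inj: "inj_on \<rho> X" for X using permutes_inj[OF r(1)] by (auto simp: inj_on_def)
      then show "bij_betw \<rho> {..<p} {..<p}" using r(2) by (simp add: bij_betw_def)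
      have B: "?B = {..<p + q} - {..<p}" by auto
      have "\<rho> ` ?B = \<rho> ` {..<p + q} - \<rho> ` {..<p}"
        unfolding B using inj[of UNIV] by (intro image_set_diff)
      also have "\<dots> = ?B" using permutes_image[OF r(1)] r(2) B by simp
      finally show "bij_betw \<rho> ?B ?B" using inj by (simp add: bij_betw_def)
    qed
    fix x assume "x \<in> {\<sigma>. \<sigma> permutes {..<p}} \<times> {\<sigma>. \<sigma> permutes ?B}"
    then obtain \<sigma>1 \<sigma>2 where x: "x = (\<sigma>1, \<sigma>2)" and
      1: "\<sigma>1 permutes {..<p}" and 2: "\<sigma>2 permutes ?B" by auto
    have "restrict_id (\<sigma>1 \<circ> \<sigma>2) {..<p} = \<sigma>1"
      using permutes_not_in[OF 2] permutes_not_in[OF 1] by (auto simp: restrict_id_def)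
    moreover have "restrict_id (\<sigma>1 \<circ> \<sigma>2) ?B = \<sigma>2"
    proof
      fix i
      have "\<sigma>2 i \<in> ?B \<longleftrightarrow> i \<in> ?B" by (rule permutes_in_image[OF 2])
      then show "restrict_id (\<sigma>1 \<circ> \<sigma>2) ?B i = \<sigma>2 i"
        using permutes_not_in[OF 2, of i] permutes_not_in[OF 1, of "\<sigma>2 i"] by (auto simp: restrict_id_def)
    qed
    ultimately show "(restrict_id ((\<lambda>(\<sigma>1, \<sigma>2). \<sigma>1 \<circ> \<sigma>2) x) {..<p},
        restrict_id ((\<lambda>(\<sigma>1, \<sigma>2). \<sigma>1 \<circ> \<sigma>2) x) ?B) = x" by (simp add: x)
  next
    fix \<rho> assume "\<rho> \<in> {\<rho>. \<rho> permutes {..<p + q} \<and> \<rho> ` {..<p} = {..<p}}"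
    then have r: "\<rho> permutes {..<p + q}" "\<rho> ` {..<p} = {..<p}" by auto
    have "\<rho> i \<in> \<rho> ` {..<p} \<longleftrightarrow> i \<in> {..<p}" for i
      using permutes_inj[OF r(1)] by (simp add: inj_image_mem_iff)
    then have lt: "\<rho> i < p \<longleftrightarrow> i < p" for i using r(2) by simp
    show "(case (restrict_id \<rho> {..<p}, restrict_id \<rho> ?B) of (\<sigma>1, \<sigma>2) \<Rightarrow> \<sigma>1 \<circ> \<sigma>2) = \<rho>"
      using permutes_not_in[OF r(1)] lt by (auto simp: restrict_id_def fun_eq_iff)
  qed
  have "bij_betw (map_prod id ?m) ({\<sigma>. \<sigma> permutes {..<p}} \<times> {\<sigma>. \<sigma> permutes {..<q}})
      ({\<sigma>. \<sigma> permutes {..<p}} \<times> {\<sigma>. \<sigma> permutes ?B})"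
    by (intro bij_betw_map_prod bm) (simp add: bij_betw_def)
  from bij_betw_trans[OF this bY] show ?thesis
    by (rule bij_betw_cong[THEN iffD1, rotated]) auto
qed

text \<open>
  The permutations \<open>\<tau>\<close> of \<open>p + q\<close> letters are sorted by the image \<open>I\<close> of the first \<open>p\<close>: those with
  a given \<open>I\<close> form a coset of the Young subgroup, represented by the shuffle of \<open>I\<close>.
\<close>

lemma wedge_alternate:
  assumes \<alpha>: "\<And>us. \<alpha> x us = alternate p f us" and \<beta>: "\<And>us. \<beta> x us = alternate q g us"
  shows "wedge \<alpha> \<beta> x vs = alternate (p + q) (\<lambda>us. f (take p us) * g (drop p us)) vs"
proof (cases "length vs = p + q")
  case False
  have "shuffle_sign (length vs) I * \<alpha> x (nths vs I) * \<beta> x (nths vs ({..<length vs} - I)) = 0"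
    if I: "I \<in> Pow {..<length vs}" for I
  proof -
    have fin: "finite I" using I by (auto intro: finite_subset)
    have "card I \<le> length vs" using card_mono[of "{..<length vs}" I] I by simp
    moreover have "length (nths vs I) = card I" "length (nths vs ({..<length vs} - I)) = length vs - card I"
      using I fin by (simp_all add: nths_sorted_list card_Diff_subset)
    ultimately show ?thesis using False by (auto simp: \<alpha> \<beta> alternate_def)
  qed
  then have "wedge \<alpha> \<beta> x vs = 0" unfolding wedge_def by (intro sum.neutral ballI)
  then show ?thesis using False by (simp add: alternate_length)
next
  case True
  let ?T = "{\<tau>. \<tau> permutes {..<p + q}}"
  let ?F = "\<lambda>\<tau>. of_int (sign \<tau>) * (f (take p (permute_list \<tau> vs)) * g (drop p (permute_list \<tau> vs)))"
  let ?G = "\<lambda>I. shuffle_sign (p + q) I * \<alpha> x (nths vs I) * \<beta> x (nths vs ({..<p + q} - I))"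
  let ?m = "map_permutation {..<q} (\<lambda>i. p + i)"
  have G0: "?G I = 0" if "I \<in> Pow {..<p + q}" "card I \<noteq> p" for I
    using that True by (simp add: \<alpha> alternate_length nths_sorted_list)
  have coset: "?G I = sum ?F {\<tau> \<in> ?T. \<tau> ` {..<p} = I}" if I: "I \<subseteq> {..<p + q}" "card I = p" for I
  proof -
    let ?s = "shuffle_perm (p + q) I"
    have s: "?s permutes {..<p + q}" using I(1) by (rule shuffle_perm_permutes)
    have s_im: "?s ` {..<p} = I" using shuffle_perm_image[OF I(1)] I(2) by simp
    let ?i = "inv_into UNIV ?s"
    have i: "?i permutes {..<p + q}" by (rule permutes_inv[OF s])
    have i_im: "?i ` I = {..<p}"
      using permutes_inv_o(2)[OF s] by (subst (2) s_im[symmetric]) (simp only: image_comp image_id id_apply)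
    have bij_s: "bij_betw (\<lambda>\<rho>. ?s \<circ> \<rho>) {\<rho>. \<rho> permutes {..<p + q} \<and> \<rho> ` {..<p} = {..<p}}
        {\<tau> \<in> ?T. \<tau> ` {..<p} = I}"
    proof (rule bij_betwI[where g="\<lambda>\<tau>. ?i \<circ> \<tau>"])
      show "(\<lambda>\<rho>. ?s \<circ> \<rho>) \<in> {\<rho>. \<rho> permutes {..<p + q} \<and> \<rho> ` {..<p} = {..<p}} \<rightarrow>
          {\<tau> \<in> ?T. \<tau> ` {..<p} = I}"
      proof (rule funcsetI)
        fix \<rho> assume "\<rho> \<in> {\<rho>. \<rho> permutes {..<p + q} \<and> \<rho> ` {..<p} = {..<p}}"
        then have r: "\<rho> permutes {..<p + q}" "\<rho> ` {..<p} = {..<p}" by auto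
        have "(?s \<circ> \<rho>) ` {..<p} = I" using r(2) s_im by (simp only: image_comp[symmetric])
        then show "?s \<circ> \<rho> \<in> {\<tau> \<in> ?T. \<tau> ` {..<p} = I}" using permutes_compose[OF r(1) s] by blast
      qed
      show "(\<lambda>\<tau>. ?i \<circ> \<tau>) \<in> {\<tau> \<in> ?T. \<tau> ` {..<p} = I} \<rightarrow>
          {\<rho>. \<rho> permutes {..<p + q} \<and> \<rho> ` {..<p} = {..<p}}"
      proof (rule funcsetI)
        fix \<tau> assume "\<tau> \<in> {\<tau> \<in> ?T. \<tau> ` {..<p} = I}"
        then have r: "\<tau> permutes {..<p + q}" "\<tau> ` {..<p} = I" by auto
        have "(?i \<circ> \<tau>) ` {..<p} = {..<p}" using r(2) i_im by (simp only: image_comp[symmetric])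
        then show "?i \<circ> \<tau> \<in> {\<rho>. \<rho> permutes {..<p + q} \<and> \<rho> ` {..<p} = {..<p}}"
          using permutes_compose[OF r(1) i] by blast
      qed
      show "?i \<circ> (?s \<circ> \<rho>) = \<rho>" for \<rho> by (rule ext) (simp only: o_apply permutes_inverses(2)[OF s])
      show "?s \<circ> (?i \<circ> \<rho>) = \<rho>" for \<rho> by (rule ext) (simp only: o_apply permutes_inverses(1)[OF s])
    qed
    have factor: "(\<Sum>a\<in>X. \<Sum>b\<in>Y. c * A a * B b) = c * sum A X * sum B Y"
      for X Y :: "(nat \<Rightarrow> nat) set" and c :: real and A B
      by (simp flip: sum_distrib_left sum_distrib_right)
    have lv: "length vs = p + q" by fact
    have lI: "length (nths vs I) = p" "length (nths vs ({..<p + q} - I)) = q"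
      using I True finite_subset[OF I(1)] by (simp_all add: nths_sorted_list card_Diff_subset)
    have summand: "?F (?s \<circ> (\<sigma>1 \<circ> ?m \<sigma>2)) = shuffle_sign (p + q) I *
        (of_int (sign \<sigma>1) * f (permute_list \<sigma>1 (nths vs I))) *
        (of_int (sign \<sigma>2) * g (permute_list \<sigma>2 (nths vs ({..<p + q} - I))))"
      if 1: "\<sigma>1 permutes {..<p}" and 2: "\<sigma>2 permutes {..<q}" for \<sigma>1 \<sigma>2
    proof -
      have b: "bij_betw (\<lambda>i. p + i) {..<q} {p..<p+q}"
        by (rule bij_betwI[where g="\<lambda>i. i - p"]) auto
      have m: "?m \<sigma>2 permutes {p..<p+q}" using b 2 by (rule map_permutation_permutes)
      have s2: "sign (?m \<sigma>2) = sign \<sigma>2" by (rule sign_map_permutation) (use 2 in auto)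
      have p1: "\<sigma>1 permutes {..<p + q}" by (rule permutes_subset[OF 1]) auto
      have p2: "?m \<sigma>2 permutes {..<p + q}" by (rule permutes_subset[OF m]) auto
      have p12: "\<sigma>1 \<circ> ?m \<sigma>2 permutes {..<p + q}" by (rule permutes_compose[OF p2 p1])
      have sg: "sign (?s \<circ> (\<sigma>1 \<circ> ?m \<sigma>2)) = sign ?s * (sign \<sigma>1 * sign \<sigma>2)"
        using s p1 p2 p12 by (simp add: sign_compose permutes_lessThan_permutation s2)
      let ?N = "nths vs I @ nths vs ({..<p + q} - I)"
      have "permute_list (?s \<circ> (\<sigma>1 \<circ> ?m \<sigma>2)) vs = permute_list (\<sigma>1 \<circ> ?m \<sigma>2) ?N"
        using p12 permute_list_shuffle[of I vs] I(1) by (simp add: permute_list_compose lv)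
      also have "\<dots> = permute_list \<sigma>1 (nths vs I) @ permute_list \<sigma>2 (nths vs ({..<p + q} - I))"
      proof (rule nth_equalityI)
        fix i assume "i < length (permute_list (\<sigma>1 \<circ> ?m \<sigma>2) ?N)"
        then have i: "i < p + q" by (simp add: lI)
        show "permute_list (\<sigma>1 \<circ> ?m \<sigma>2) ?N ! i =
            (permute_list \<sigma>1 (nths vs I) @ permute_list \<sigma>2 (nths vs ({..<p + q} - I))) ! i"
        proof (cases "i < p")
          case True
          moreover have "?m \<sigma>2 i = i" using True by (intro permutes_not_in[OF m]) auto
          moreover have "\<sigma>1 i < p" using permutes_in_image[OF 1, of i] True by simp
          ultimately show ?thesis using i by (simp add: permute_list_def lI nth_append)
        next
          case False
          then obtain j where j: "i = p + j" "j < q" using i by (metis le_add_diff_inverse nat_add_left_cancel_less not_less)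
          have "?m \<sigma>2 i = p + \<sigma>2 j" unfolding j(1)
            by (rule map_permutation_apply) (use j in auto)
          moreover have "\<sigma>1 (p + \<sigma>2 j) = p + \<sigma>2 j" by (rule permutes_not_in[OF 1]) auto
          ultimately show ?thesis using i j by (simp add: permute_list_def lI nth_append)
        qed
      qed (simp add: lI)
      finally show ?thesis by (simp add: sg shuffle_sign_perm lI)
    qed
    have "sum ?F {\<tau> \<in> ?T. \<tau> ` {..<p} = I} =
        (\<Sum>\<rho> | \<rho> permutes {..<p + q} \<and> \<rho> ` {..<p} = {..<p}. ?F (?s \<circ> \<rho>))"
      by (rule sum.reindex_bij_betw[OF bij_s, symmetric])
    also have "\<dots> = (\<Sum>(\<sigma>1, \<sigma>2) \<in> {\<sigma>. \<sigma> permutes {..<p}} \<times> {\<sigma>. \<sigma> permutes {..<q}}.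
        ?F (?s \<circ> (\<sigma>1 \<circ> ?m \<sigma>2)))"
      by (subst sum.reindex_bij_betw[OF bij_betw_Young, symmetric]) (simp add: case_prod_beta)
    also have "\<dots> = (\<Sum>(\<sigma>1, \<sigma>2) \<in> {\<sigma>. \<sigma> permutes {..<p}} \<times> {\<sigma>. \<sigma> permutes {..<q}}.
        shuffle_sign (p + q) I * (of_int (sign \<sigma>1) * f (permute_list \<sigma>1 (nths vs I))) *
        (of_int (sign \<sigma>2) * g (permute_list \<sigma>2 (nths vs ({..<p + q} - I)))))"
      by (intro sum.cong refl) (use summand in auto)
    also have "\<dots> = ?G I"
      unfolding \<alpha> \<beta> alternate_def lI sum.cartesian_product[symmetric]
      using factor by simp
    finally show ?thesis by simp
  qed
  have "wedge \<alpha> \<beta> x vs = sum ?G (Pow {..<p + q})" by (simp add: wedge_def True)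
  also have "\<dots> = sum ?G {I \<in> Pow {..<p + q}. card I = p}"
    using G0 by (intro sum.mono_neutral_right) auto
  also have "\<dots> = (\<Sum>I\<in>{I \<in> Pow {..<p + q}. card I = p}. sum ?F {\<tau> \<in> ?T. \<tau> ` {..<p} = I})"
    by (intro sum.cong refl) (use coset in auto)
  also have "\<dots> = sum ?F ?T"
  proof (rule sum.group)
    show "(\<lambda>\<tau>. \<tau> ` {..<p}) ` ?T \<subseteq> {I \<in> Pow {..<p + q}. card I = p}"
    proof clarify
      fix \<tau> :: "nat \<Rightarrow> nat" assume t: "\<tau> permutes {..<p + q}"
      then have "\<tau> ` {..<p} \<subseteq> {..<p + q}" using permutes_image[OF t] by fastforce
      moreover have "card (\<tau> ` {..<p}) = p" using permutes_inj[OF t] by (simp add: card_image inj_on_def)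
      ultimately show "\<tau> ` {..<p} \<in> Pow {..<p + q} \<and> card (\<tau> ` {..<p}) = p" by simp
    qed
  qed (auto simp: finite_permutations)
  finally show ?thesis using True by (simp add: alternate_def)
qed
lemma wedge_list_Nil: "wedge_list [] = fun_form (\<lambda>_. 1)"
  by (simp add: wedge_list_def)

lemma wedge_list_Cons: "wedge_list (\<alpha> # \<alpha>s) = wedge \<alpha> (wedge_list \<alpha>s)"
  by (simp add: wedge_list_def)

lemma wedge_list_alternate:
  assumes "\<And>k us. k < length \<alpha>s \<Longrightarrow> (\<alpha>s ! k) x us = alternate c (f k) us"
  shows "wedge_list \<alpha>s x vs = alternate (c * length \<alpha>s)
    (\<lambda>us. \<Prod>k<length \<alpha>s. f k (take c (drop (c * k) us))) vs"
  using assms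
proof (induction \<alpha>s arbitrary: f vs)
  case Nil
  then show ?case by (simp add: wedge_list_Nil fun_form_def alternate_def permutes_empty)
next
  case (Cons \<alpha> \<alpha>s)
  have 0: "\<alpha> x us = alternate c (f 0) us" for us using Cons.prems[of 0] by simp
  have IH: "wedge_list \<alpha>s x us = alternate (c * length \<alpha>s)
    (\<lambda>us. \<Prod>k<length \<alpha>s. f (Suc k) (take c (drop (c * k) us))) us" for us
    by (rule Cons.IH) (use Cons.prems[of "Suc _"] in simp)
  have "wedge_list (\<alpha> # \<alpha>s) x vs = alternate (c + c * length \<alpha>s) (\<lambda>us. f 0 (take c us) *
      (\<Prod>k<length \<alpha>s. f (Suc k) (take c (drop (c * k) (drop c us))))) vs"
    unfolding wedge_list_Cons
    by (rule wedge_alternate[of \<alpha> x c "f 0" "wedge_list \<alpha>s" "c * length \<alpha>s"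
          "\<lambda>us. \<Prod>k<length \<alpha>s. f (Suc k) (take c (drop (c * k) us))", OF 0 IH])
  then show ?case
    by (simp del: prod.lessThan_Suc add: prod.lessThan_Suc_shift algebra_simps)
qed

lemma wedge_list_1_forms:
  assumes "\<And>k us. k < length \<alpha>s \<Longrightarrow> (\<alpha>s ! k) x us = alternate 1 (\<lambda>us. h k (us ! 0)) us"
  shows "wedge_list \<alpha>s x vs = alternate (length \<alpha>s) (\<lambda>us. \<Prod>k<length \<alpha>s. h k (us ! k)) vs"
proof -
  have "wedge_list \<alpha>s x vs = alternate (1 * length \<alpha>s)
      (\<lambda>us. \<Prod>k<length \<alpha>s. h k (take 1 (drop (1 * k) us) ! 0)) vs"
    by (rule wedge_list_alternate) (rule assms)
  also have "\<dots> = alternate (length \<alpha>s) (\<lambda>us. \<Prod>k<length \<alpha>s. h k (us ! k)) vs"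
    by (simp, intro alternate_cong prod.cong) (auto simp: nth_drop)
  finally show ?thesis .
qed

lemma alternate_1: "alternate 1 f us = (case us of [v] \<Rightarrow> f [v] | _ \<Rightarrow> 0)"
proof -
  have "{\<sigma>. \<sigma> permutes {..<Suc 0}} = {id}" by (auto simp: lessThan_Suc permutes_sing)
  then show ?thesis by (auto simp: alternate_def split: list.split)
qed

lemma alternate_2:
  "alternate 2 f us = (case us of [v, w] \<Rightarrow> f [v, w] - f [w, v] | _ \<Rightarrow> 0)"
proof (cases "length us = 2")
  case True
  then obtain v w where us: "us = [v, w]"
    by (metis (no_types, opaque_lifting) One_nat_def Suc_1 length_0_conv length_Suc_conv)
  let ?t = "Transposition.transpose 0 (1::nat)"
  have "{..<2} = {0, 1::nat}" by auto
  then have "{\<sigma>. \<sigma> permutes {..<2::nat}} = {id, ?t}" by (auto simp: permutes_doubleton_iff)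
  moreover have "id \<noteq> ?t" by (metis id_apply transpose_apply_first zero_neq_one)
  moreover have "permute_list ?t [v, w] = [w, v]" by (simp add: permute_list_def upt_rec)
  ultimately show ?thesis using True by (simp add: alternate_def us sign_swap_id)
qed (auto simp: alternate_def split: list.split)

lemma det_alternate:
  assumes "length vs = n"
  shows "alternate n (\<lambda>us. \<Prod>k<n. h k (us ! k)) vs =
    Determinant.det (Matrix.mat n n (\<lambda>(i, j). h i (vs ! j)))"
  using assms
  by (auto simp: alternate_def Determinant.det_def permute_list_nth lessThan_atLeast0 permutes_in_image
      intro!: sum.cong prod.cong)

text \<open>
  An alternating sum turns a renumbering of the arguments into a sign. The shuffle of \<open>I\<close>
  renumbers the list of arguments to the one that starts with the arguments in \<open>I\<close>.
\<close>

lemma alternate_shuffle: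
  assumes I: "I \<subseteq> {..<n}"
  shows "shuffle_sign n I * alternate n f vs =
    alternate n (\<lambda>us. f (nths us I @ nths us ({..<n} - I))) vs"
proof -
  have "alternate n (\<lambda>us. f (nths us I @ nths us ({..<n} - I))) vs =
      alternate n (\<lambda>us. f (permute_list (shuffle_perm n I) us)) vs"
    by (intro alternate_cong) (use I in \<open>auto simp: permute_list_shuffle\<close>)
  then show ?thesis
    by (simp add: shuffle_sign_perm alternate_permute[OF shuffle_perm_permutes[OF I]])
qed

section \<open>Sums over pairings\<close>

text \<open>
  The sum of \<open>\<Prod> \<kappa> i j\<close> over the partitions of \<open>A\<close> into pairs \<open>{i, j}\<close>. Each partition is
  listed \<open>2\<^sup>k k!\<close> times by the arrangements of \<open>A\<close>, where \<open>2 k\<close> is the size of \<open>A\<close>.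
\<close>

definition pairing_sum :: "('i \<Rightarrow> 'i \<Rightarrow> real) \<Rightarrow> 'i set \<Rightarrow> real"
  where "pairing_sum \<kappa> A = (if even (card A)
    then (\<Sum>xs\<in>permutations_of_set A. \<Prod>l<card A div 2. \<kappa> (xs ! (2 * l)) (xs ! (2 * l + 1))) /
      (2 ^ (card A div 2) * fact (card A div 2))
    else 0)"

text \<open>
  Sums over permutations of indices, as in the Mathai-Quillen form, are sums over arrangements;
  the latter allow recursion on the first entries.
\<close>

lemma bij_betw_permute_list:
  assumes "distinct xs"
  shows "bij_betw (\<lambda>\<sigma>. permute_list \<sigma> xs) {\<sigma>. \<sigma> permutes {..<length xs}} (permutations_of_set (set xs))"
  unfolding bij_betw_def
proof
  show "inj_on (\<lambda>\<sigma>. permute_list \<sigma> xs) {\<sigma>. \<sigma> permutes {..<length xs}}"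
  proof (rule inj_onI, clarsimp)
    fix \<sigma> \<tau> assume st: "\<sigma> permutes {..<length xs}" "\<tau> permutes {..<length xs}"
      "permute_list \<sigma> xs = permute_list \<tau> xs"
    have "\<sigma> i = \<tau> i" for i
    proof (cases "i < length xs")
      case True
      then have "xs ! \<sigma> i = xs ! \<tau> i" using st by (metis permute_list_nth)
      moreover have "\<sigma> i < length xs" "\<tau> i < length xs"
        using permutes_in_image[OF st(1), of i] permutes_in_image[OF st(2), of i] True by auto
      ultimately show ?thesis using assms by (simp add: nth_eq_iff_index_eq)
    qed (use permutes_not_in[OF st(1)] permutes_not_in[OF st(2)] in auto)
    then show "\<sigma> = \<tau>" by auto
  qed
  show "(\<lambda>\<sigma>. permute_list \<sigma> xs) ` {\<sigma>. \<sigma> permutes {..<length xs}} = permutations_of_set (set xs)"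
  proof
    show "(\<lambda>\<sigma>. permute_list \<sigma> xs) ` {\<sigma>. \<sigma> permutes {..<length xs}} \<subseteq> permutations_of_set (set xs)"
      using assms by (auto intro!: permutations_of_setI)
    show "permutations_of_set (set xs) \<subseteq> (\<lambda>\<sigma>. permute_list \<sigma> xs) ` {\<sigma>. \<sigma> permutes {..<length xs}}"
    proof
      fix ys assume "ys \<in> permutations_of_set (set xs)"
      then have "mset ys = mset xs" using assms by (metis permutations_of_setD set_eq_iff_mset_eq_distinct)
      then show "ys \<in> (\<lambda>\<sigma>. permute_list \<sigma> xs) ` {\<sigma>. \<sigma> permutes {..<length xs}}"
        by (rule mset_eq_permutation) blast
    qed
  qed
qed

text \<open>
  The tangent vectors are renumbered by \<open>\<sigma>\<close> along with the indices, which absorbs the sign of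
  \<open>\<sigma>\<close>; then all permutations contribute without a sign, and the factors 2 from the
  antisymmetry of 2-forms reduce \<open>2\<^bsup>2k\<^esup>\<close> to \<open>2\<^sup>k\<close>.
\<close>

lemma Omega_part_alternate:
  assumes \<Omega>: "\<And>i j us. i \<in> J \<Longrightarrow> j \<in> J \<Longrightarrow>
      lift_form d n (\<Omega> i j) z us = alternate 2 (\<lambda>us. 2 * K i (us ! 0) j (us ! 1)) us"
    and J: "finite J" "even (card J)"
  shows "Omega_part d n \<Omega> J z vs = alternate (card J) (\<lambda>us.
    pairing_sum (\<lambda>a b. K (sorted_list_of_set J ! a) (us ! a) (sorted_list_of_set J ! b) (us ! b))
      {..<card J}) vs"
proof -
  let ?t = "sorted_list_of_set J"
  obtain k where q: "card J = 2 * k" using J(2) by blast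
  let ?c = "1 / (2 ^ card J * fact k) :: real"
  have "of_int (sign \<sigma>) * wedge_list (map (\<lambda>l. lift_form d n
          (\<Omega> (?t ! \<sigma> (2 * l)) (?t ! \<sigma> (2 * l + 1)))) [0..<k]) z vs =
      alternate (card J) (\<lambda>us. \<Prod>l<k. 2 * K (?t ! \<sigma> (2 * l)) (us ! \<sigma> (2 * l))
        (?t ! \<sigma> (2 * l + 1)) (us ! \<sigma> (2 * l + 1))) vs"
    if s: "\<sigma> permutes {..<card J}" for \<sigma>
  proof -
    have lt: "\<sigma> (2 * l) < card J" "\<sigma> (2 * l + 1) < card J" "2 * l < card J" "2 * l + 1 < card J" if "l < k" for l
    proof -
      show 1: "2 * l < card J" "2 * l + 1 < card J" using that q by auto
      show "\<sigma> (2 * l) < card J" "\<sigma> (2 * l + 1) < card J"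
        using permutes_in_image[OF s] 1 by auto
    qed
    have mem: "?t ! i \<in> J" if "i < card J" for i
      using that J(1) nth_mem[of i ?t] by simp
    let ?f = "\<lambda>l us. 2 * K (?t ! \<sigma> (2 * l)) (us ! 0) (?t ! \<sigma> (2 * l + 1)) (us ! 1)"
    let ?F = "\<lambda>us. \<Prod>l<k. 2 * K (?t ! \<sigma> (2 * l)) (us ! (2 * l))
        (?t ! \<sigma> (2 * l + 1)) (us ! (2 * l + 1))"
    let ?ws = "map (\<lambda>l. lift_form d n (\<Omega> (?t ! \<sigma> (2 * l)) (?t ! \<sigma> (2 * l + 1)))) [0..<k]"
    have "wedge_list ?ws z vs =
      alternate (2 * length ?ws) (\<lambda>us. \<Prod>l<length ?ws. ?f l (take 2 (drop (2 * l) us))) vs"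
    proof (rule wedge_list_alternate)
      fix l us assume "l < length ?ws"
      then have l: "l < k" by simp
      have "lift_form d n (\<Omega> (?t ! \<sigma> (2 * l)) (?t ! \<sigma> (2 * l + 1))) z us = alternate 2 (?f l) us"
        by (rule \<Omega>) (intro mem lt l)+
      then show "(?ws ! l) z us = alternate 2 (?f l) us" using l by simp
    qed
    also have "length ?ws = k" by simp
    also have "alternate (2 * k) (\<lambda>us. \<Prod>l<k. ?f l (take 2 (drop (2 * l) us))) vs =
        alternate (2 * k) ?F vs"
    proof (intro alternate_cong prod.cong refl)
      fix us :: "rvec list" and l assume "length us = 2 * k" "l \<in> {..<k}"
      then show "?f l (take 2 (drop (2 * l) us)) = 2 * K (?t ! \<sigma> (2 * l)) (us ! (2 * l))
        (?t ! \<sigma> (2 * l + 1)) (us ! (2 * l + 1))" by simp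
    qed
    also have "2 * k = card J" using q by simp
    finally have W: "wedge_list ?ws z vs = alternate (card J) ?F vs" .
    have "of_int (sign \<sigma>) * alternate (card J) ?F vs =
        alternate (card J) (\<lambda>us. ?F (permute_list \<sigma> us)) vs"
      by (rule alternate_permute[OF s, symmetric])

    also have "\<dots> = alternate (card J) (\<lambda>us. \<Prod>l<k. 2 * K (?t ! \<sigma> (2 * l)) (us ! \<sigma> (2 * l))
        (?t ! \<sigma> (2 * l + 1)) (us ! \<sigma> (2 * l + 1))) vs"
    proof (intro alternate_cong prod.cong refl)
      fix us :: "rvec list" and l assume us: "length us = card J" and l: "l \<in> {..<k}"
      have "permute_list \<sigma> us ! (2 * l) = us ! \<sigma> (2 * l)"
        "permute_list \<sigma> us ! (2 * l + 1) = us ! \<sigma> (2 * l + 1)"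
        using s lt[of l] l us by (simp_all add: permute_list_nth)
      then show "2 * K (?t ! \<sigma> (2 * l)) (permute_list \<sigma> us ! (2 * l))
        (?t ! \<sigma> (2 * l + 1)) (permute_list \<sigma> us ! (2 * l + 1)) = 2 * K (?t ! \<sigma> (2 * l)) (us ! \<sigma> (2 * l))
        (?t ! \<sigma> (2 * l + 1)) (us ! \<sigma> (2 * l + 1))" by (simp only:)
    qed
    finally show ?thesis unfolding W .
  qed
  then have "Omega_part d n \<Omega> J z vs = ?c * (\<Sum>\<sigma> | \<sigma> permutes {..<card J}.
      alternate (card J) (\<lambda>us. \<Prod>l<k. 2 * K (?t ! \<sigma> (2 * l)) (us ! \<sigma> (2 * l))
        (?t ! \<sigma> (2 * l + 1)) (us ! \<sigma> (2 * l + 1))) vs)"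
    by (simp add: Omega_part_def q)
  also have "\<dots> = alternate (card J) (\<lambda>us. ?c * (\<Sum>\<sigma> | \<sigma> permutes {..<card J}.
      \<Prod>l<k. 2 * K (?t ! \<sigma> (2 * l)) (us ! \<sigma> (2 * l))
        (?t ! \<sigma> (2 * l + 1)) (us ! \<sigma> (2 * l + 1)))) vs"
    by (simp only: alternate_cmult alternate_sum)
  also have "\<dots> = alternate (card J) (\<lambda>us. pairing_sum
      (\<lambda>a b. K (?t ! a) (us ! a) (?t ! b) (us ! b)) {..<card J}) vs"
  proof (intro alternate_cong)
    fix us :: "rvec list" assume "length us = card J"
    let ?\<kappa> = "\<lambda>a b. K (?t ! a) (us ! a) (?t ! b) (us ! b)"
    have c: "?c * 2 ^ k = 1 / (2 ^ k * fact k)"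
    proof -
      have cancel: "1 / (a * a * b) * a = 1 / (a * b)" if "a \<noteq> 0" for a b :: real
        using that by (cases "b = 0") (simp_all add: field_simps)
      show ?thesis unfolding q mult_2 power_add by (rule cancel) simp
    qed
    have "(\<Sum>\<sigma> | \<sigma> permutes {..<card J}. \<Prod>l<k. ?\<kappa> (\<sigma> (2 * l)) (\<sigma> (2 * l + 1))) =
        (\<Sum>\<sigma> | \<sigma> permutes {..<length [0..<card J]}. \<Prod>l<k.
          ?\<kappa> (permute_list \<sigma> [0..<card J] ! (2 * l)) (permute_list \<sigma> [0..<card J] ! (2 * l + 1)))"
    proof (intro sum.cong prod.cong)
      fix \<sigma> l assume "\<sigma> \<in> {\<sigma>. \<sigma> permutes {..<length [0..<card J]}}" "l \<in> {..<k}"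
      then have s: "\<sigma> permutes {..<card J}" and l: "2 * l < card J" "2 * l + 1 < card J" using q by auto
      have "\<sigma> (2 * l) < card J" "\<sigma> (2 * l + 1) < card J"
        using permutes_in_image[OF s] l by auto
      then show "?\<kappa> (\<sigma> (2 * l)) (\<sigma> (2 * l + 1)) =
          ?\<kappa> (permute_list \<sigma> [0..<card J] ! (2 * l)) (permute_list \<sigma> [0..<card J] ! (2 * l + 1))"
        using l by (simp add: permute_list_def)
    qed auto
    also have "\<dots> = (\<Sum>xs\<in>permutations_of_set (set [0..<card J]).
        \<Prod>l<k. ?\<kappa> (xs ! (2 * l)) (xs ! (2 * l + 1)))"
      by (rule sum.reindex_bij_betw[OF bij_betw_permute_list]) simp
    finally have "(\<Sum>\<sigma> | \<sigma> permutes {..<card J}. \<Prod>l<k. ?\<kappa> (\<sigma> (2 * l)) (\<sigma> (2 * l + 1))) = \<dots>" .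
    then have "?c * (\<Sum>\<sigma> | \<sigma> permutes {..<card J}. \<Prod>l<k. 2 * ?\<kappa> (\<sigma> (2 * l)) (\<sigma> (2 * l + 1))) =
        (?c * 2 ^ k) * (\<Sum>xs\<in>permutations_of_set (set [0..<card J]).
          \<Prod>l<k. ?\<kappa> (xs ! (2 * l)) (xs ! (2 * l + 1)))"
      by (simp only: prod.distrib prod_constant card_lessThan mult.assoc flip: sum_distrib_left)
    also have "\<dots> = pairing_sum ?\<kappa> {..<card J}"
      unfolding c using q by (simp add: pairing_sum_def lessThan_atLeast0)
    finally show "?c * (\<Sum>\<sigma> | \<sigma> permutes {..<card J}. \<Prod>l<k. 2 * ?\<kappa> (\<sigma> (2 * l)) (\<sigma> (2 * l + 1))) =
        pairing_sum ?\<kappa> {..<card J}" .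
  qed
  finally show ?thesis .
qed

lemma pairing_sum_reindex:
  assumes "inj_on f A"
  shows "pairing_sum \<kappa> (f ` A) = pairing_sum (\<lambda>a b. \<kappa> (f a) (f b)) A"
proof -
  have P: "permutations_of_set (f ` A) = map f ` permutations_of_set A"
    using assms by (rule permutations_of_set_image_inj)
  have "inj_on (map f) (permutations_of_set A)"
  proof (rule inj_onI)
    fix xs ys assume "xs \<in> permutations_of_set A" "ys \<in> permutations_of_set A" "map f xs = map f ys"
    then show "xs = ys"
      using assms by (intro map_inj_on[of f xs ys]) (simp_all add: permutations_of_setD(1))
  qed
  note inj = this
  have card: "card (f ` A) = card A" using assms by (rule card_image)
  have eq: "(\<Prod>l<card A div 2. \<kappa> (map f xs ! (2 * l)) (map f xs ! (2 * l + 1))) =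
      (\<Prod>l<card A div 2. \<kappa> (f (xs ! (2 * l))) (f (xs ! (2 * l + 1))))"
    if "xs \<in> permutations_of_set A" for xs
  proof (intro prod.cong refl)
    fix l assume "l \<in> {..<card A div 2}"
    moreover have "length xs = card A" using that by (rule length_finite_permutations_of_set)
    ultimately show "\<kappa> (map f xs ! (2 * l)) (map f xs ! (2 * l + 1)) =
        \<kappa> (f (xs ! (2 * l))) (f (xs ! (2 * l + 1)))" by simp
  qed
  have "(\<Sum>xs\<in>permutations_of_set (f ` A). \<Prod>l<card A div 2. \<kappa> (xs ! (2 * l)) (xs ! (2 * l + 1))) =
      (\<Sum>xs\<in>permutations_of_set A. \<Prod>l<card A div 2. \<kappa> (f (xs ! (2 * l))) (f (xs ! (2 * l + 1))))"
    unfolding P sum.reindex[OF inj] o_def by (intro sum.cong refl eq)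
  then show ?thesis by (simp only: pairing_sum_def card)
qed

lemma pairing_sum_cong:
  assumes "\<And>i j. i \<in> A \<Longrightarrow> j \<in> A \<Longrightarrow> \<kappa> i j = \<kappa>' i j"
  shows "pairing_sum \<kappa> A = pairing_sum \<kappa>' A"
proof -
  have "(\<Prod>l<card A div 2. \<kappa> (xs ! (2 * l)) (xs ! (2 * l + 1))) =
      (\<Prod>l<card A div 2. \<kappa>' (xs ! (2 * l)) (xs ! (2 * l + 1)))"
    if xs: "xs \<in> permutations_of_set A" for xs
  proof (intro prod.cong refl assms)
    fix l assume "l \<in> {..<card A div 2}"
    then have "2 * l < length xs" "2 * l + 1 < length xs"
      using length_finite_permutations_of_set[OF xs] by auto
    from this[THEN nth_mem] show "xs ! (2 * l) \<in> A" "xs ! (2 * l + 1) \<in> A"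
      unfolding permutations_of_setD(1)[OF xs] by simp_all
  qed
  then have "(\<Sum>xs\<in>permutations_of_set A. \<Prod>l<card A div 2. \<kappa> (xs ! (2 * l)) (xs ! (2 * l + 1))) =
      (\<Sum>xs\<in>permutations_of_set A. \<Prod>l<card A div 2. \<kappa>' (xs ! (2 * l)) (xs ! (2 * l + 1)))"
    by (intro sum.cong refl)
  then show ?thesis by (simp only: pairing_sum_def)
qed

lemma prod_sorted_list:
  assumes "finite I"
  shows "(\<Prod>k<card I. f (sorted_list_of_set I ! k)) = (\<Prod>i\<in>I. f i)"
proof -
  have "bij_betw ((!) (sorted_list_of_set I)) {..<card I} I"
    by (rule bij_betw_nth) (use assms in auto)
  then show ?thesis by (rule prod.reindex_bij_betw)
qed

text \<open>
  The term of \<open>I\<close> in the Mathai-Quillen form. Moving the arguments back to their places absorbs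
  the sign of the shuffle, so that the \<open>i\<close>-th argument meets the \<open>i\<close>-th factor.
\<close>

lemma wedge_Omega_part_alternate:
  assumes a: "\<And>i us. i < n \<Longrightarrow> \<xi> i z us = alternate 1 (\<lambda>us. a i (us ! 0)) us"
    and \<Omega>: "\<And>i j us. i < n \<Longrightarrow> j < n \<Longrightarrow>
      lift_form d n (\<Omega> i j) z us = alternate 2 (\<lambda>us. 2 * K i (us ! 0) j (us ! 1)) us"
    and I: "I \<subseteq> {..<n}" "even (card ({..<n} - I))"
  shows "shuffle_sign n I * wedge (wedge_list (map \<xi> (sorted_list_of_set I)))
      (Omega_part d n \<Omega> ({..<n} - I)) z vs =
    alternate n (\<lambda>us. (\<Prod>i\<in>I. a i (us ! i)) *
      pairing_sum (\<lambda>i j. K i (us ! i) j (us ! j)) ({..<n} - I)) vs"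
proof -
  let ?J = "{..<n} - I"
  let ?s = "sorted_list_of_set I" and ?t = "sorted_list_of_set ?J"
  have fin: "finite I" using I(1) by (rule finite_subset) simp
  have le: "card I \<le> n" using card_mono[OF _ I(1)] by simp
  have cJ: "card ?J = n - card I" using fin I(1) by (simp add: card_Diff_subset)
  have sI: "?s ! k \<in> I" if "k < card I" for k
    using nth_mem[of k ?s] that fin by simp

  have w1: "wedge_list (map \<xi> ?s) z us =
      alternate (length (map \<xi> ?s)) (\<lambda>us. \<Prod>k<length (map \<xi> ?s). a (?s ! k) (us ! k)) us" for us
  proof (rule wedge_list_1_forms)
    fix k us assume "k < length (map \<xi> ?s)"
    then have k: "k < card I" by simp
    then have "?s ! k < n" using sI I(1) by auto
    from a[OF this] show "(map \<xi> ?s ! k) z us = alternate 1 (\<lambda>us. a (?s ! k) (us ! 0)) us"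
      using k by simp
  qed
  let ?f = "\<lambda>us. \<Prod>k<card I. a (?s ! k) (us ! k)"
  let ?g = "\<lambda>us. pairing_sum (\<lambda>a b. K (?t ! a) (us ! a) (?t ! b) (us ! b)) {..<card ?J}"
  have "wedge (wedge_list (map \<xi> ?s)) (Omega_part d n \<Omega> ?J) z vs =
      alternate (card I + card ?J) (\<lambda>us. ?f (take (card I) us) * ?g (drop (card I) us)) vs"
  proof (rule wedge_alternate)
    show "wedge_list (map \<xi> ?s) z us = alternate (card I) ?f us" for us using w1 by simp
    show "Omega_part d n \<Omega> ?J z us = alternate (card ?J) ?g us" for us
    proof (rule Omega_part_alternate)
      fix i j us assume "i \<in> ?J" "j \<in> ?J"
      then show "lift_form d n (\<Omega> i j) z us = alternate 2 (\<lambda>us. 2 * K i (us ! 0) j (us ! 1)) us"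
        by (intro \<Omega>) auto
    qed (use I in simp_all)
  qed
  also have "card I + card ?J = n" using le cJ by simp
  finally have W: "wedge (wedge_list (map \<xi> ?s)) (Omega_part d n \<Omega> ?J) z vs =
      alternate n (\<lambda>us. ?f (take (card I) us) * ?g (drop (card I) us)) vs" .
  have "shuffle_sign n I * alternate n (\<lambda>us. ?f (take (card I) us) * ?g (drop (card I) us)) vs =
      alternate n (\<lambda>us. ?f (take (card I) (nths us I @ nths us ?J)) *
        ?g (drop (card I) (nths us I @ nths us ?J))) vs"
    by (rule alternate_shuffle[OF I(1)])
  also have "\<dots> = alternate n (\<lambda>us. (\<Prod>i\<in>I. a i (us ! i)) *
      pairing_sum (\<lambda>i j. K i (us ! i) j (us ! j)) ?J) vs"
  proof (rule alternate_cong)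
    fix us :: "rvec list" assume us: "length us = n"
    have nI: "nths us I = map ((!) us) ?s" by (rule nths_sorted_list) (use I(1) us in simp)
    have nJ: "nths us ?J = map ((!) us) ?t" by (rule nths_sorted_list) (use us in auto)
    have "?f (take (card I) (nths us I @ nths us ?J)) = (\<Prod>k<card I. a (?s ! k) (us ! (?s ! k)))"
      by (intro prod.cong refl) (simp add: nI)
    also have "\<dots> = (\<Prod>i\<in>I. a i (us ! i))" by (rule prod_sorted_list[OF fin])
    finally have 1: "?f (take (card I) (nths us I @ nths us ?J)) = (\<Prod>i\<in>I. a i (us ! i))" .
    have b: "bij_betw ((!) ?t) {..<card ?J} ?J"
      by (rule bij_betw_nth) simp_all
    have "?g (drop (card I) (nths us I @ nths us ?J)) =
        pairing_sum (\<lambda>a b. K (?t ! a) (us ! (?t ! a)) (?t ! b) (us ! (?t ! b))) {..<card ?J}"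
    proof -
      have "drop (card I) (nths us I @ nths us ?J) = map ((!) us) ?t" by (simp add: nI nJ)
      moreover have "pairing_sum (\<lambda>a b. K (?t ! a) (map ((!) us) ?t ! a) (?t ! b) (map ((!) us) ?t ! b)) {..<card ?J} =
          pairing_sum (\<lambda>a b. K (?t ! a) (us ! (?t ! a)) (?t ! b) (us ! (?t ! b))) {..<card ?J}"
        by (rule pairing_sum_cong) simp
      ultimately show ?thesis by simp
    qed
    also have "\<dots> = pairing_sum (\<lambda>i j. K i (us ! i) j (us ! j)) ((!) ?t ` {..<card ?J})"
      by (rule pairing_sum_reindex[symmetric]) (use b in \<open>simp add: bij_betw_def\<close>)
    also have "(!) ?t ` {..<card ?J} = ?J" using b by (simp add: bij_betw_def)
    finally show "?f (take (card I) (nths us I @ nths us ?J)) *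
        ?g (drop (card I) (nths us I @ nths us ?J)) =
      (\<Prod>i\<in>I. a i (us ! i)) * pairing_sum (\<lambda>i j. K i (us ! i) j (us ! j)) ?J" using 1 by simp
  qed
  finally show ?thesis unfolding W .
qed

section \<open>Moments of a Gaussian vector\<close>

definition gauss_moment :: "real \<Rightarrow> nat \<Rightarrow> real"
  where "gauss_moment \<sigma> k = (LINT x|lborel. normal_density 0 \<sigma> x * x ^ k)"

lemma integrable_gauss_moment:
  "\<sigma> > 0 \<Longrightarrow> integrable lborel (\<lambda>x. normal_density 0 \<sigma> x * x ^ k)"
  using integrable_normal_moment[of \<sigma> 0 k] by simp

lemma gauss_moment_0: "\<sigma> > 0 \<Longrightarrow> gauss_moment \<sigma> 0 = 1"
  using integral_normal_moment_even[of \<sigma> 0 0] by (simp add: gauss_moment_def)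

lemma gauss_moment_Suc:
  assumes "\<sigma> > 0"
  shows "gauss_moment \<sigma> (Suc k) = real k * \<sigma>\<^sup>2 * gauss_moment \<sigma> (k - 1)"
proof -
  have e: "gauss_moment \<sigma> (2 * j) = fact (2 * j) / ((2 / \<sigma>\<^sup>2) ^ j * fact j)" for j
    using integral_normal_moment_even[OF assms, of 0 j] by (simp add: gauss_moment_def)
  have o: "gauss_moment \<sigma> (2 * j + 1) = 0" for j
    using integral_normal_moment_odd[OF assms, of 0 j] by (simp add: gauss_moment_def)
  show ?thesis
  proof (cases "even k")
    case True
    then obtain j where k: "k = 2 * j" by blast
    show ?thesis
    proof (cases j)
      case 0
      then show ?thesis using o[of 0] k by simp
    next
      case (Suc i)
      have "gauss_moment \<sigma> (k - 1) = 0" using o[of i] k Suc by simp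
      then show ?thesis using o[of j] k by simp
    qed
  next
    case False
    then obtain j where k: "k = 2 * j + 1" by (blast elim: oddE)
    have "gauss_moment \<sigma> (Suc k) = gauss_moment \<sigma> (2 * Suc j)" by (simp add: k)
    also have "\<dots> = fact (2 * Suc j) / ((2 / \<sigma>\<^sup>2) ^ Suc j * fact (Suc j))" by (rule e)
    also have "\<dots> = (real (2 * j + 2) * real (2 * j + 1) * fact (2 * j)) /
        ((2 / \<sigma>\<^sup>2) * real (j + 1) * ((2 / \<sigma>\<^sup>2) ^ j * fact j))"
      by (simp add: algebra_simps)
    also have "\<dots> = real (2 * j + 1) * \<sigma>\<^sup>2 * (fact (2 * j) / ((2 / \<sigma>\<^sup>2) ^ j * fact j))"
    proof -
      have "real (2 * j + 2) * real (2 * j + 1) * F / ((2 / \<sigma>\<^sup>2) * real (j + 1) * D) =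
          real (2 * j + 1) * \<sigma>\<^sup>2 * (F / D)" for F D :: real
      proof -
        have "2 * c * e * F / ((2 / s) * c * D) = e * s * (F / D)" if "c \<noteq> 0" "s \<noteq> 0" for c e s :: real
          using that by (cases "D = 0") (simp_all add: field_simps)
        from this[of "real (j + 1)" "\<sigma>\<^sup>2" "real (2 * j + 1)"] show ?thesis using assms by simp
      qed
      then show ?thesis .
    qed
    also have "\<dots> = real k * \<sigma>\<^sup>2 * gauss_moment \<sigma> (k - 1)" by (simp add: e k)
    finally show ?thesis .
  qed
qed

text \<open>
  Expectation with respect to independent centered Gaussian coordinates of standard deviation
  \<open>\<sigma> j\<close>.
\<close>

definition gauss_expect :: "nat set \<Rightarrow> (nat \<Rightarrow> real) \<Rightarrow> (rvec \<Rightarrow> real) \<Rightarrow> real"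
  where "gauss_expect J \<sigma> f =
    (LINT w | (\<Pi>\<^sub>M j\<in>J. lborel). (\<Prod>j\<in>J. normal_density 0 (\<sigma> j) (w j)) * f w)"

definition gauss_integrable :: "nat set \<Rightarrow> (nat \<Rightarrow> real) \<Rightarrow> (rvec \<Rightarrow> real) \<Rightarrow> bool"
  where "gauss_integrable J \<sigma> f \<longleftrightarrow>
    integrable (\<Pi>\<^sub>M j\<in>J. lborel) (\<lambda>w. (\<Prod>j\<in>J. normal_density 0 (\<sigma> j) (w j)) * f w)"

lemma gauss_cmult:
  "gauss_integrable J \<sigma> f \<Longrightarrow> gauss_integrable J \<sigma> (\<lambda>w. c * f w)"
  "gauss_expect J \<sigma> (\<lambda>w. c * f w) = c * gauss_expect J \<sigma> f"
  unfolding gauss_expect_def gauss_integrable_def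
  by (simp_all add: mult.left_commute[of _ c])

lemma gauss_sum:
  assumes "\<And>k. k \<in> K \<Longrightarrow> gauss_integrable J \<sigma> (f k)"
  shows "gauss_integrable J \<sigma> (\<lambda>w. \<Sum>k\<in>K. f k w)"
    and "gauss_expect J \<sigma> (\<lambda>w. \<Sum>k\<in>K. f k w) = (\<Sum>k\<in>K. gauss_expect J \<sigma> (f k))"
  using assms unfolding gauss_expect_def gauss_integrable_def
  by (auto simp: sum_distrib_left intro!: Bochner_Integration.integral_sum)

lemma gauss_monomial:
  assumes "finite J" "\<And>j. j \<in> J \<Longrightarrow> \<sigma> j > 0"
  shows "gauss_integrable J \<sigma> (\<lambda>w. \<Prod>j\<in>J. w j ^ k j)"
    and "gauss_expect J \<sigma> (\<lambda>w. \<Prod>j\<in>J. w j ^ k j) = (\<Prod>j\<in>J. gauss_moment (\<sigma> j) (k j))"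
proof -
  interpret product_sigma_finite "\<lambda>_. lborel :: real measure" by standard
  have eq: "(\<Prod>j\<in>J. normal_density 0 (\<sigma> j) (w j)) * (\<Prod>j\<in>J. w j ^ k j) =
      (\<Prod>j\<in>J. normal_density 0 (\<sigma> j) (w j) * w j ^ k j)" for w
    by (simp add: prod.distrib)
  show "gauss_integrable J \<sigma> (\<lambda>w. \<Prod>j\<in>J. w j ^ k j)"
    unfolding gauss_integrable_def eq
    by (intro product_integrable_prod integrable_gauss_moment assms)
  show "gauss_expect J \<sigma> (\<lambda>w. \<Prod>j\<in>J. w j ^ k j) = (\<Prod>j\<in>J. gauss_moment (\<sigma> j) (k j))"
    unfolding gauss_expect_def eq gauss_moment_def
    by (intro product_integral_prod integrable_gauss_moment assms)
qed

text \<open>Monomials in the coordinates of \<open>w\<close> are written as words \<open>f\<close> in the letters \<open>J\<close>.\<close>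

lemma prod_word:
  fixes w :: "nat \<Rightarrow> real"
  assumes "finite A" "finite J" "f ` A \<subseteq> J"
  shows "(\<Prod>i\<in>A. w (f i)) = (\<Prod>j\<in>J. w j ^ card {i\<in>A. f i = j})"
proof -
  have "(\<Prod>i\<in>A. w (f i)) = (\<Prod>j\<in>J. \<Prod>i\<in>{i\<in>A. f i = j}. w (f i))"
    using assms by (intro prod.group[symmetric])
  also have "\<dots> = (\<Prod>j\<in>J. w j ^ card {i\<in>A. f i = j})"
    by (intro prod.cong refl) simp
  finally show ?thesis .
qed

locale gaussian =
  fixes J :: "nat set" and \<sigma> :: "nat \<Rightarrow> real"
  assumes fin: "finite J" and pos: "\<And>j. j \<in> J \<Longrightarrow> \<sigma> j > 0"
begin

lemma word:
  assumes "finite A" "f ` A \<subseteq> J"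
  shows "gauss_integrable J \<sigma> (\<lambda>w. \<Prod>i\<in>A. w (f i))"
    and "gauss_expect J \<sigma> (\<lambda>w. \<Prod>i\<in>A. w (f i)) =
      (\<Prod>j\<in>J. gauss_moment (\<sigma> j) (card {i\<in>A. f i = j}))"
  unfolding prod_word[OF assms(1) fin assms(2)]
  by (rule gauss_monomial[OF fin pos], assumption)+

text \<open>
  Integration by parts for words: by the recursion of the moments, removing the letter \<open>f a\<close>
  together with each of its other occurrences in turn gives equal terms, as many as there are
  occurrences.
\<close>

lemma word_insert:
  assumes A: "finite A" "f ` A \<subseteq> J" and a: "a \<notin> A" "f a \<in> J"
  shows "gauss_expect J \<sigma> (\<lambda>w. \<Prod>i\<in>insert a A. w (f i)) =
    (\<Sum>i\<in>A. if f i = f a then (\<sigma> (f a))\<^sup>2 * gauss_expect J \<sigma> (\<lambda>w. \<Prod>i\<in>A - {i}. w (f i)) else 0)"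
proof -
  define l where "l = f a"
  define k where "k j = card {i\<in>A. f i = j}" for j
  \<comment> \<open>If \<open>l\<close> does not occur in \<open>A\<close>, then \<open>k l - 1 = 0\<close>, but this moment has the factor \<open>k l = 0\<close>.\<close>
  let ?R = "\<Prod>j\<in>J - {l}. gauss_moment (\<sigma> j) (k j)"
  have lJ: "l \<in> J" using a by (simp add: l_def)
  have "{i\<in>insert a A. f i = j} = (if j = l then insert a {i\<in>A. f i = j} else {i\<in>A. f i = j})" for j
    by (auto simp: l_def)
  then have k1: "card {i\<in>insert a A. f i = j} = (if j = l then Suc (k j) else k j)" for j
    using A a by (simp add: k_def)
  have "gauss_expect J \<sigma> (\<lambda>w. \<Prod>i\<in>insert a A. w (f i)) =
      (\<Prod>j\<in>J. gauss_moment (\<sigma> j) (if j = l then Suc (k j) else k j))"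
    using A a by (subst word) (simp_all only: k1, auto)
  also have "\<dots> = gauss_moment (\<sigma> l) (Suc (k l)) * ?R"
    by (subst prod.remove[OF fin lJ]) simp
  also have "\<dots> = real (k l) * ((\<sigma> l)\<^sup>2 * (gauss_moment (\<sigma> l) (k l - 1) * ?R))"
    by (simp add: gauss_moment_Suc pos lJ)
  also have "\<dots> = (\<Sum>i\<in>{i\<in>A. f i = l}. (\<sigma> l)\<^sup>2 * (gauss_moment (\<sigma> l) (k l - 1) * ?R))"
    by (simp add: k_def)
  also have "\<dots> = (\<Sum>i\<in>{i\<in>A. f i = l}. (\<sigma> l)\<^sup>2 * gauss_expect J \<sigma> (\<lambda>w. \<Prod>i\<in>A - {i}. w (f i)))"
  proof (intro sum.cong refl)
    fix b assume b: "b \<in> {i\<in>A. f i = l}"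
    have "{i\<in>A - {b}. f i = j} = (if j = l then {i\<in>A. f i = j} - {b} else {i\<in>A. f i = j})" for j
      using b by auto
    then have k2: "card {i\<in>A - {b}. f i = j} = (if j = l then k j - 1 else k j)" for j
      using A b by (simp add: k_def)
    have "gauss_expect J \<sigma> (\<lambda>w. \<Prod>i\<in>A - {b}. w (f i)) =
        (\<Prod>j\<in>J. gauss_moment (\<sigma> j) (if j = l then k j - 1 else k j))"
      using A by (subst word) (simp_all only: k2, auto)
    also have "\<dots> = gauss_moment (\<sigma> l) (k l - 1) * ?R"
      by (subst prod.remove[OF fin lJ]) simp
    finally show "(\<sigma> l)\<^sup>2 * (gauss_moment (\<sigma> l) (k l - 1) * ?R) =
        (\<sigma> l)\<^sup>2 * gauss_expect J \<sigma> (\<lambda>w. \<Prod>i\<in>A - {b}. w (f i))" by simp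
  qed
  also have "\<dots> = (\<Sum>i\<in>A. if f i = l then (\<sigma> l)\<^sup>2 * gauss_expect J \<sigma> (\<lambda>w. \<Prod>i\<in>A - {i}. w (f i)) else 0)"
    using A(1) by (rule sum.inter_filter)
  finally show ?thesis unfolding l_def .
qed

definition lin :: "(nat \<Rightarrow> real) \<Rightarrow> rvec \<Rightarrow> real"
  where "lin x w = (\<Sum>j\<in>J. x j * w j)"

definition cov :: "(nat \<Rightarrow> real) \<Rightarrow> (nat \<Rightarrow> real) \<Rightarrow> real"
  where "cov x y = (\<Sum>j\<in>J. x j * y j * (\<sigma> j)\<^sup>2)"

lemma prod_lin:
  assumes "finite A"
  shows "gauss_integrable J \<sigma> (\<lambda>w. \<Prod>i\<in>A. lin (x i) w)"
    and "gauss_expect J \<sigma> (\<lambda>w. \<Prod>i\<in>A. lin (x i) w) =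
      (\<Sum>f\<in>A \<rightarrow>\<^sub>E J. (\<Prod>i\<in>A. x i (f i)) * gauss_expect J \<sigma> (\<lambda>w. \<Prod>i\<in>A. w (f i)))"
proof -
  have eq: "(\<lambda>w. \<Prod>i\<in>A. lin (x i) w) =
      (\<lambda>w. \<Sum>f\<in>A \<rightarrow>\<^sub>E J. (\<Prod>i\<in>A. x i (f i)) * (\<Prod>i\<in>A. w (f i)))"
    using assms fin by (simp add: lin_def prod_sum_PiE prod.distrib)
  have int: "gauss_integrable J \<sigma> (\<lambda>w. (\<Prod>i\<in>A. x i (f i)) * (\<Prod>i\<in>A. w (f i)))"
    if "f \<in> A \<rightarrow>\<^sub>E J" for f
    using that assms by (intro gauss_cmult word) (auto simp: PiE_iff)
  show "gauss_integrable J \<sigma> (\<lambda>w. \<Prod>i\<in>A. lin (x i) w)"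
    unfolding eq by (rule gauss_sum(1)[OF int])
  show "gauss_expect J \<sigma> (\<lambda>w. \<Prod>i\<in>A. lin (x i) w) =
      (\<Sum>f\<in>A \<rightarrow>\<^sub>E J. (\<Prod>i\<in>A. x i (f i)) * gauss_expect J \<sigma> (\<lambda>w. \<Prod>i\<in>A. w (f i)))"
    unfolding eq by (subst gauss_sum(2)[OF int]) (simp_all add: gauss_cmult)
qed

end

lemma sum_PiE_insert:
  assumes "a \<notin> A"
  shows "(\<Sum>f\<in>insert a A \<rightarrow>\<^sub>E J. F f) = (\<Sum>l\<in>J. \<Sum>f\<in>A \<rightarrow>\<^sub>E J. F (f(a := l)))"
proof -
  have "(\<Sum>f\<in>insert a A \<rightarrow>\<^sub>E J. F f) = (\<Sum>(l, f)\<in>J \<times> (A \<rightarrow>\<^sub>E J). F (f(a := l)))"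
    unfolding PiE_insert_eq
    by (subst sum.reindex) (use inj_combinator[OF assms, of "\<lambda>_. J"] in \<open>auto simp: case_prod_beta\<close>)
  then show ?thesis by (simp add: sum.cartesian_product)
qed

context gaussian
begin

text \<open>
  Gaussian integration by parts for products of linear functionals: \<open>word_insert\<close> applied to
  every word of the expansion.
\<close>

lemma prod_lin_insert:
  assumes A: "finite A" and a: "a \<notin> A"
  shows "gauss_expect J \<sigma> (\<lambda>w. \<Prod>i\<in>insert a A. lin (x i) w) =
    (\<Sum>i\<in>A. cov (x a) (x i) * gauss_expect J \<sigma> (\<lambda>w. \<Prod>i\<in>A - {i}. lin (x i) w))"
proof -
  let ?E = "\<lambda>A f. gauss_expect J \<sigma> (\<lambda>w. \<Prod>i\<in>A. w (f i))"
  let ?P = "\<lambda>A f. \<Prod>i\<in>A. x i (f i)"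
  have E_upd: "?E A (f(a := l)) = ?E A f" "?P A (f(a := l)) = ?P A f" if "a \<notin> A" for A f a l
  proof -
    have "(\<Prod>i\<in>A. w ((f(a := l)) i)) = (\<Prod>i\<in>A. w (f i))" for w :: rvec
      using that by (intro prod.cong) auto
    then show "?E A (f(a := l)) = ?E A f" by simp
    show "?P A (f(a := l)) = ?P A f" using that by (intro prod.cong) auto
  qed
  let ?S = "\<lambda>i l f. if f i = l then x a l * ?P A f * ((\<sigma> l)\<^sup>2 * ?E (A - {i}) f) else 0"
  have "gauss_expect J \<sigma> (\<lambda>w. \<Prod>i\<in>insert a A. lin (x i) w) =
      (\<Sum>l\<in>J. \<Sum>f\<in>A \<rightarrow>\<^sub>E J. ?P (insert a A) (f(a := l)) * ?E (insert a A) (f(a := l)))"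
    using A by (simp only: prod_lin finite_insert sum_PiE_insert[OF a])
  also have "\<dots> = (\<Sum>l\<in>J. \<Sum>f\<in>A \<rightarrow>\<^sub>E J. \<Sum>i\<in>A. ?S i l f)"
  proof (intro sum.cong refl)
    fix l f assume l: "l \<in> J" and f: "f \<in> A \<rightarrow>\<^sub>E J"
    have im: "(f(a := l)) ` A \<subseteq> J" using f l by (auto simp: PiE_iff)
    have la: "(f(a := l)) a \<in> J" using l by simp
    have "?E (insert a A) (f(a := l)) =
        (\<Sum>i\<in>A. if (f(a := l)) i = l then (\<sigma> l)\<^sup>2 * ?E (A - {i}) (f(a := l)) else 0)"
      using word_insert[OF A im a la] unfolding fun_upd_same .
    also have "\<dots> = (\<Sum>i\<in>A. if f i = l then (\<sigma> l)\<^sup>2 * ?E (A - {i}) f else 0)"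
    proof (intro sum.cong refl)
      fix i assume i: "i \<in> A"
      then have "i \<noteq> a" using a by auto
      then have "(f(a := l)) i = f i" by simp
      moreover have "?E (A - {i}) (f(a := l)) = ?E (A - {i}) f" using a by (intro E_upd(1)) auto
      ultimately show "(if (f(a := l)) i = l then (\<sigma> l)\<^sup>2 * ?E (A - {i}) (f(a := l)) else 0) =
          (if f i = l then (\<sigma> l)\<^sup>2 * ?E (A - {i}) f else 0)" by (simp only:)
    qed
    finally have "?P (insert a A) (f(a := l)) * ?E (insert a A) (f(a := l)) =
        (x a l * ?P A f) * (\<Sum>i\<in>A. if f i = l then (\<sigma> l)\<^sup>2 * ?E (A - {i}) f else 0)"
      using A a E_upd(2)[OF a, of f l] by simp
    then show "?P (insert a A) (f(a := l)) * ?E (insert a A) (f(a := l)) = (\<Sum>i\<in>A. ?S i l f)"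
      by (simp add: sum_distrib_left if_distrib cong: if_cong)
  qed
  also have "\<dots> = (\<Sum>i\<in>A. \<Sum>l\<in>J. \<Sum>f\<in>A \<rightarrow>\<^sub>E J. ?S i l f)"
  proof -
    have "(\<Sum>f\<in>A \<rightarrow>\<^sub>E J. \<Sum>i\<in>A. ?S i l f) = (\<Sum>i\<in>A. \<Sum>f\<in>A \<rightarrow>\<^sub>E J. ?S i l f)" for l
      by (rule sum.swap)
    then show ?thesis by (simp only:) (rule sum.swap)
  qed
  also have "\<dots> = (\<Sum>i\<in>A. cov (x a) (x i) * gauss_expect J \<sigma> (\<lambda>w. \<Prod>i\<in>A - {i}. lin (x i) w))"
  proof (intro sum.cong refl)
    fix b assume b: "b \<in> A"
    let ?B = "A - {b}"
    have AB: "A = insert b ?B" using b by auto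
    have B: "finite ?B" "b \<notin> ?B" using A by auto
    have "(\<Sum>f\<in>A \<rightarrow>\<^sub>E J. ?S b l f) = x a l * x b l * (\<sigma> l)\<^sup>2 * (\<Sum>f\<in>?B \<rightarrow>\<^sub>E J. ?P ?B f * ?E ?B f)"
      if l: "l \<in> J" for l
    proof -
      have "(\<Sum>f\<in>A \<rightarrow>\<^sub>E J. ?S b l f) = (\<Sum>l'\<in>J. \<Sum>f\<in>?B \<rightarrow>\<^sub>E J. ?S b l (f(b := l')))"
        by (subst (1) AB) (rule sum_PiE_insert[OF B(2)])
      also have "\<dots> = (\<Sum>l'\<in>J. if l' = l then \<Sum>f\<in>?B \<rightarrow>\<^sub>E J. x a l * x b l * (\<sigma> l)\<^sup>2 * (?P ?B f * ?E ?B f) else 0)"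
      proof (intro sum.cong refl)
        fix l'
        have "?P A (f(b := l')) = x b l' * ?P ?B f" for f
          by (subst prod.remove[OF A b]) (simp add: E_upd(2)[OF B(2)] del: fun_upd_apply, simp)
        then have "(\<Sum>f\<in>?B \<rightarrow>\<^sub>E J. ?S b l (f(b := l'))) = (\<Sum>f\<in>?B \<rightarrow>\<^sub>E J.
            if l' = l then x a l * (x b l' * ?P ?B f) * ((\<sigma> l)\<^sup>2 * ?E ?B f) else 0)"
          by (simp only: E_upd(1)[OF B(2)] fun_upd_same)
        then show "(\<Sum>f\<in>?B \<rightarrow>\<^sub>E J. ?S b l (f(b := l'))) =
            (if l' = l then \<Sum>f\<in>?B \<rightarrow>\<^sub>E J. x a l * x b l * (\<sigma> l)\<^sup>2 * (?P ?B f * ?E ?B f) else 0)"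
          by (simp add: mult_ac)
      qed
      also have "\<dots> = (\<Sum>f\<in>?B \<rightarrow>\<^sub>E J. x a l * x b l * (\<sigma> l)\<^sup>2 * (?P ?B f * ?E ?B f))"
        using l fin by simp
      finally show ?thesis by (simp only: sum_distrib_left)
    qed
    then show "(\<Sum>l\<in>J. \<Sum>f\<in>A \<rightarrow>\<^sub>E J. ?S b l f) =
        cov (x a) (x b) * gauss_expect J \<sigma> (\<lambda>w. \<Prod>i\<in>?B. lin (x i) w)"
      using B(1) by (simp add: prod_lin cov_def sum_distrib_right)
  qed
  finally show ?thesis .
qed

end

lemma sum_permutations_of_set:
  assumes "finite A" "A \<noteq> {}"
  shows "(\<Sum>xs\<in>permutations_of_set A. F xs) =
    (\<Sum>a\<in>A. \<Sum>xs\<in>permutations_of_set (A - {a}). F (a # xs))"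
  unfolding permutations_of_set_nonempty[OF assms(2)]
  by (subst sum.UNION_disjoint) (use assms(1) in \<open>auto simp: sum.reindex\<close>)

text \<open>
  The first two entries of an arrangement form an arbitrary ordered pair. The factor \<open>2 (k + 1)\<close> is
  the quotient of the normalizations for \<open>k + 1\<close> and \<open>k\<close> pairs.
\<close>

lemma pairing_sum_rec:
  assumes A: "finite A" "card A = 2 * Suc k"
  shows "(2 * real (Suc k)) * pairing_sum \<kappa> A =
    (\<Sum>a\<in>A. \<Sum>b\<in>A - {a}. \<kappa> a b * pairing_sum \<kappa> (A - {a} - {b}))"
proof -
  define T where "T m B = (\<Sum>xs\<in>permutations_of_set B. \<Prod>l<m. \<kappa> (xs ! (2 * l)) (xs ! (2 * l + 1)))" for m B
  have ne: "A \<noteq> {}" using A by auto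
  have "T (Suc k) A = (\<Sum>a\<in>A. \<Sum>b\<in>A - {a}. \<Sum>xs\<in>permutations_of_set (A - {a} - {b}).
      \<Prod>l<Suc k. \<kappa> ((a # b # xs) ! (2 * l)) ((a # b # xs) ! (2 * l + 1)))"
    unfolding T_def
  proof (subst sum_permutations_of_set[OF A(1) ne], intro sum.cong refl)
    fix a assume "a \<in> A"
    then have "card (A - {a}) = 2 * k + 1" using A by simp
    then have "A - {a} \<noteq> {}" by (metis card.empty add_is_0 one_neq_zero)
    then show "(\<Sum>xs\<in>permutations_of_set (A - {a}). \<Prod>l<Suc k. \<kappa> ((a # xs) ! (2 * l)) ((a # xs) ! (2 * l + 1))) =
        (\<Sum>b\<in>A - {a}. \<Sum>xs\<in>permutations_of_set (A - {a} - {b}).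
          \<Prod>l<Suc k. \<kappa> ((a # b # xs) ! (2 * l)) ((a # b # xs) ! (2 * l + 1)))"
      using A(1) by (intro sum_permutations_of_set) auto
  qed
  also have "\<dots> = (\<Sum>a\<in>A. \<Sum>b\<in>A - {a}. \<kappa> a b * T k (A - {a} - {b}))"
    by (simp add: T_def sum_distrib_left prod.lessThan_Suc_shift del: prod.lessThan_Suc)
  finally have T: "T (Suc k) A = (\<Sum>a\<in>A. \<Sum>b\<in>A - {a}. \<kappa> a b * T k (A - {a} - {b}))" .
  have PA: "pairing_sum \<kappa> A = T (Suc k) A / (2 ^ Suc k * fact (Suc k))"
    by (simp add: pairing_sum_def A(2) T_def)
  have PB: "pairing_sum \<kappa> (A - {a} - {b}) = T k (A - {a} - {b}) / (2 ^ k * fact k)"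
    if "a \<in> A" "b \<in> A - {a}" for a b
  proof -
    have "card (A - {a} - {b}) = 2 * k" using that A by simp
    then show ?thesis by (simp add: pairing_sum_def T_def)
  qed
  have "(\<Sum>a\<in>A. \<Sum>b\<in>A - {a}. \<kappa> a b * pairing_sum \<kappa> (A - {a} - {b})) =
      (\<Sum>a\<in>A. \<Sum>b\<in>A - {a}. \<kappa> a b * T k (A - {a} - {b}) / (2 ^ k * fact k))"
    by (intro sum.cong refl) (simp add: PB)
  also have "\<dots> = T (Suc k) A / (2 ^ k * fact k)"
    by (simp add: T sum_divide_distrib)
  also have "\<dots> = (2 * real (Suc k)) * pairing_sum \<kappa> A"
    unfolding PA by (simp add: field_simps del: of_nat_Suc)
  finally show ?thesis by simp
qed

context gaussian
begin

text \<open>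
  Wick's formula. Integration by parts may single out any factor; averaging over this choice
  gives the recursion that \<^const>\<open>pairing_sum\<close> satisfies.
\<close>

lemma wick:
  assumes "finite A"
  shows "gauss_expect J \<sigma> (\<lambda>w. \<Prod>i\<in>A. lin (x i) w) = pairing_sum (\<lambda>i j. cov (x i) (x j)) A"
  using assms
proof (induction "card A" arbitrary: A rule: less_induct)
  case less
  let ?E = "\<lambda>A. gauss_expect J \<sigma> (\<lambda>w. \<Prod>i\<in>A. lin (x i) w)"
  let ?P = "pairing_sum (\<lambda>i j. cov (x i) (x j))"
  have rec: "?E A = (\<Sum>b\<in>A - {a}. cov (x a) (x b) * ?P (A - {a} - {b}))" if a: "a \<in> A" for a
  proof -
    have "?E (A - {a} - {b}) = ?P (A - {a} - {b})" if "b \<in> A - {a}" for b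
    proof (rule less.hyps)
      have "A - {a} - {b} \<subset> A" using a by auto
      then show "card (A - {a} - {b}) < card A" using less.prems by (intro psubset_card_mono)
    qed (use less.prems in simp)
    then show ?thesis
      using prod_lin_insert[of "A - {a}" a x] less.prems a by (simp add: insert_absorb)
  qed
  consider "A = {}" | "odd (card A)" | k where "card A = 2 * Suc k"
    using less.prems by (metis card_eq_0_iff evenE mult_is_0 not0_implies_Suc)
  then show ?case
  proof cases
    case 1
    have "gauss_expect J \<sigma> (\<lambda>w. \<Prod>j\<in>J. w j ^ 0) = (\<Prod>j\<in>J. gauss_moment (\<sigma> j) 0)"
      by (rule gauss_monomial(2)[OF fin pos])
    then show ?thesis
      using pos by (simp add: 1 pairing_sum_def gauss_moment_0)
  next
    case 2
    then obtain a where a: "a \<in> A" by fastforce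
    have "?P (A - {a} - {b}) = 0" if b: "b \<in> A - {a}" for b
    proof -
      have "card A = Suc (Suc (card (A - {a} - {b})))"
        using less.prems a b by (metis card.remove finite_Diff)
      then show ?thesis using 2 by (simp add: pairing_sum_def)
    qed
    then show ?thesis using rec[OF a] 2 by (simp add: pairing_sum_def)
  next
    case 3
    have "(2 * real (Suc k)) * ?E A = (\<Sum>a\<in>A. ?E A)" using 3 by simp
    also have "\<dots> = (\<Sum>a\<in>A. \<Sum>b\<in>A - {a}. cov (x a) (x b) * ?P (A - {a} - {b}))"
      by (intro sum.cong refl rec)
    also have "\<dots> = (2 * real (Suc k)) * ?P A"
      using pairing_sum_rec[OF less.prems 3] by simp
    finally show ?thesis by simp
  qed
qed

text \<open>The subset \<open>I\<close> collects the factors that contribute their constant term.\<close>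

lemma expect_prod_affine:
  assumes "finite A"
  shows "gauss_integrable J \<sigma> (\<lambda>w. \<Prod>i\<in>A. c i + lin (x i) w)"
    and "gauss_expect J \<sigma> (\<lambda>w. \<Prod>i\<in>A. c i + lin (x i) w) =
      (\<Sum>I\<in>Pow A. (\<Prod>i\<in>I. c i) * pairing_sum (\<lambda>i j. cov (x i) (x j)) (A - I))"
proof -
  have eq: "(\<lambda>w. \<Prod>i\<in>A. c i + lin (x i) w) =
      (\<lambda>w. \<Sum>I\<in>Pow A. (\<Prod>i\<in>I. c i) * (\<Prod>i\<in>A - I. lin (x i) w))"
    using assms by (simp add: prod_add)
  have int: "gauss_integrable J \<sigma> (\<lambda>w. (\<Prod>i\<in>I. c i) * (\<Prod>i\<in>A - I. lin (x i) w))" for I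
    using assms by (intro gauss_cmult prod_lin) auto
  show "gauss_integrable J \<sigma> (\<lambda>w. \<Prod>i\<in>A. c i + lin (x i) w)"
    unfolding eq by (intro gauss_sum(1) int)
  show "gauss_expect J \<sigma> (\<lambda>w. \<Prod>i\<in>A. c i + lin (x i) w) =
      (\<Sum>I\<in>Pow A. (\<Prod>i\<in>I. c i) * pairing_sum (\<lambda>i j. cov (x i) (x j)) (A - I))"
    unfolding eq using assms by (subst gauss_sum(2)[OF int]) (simp add: gauss_cmult wick)
qed

lemma expect_alternate:
  "gauss_expect J \<sigma> (\<lambda>w. alternate n (\<lambda>us. \<Prod>i<n. c i (us ! i) + lin (x i (us ! i)) w) vs) =
    alternate n (\<lambda>us. \<Sum>I\<in>Pow {..<n}. (\<Prod>i\<in>I. c i (us ! i)) *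
      pairing_sum (\<lambda>i j. cov (x i (us ! i)) (x j (us ! j))) ({..<n} - I)) vs"
proof (cases "length vs = n")
  case True
  show ?thesis
    unfolding alternate_def using True
    by (simp add: gauss_sum(2)[OF gauss_cmult(1)[OF expect_prod_affine(1)]] gauss_cmult(2) expect_prod_affine(2))
next
  case False
  then show ?thesis by (simp add: alternate_length gauss_expect_def)
qed

end

section \<open>Shears and orthogonalization\<close>

lemma emeasure_lborel_shift:
  assumes "A \<in> sets borel"
  shows "{s. s + c \<in> A} \<in> sets borel" "emeasure lborel {s. s + c \<in> A} = emeasure lborel (A :: real set)"
proof -
  have vim: "(\<lambda>s. c + s) -` A = {s. s + c \<in> A}" by (auto simp: add.commute)
  have meas: "(\<lambda>s. c + s) \<in> borel \<rightarrow>\<^sub>M (borel :: real measure)" by simp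
  show "{s. s + c \<in> A} \<in> sets borel" using measurable_sets[OF meas assms] by (simp add: vim)
  have "emeasure lborel A = emeasure (distr lborel borel (\<lambda>s. c + s)) A"
    by (simp add: lborel_distr_plus)
  also have "\<dots> = emeasure lborel {s. s + c \<in> A}"
    using assms by (subst emeasure_distr) (simp_all add: vim)
  finally show "emeasure lborel {s. s + c \<in> A} = emeasure lborel A" by simp
qed

definition shear :: "nat set \<Rightarrow> nat \<Rightarrow> (nat \<Rightarrow> real) \<Rightarrow> rvec \<Rightarrow> rvec"
  where "shear L k t w = (\<lambda>l. if l \<in> L then w l + t l * w k else w l)"

text \<open>
  With the coordinate \<open>k\<close> frozen, the shear translates the other coordinates, and translations
  preserve the measure of boxes.
\<close>

lemma shear_preserves_lborel:
  assumes J: "finite J" "k \<in> J" and L: "L \<subseteq> J - {k}"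
  shows "shear L k t \<in> (\<Pi>\<^sub>M j\<in>J. lborel) \<rightarrow>\<^sub>M (\<Pi>\<^sub>M j\<in>J. lborel)"
    and "distr (\<Pi>\<^sub>M j\<in>J. lborel) (\<Pi>\<^sub>M j\<in>J. lborel) (shear L k t) = (\<Pi>\<^sub>M j\<in>J. lborel)"
proof -
  interpret product_sigma_finite "\<lambda>_. lborel :: real measure" by standard
  let ?M = "\<Pi>\<^sub>M j\<in>J. lborel :: real measure" and ?S = "shear L k t"
  have comp: "(\<lambda>w. w j) \<in> ?M \<rightarrow>\<^sub>M borel" if "j \<in> J" for j
    using measurable_component_singleton[OF that, of "\<lambda>_. lborel"] by (simp add: measurable_lborel2)
  show S: "?S \<in> ?M \<rightarrow>\<^sub>M ?M"
  proof (rule measurable_PiM_single')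
    show "?S \<in> space ?M \<rightarrow> (\<Pi>\<^sub>E j\<in>J. space lborel)"
      using L by (auto simp: space_PiM PiE_iff extensional_def shear_def)
    fix j assume j: "j \<in> J"
    show "(\<lambda>w. ?S w j) \<in> ?M \<rightarrow>\<^sub>M lborel"
      using comp[OF j] comp[OF J(2)]
      by (cases "j \<in> L") (simp_all add: shear_def)
  qed
  show "distr ?M ?M ?S = ?M"
  proof (rule PiM_eqI[OF J(1)])
    fix A :: "nat \<Rightarrow> real set" assume A: "\<And>i. i \<in> J \<Longrightarrow> A i \<in> sets lborel"
    let ?I = "J - {k}"
    have JI: "J = insert k ?I" using J by auto
    have box: "Pi\<^sub>E J A \<in> sets ?M" using A J by (intro sets_PiM_I_finite) auto
    let ?B = "\<lambda>y l. if l \<in> L then {s. s + t l * y \<in> A l} else A l"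
    have B: "?B y l \<in> sets lborel" "emeasure lborel (?B y l) = emeasure lborel (A l)" if "l \<in> ?I" for y l
      using that A[of l] emeasure_lborel_shift[of "A l" "t l * y"] by auto
    have "emeasure (distr ?M ?M ?S) (Pi\<^sub>E J A) = emeasure ?M (?S -` Pi\<^sub>E J A \<inter> space ?M)"
      by (rule emeasure_distr[OF S box])
    also have "\<dots> = (\<integral>\<^sup>+ w. indicator (?S -` Pi\<^sub>E J A \<inter> space ?M) w \<partial>?M)"
      using measurable_sets[OF S box] by simp
    also have "\<dots> = (\<integral>\<^sup>+ y. (\<integral>\<^sup>+ x. indicator (?S -` Pi\<^sub>E J A \<inter> space ?M) (x(k := y)) \<partial>(\<Pi>\<^sub>M j\<in>?I. lborel)) \<partial>lborel)"
      by (rule product_nn_integral_insert_rev[of ?I k, folded JI])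
        (use measurable_sets[OF S box] J(1) in simp_all)
    also have "\<dots> = (\<integral>\<^sup>+ y. indicator (A k) y * (\<Prod>l\<in>?I. emeasure lborel (A l)) \<partial>lborel)"
    proof (intro nn_integral_cong)
      fix y
      have "(\<integral>\<^sup>+ x. indicator (?S -` Pi\<^sub>E J A \<inter> space ?M) (x(k := y)) \<partial>(\<Pi>\<^sub>M j\<in>?I. lborel)) =
          (\<integral>\<^sup>+ x. indicator (A k) y * indicator (Pi\<^sub>E ?I (?B y)) x \<partial>(\<Pi>\<^sub>M j\<in>?I. lborel))"
      proof (intro nn_integral_cong)
        fix x assume "x \<in> space (\<Pi>\<^sub>M j\<in>?I. lborel :: real measure)"
        then have ext: "\<And>j. j \<notin> ?I \<Longrightarrow> x j = undefined" by (auto simp: space_PiM PiE_iff extensional_def)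
        have "x(k := y) \<in> ?S -` Pi\<^sub>E J A \<inter> space ?M \<longleftrightarrow> y \<in> A k \<and> x \<in> Pi\<^sub>E ?I (?B y)"
          using L J(2) ext
          by (auto simp: space_PiM PiE_iff extensional_def shear_def Ball_def subset_iff)
        then show "indicator (?S -` Pi\<^sub>E J A \<inter> space ?M) (x(k := y)) =
            (indicator (A k) y * indicator (Pi\<^sub>E ?I (?B y)) x :: ennreal)"
          by (simp add: indicator_def)
      qed
      also have "\<dots> = indicator (A k) y * emeasure (\<Pi>\<^sub>M j\<in>?I. lborel) (Pi\<^sub>E ?I (?B y))"
        using B J(1) by (subst nn_integral_cmult_indicator) (auto intro!: sets_PiM_I_finite)
      also have "emeasure (\<Pi>\<^sub>M j\<in>?I. lborel) (Pi\<^sub>E ?I (?B y)) = (\<Prod>l\<in>?I. emeasure lborel (A l))"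
        using B J(1) by (subst emeasure_PiM) (auto intro!: prod.cong)
      finally show "(\<integral>\<^sup>+ x. indicator (?S -` Pi\<^sub>E J A \<inter> space ?M) (x(k := y)) \<partial>(\<Pi>\<^sub>M j\<in>?I. lborel)) =
          indicator (A k) y * (\<Prod>l\<in>?I. emeasure lborel (A l))" .
    qed
    also have "\<dots> = (\<Prod>l\<in>J. emeasure lborel (A l))"
      using A[OF J(2)] J by (simp add: nn_integral_multc prod.remove)
    finally show "emeasure (distr ?M ?M ?S) (Pi\<^sub>E J A) = (\<Prod>l\<in>J. emeasure lborel (A l))" .
  qed simp
qed

definition ip :: "nat \<Rightarrow> rvec \<Rightarrow> rvec \<Rightarrow> real"
  where "ip N x y = (\<Sum>k<N. x k * y k)"

lemma ip_commute: "ip N x y = ip N y x"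
  by (simp add: ip_def mult.commute)

lemma ip_sum_right: "ip N x (\<lambda>k. \<Sum>j\<in>J. c j * y j k) = (\<Sum>j\<in>J. c j * ip N x (y j))"
  by (simp add: ip_def sum_distrib_left mult_ac sum.swap[of _ J])

lemma ip_sum_left: "ip N (\<lambda>k. \<Sum>j\<in>J. c j * y j k) x = (\<Sum>j\<in>J. c j * ip N (y j) x)"
  by (simp add: ip_commute[of N _ x] ip_sum_right)

lemma ip_add_right: "ip N x (\<lambda>k. y k + z k) = ip N x y + ip N x z"
  by (simp add: ip_def algebra_simps sum.distrib)

lemma ip_diff_right: "ip N x (\<lambda>k. y k - z k) = ip N x y - ip N x z"
  by (simp add: ip_def algebra_simps sum_subtractf)

lemma ip_zero_imp: "ip N x x = 0 \<Longrightarrow> ip N y x = 0"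
  unfolding ip_def by (auto simp: sum_nonneg_eq_0_iff intro!: sum.neutral)

definition frame_mat :: "nat \<Rightarrow> nat \<Rightarrow> (nat \<Rightarrow> rvec) \<Rightarrow> (nat \<Rightarrow> rvec) \<Rightarrow> real mat"
  where "frame_mat n m e g = Matrix.mat (n + m) (n + m) (\<lambda>(k, c). if c < n then e c k else g (c - n) k)"

text \<open>The change of frame is right multiplication by a unipotent triangular matrix.\<close>

lemma det_frame_mat_shear:
  assumes r: "r < m"
  shows "Determinant.det (frame_mat n m e (g(r := \<lambda>k. g r k - (\<Sum>l<r. t l * g l k)))) =
    Determinant.det (frame_mat n m e g)"
proof -
  let ?N = "n + m"
  let ?C = "Matrix.mat ?N ?N (\<lambda>(a, c). if a = c then 1
    else if c = n + r \<and> n \<le> a \<and> a < n + r then - t (a - n) else 0 :: real)"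
  have FC: "frame_mat n m e g \<in> carrier_mat ?N ?N" by (simp add: frame_mat_def)
  have CC: "?C \<in> carrier_mat ?N ?N" by simp
  have "Determinant.det ?C = prod_list (diag_mat ?C)"
    by (rule det_upper_triangular[OF _ CC]) (auto simp: upper_triangular_def)
  also have "diag_mat ?C = map (\<lambda>_. 1) [0..<?N]"
    by (auto simp: diag_mat_def)
  also have "prod_list \<dots> = 1" by (simp add: map_replicate_const)
  finally have dC: "Determinant.det ?C = 1" .
  have "frame_mat n m e (g(r := \<lambda>k. g r k - (\<Sum>l<r. t l * g l k))) = frame_mat n m e g * ?C"
  proof (rule eq_matI)
    fix k c assume "k < dim_row (frame_mat n m e g * ?C)" "c < dim_col (frame_mat n m e g * ?C)"
    then have kc: "k < ?N" "c < ?N" by (auto simp: frame_mat_def)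
    let ?F = "\<lambda>a. if a < n then e a k else g (a - n) k"
    let ?c = "\<lambda>a. if a = c then 1 else if c = n + r \<and> n \<le> a \<and> a < n + r then - t (a - n) else 0"
    have "(frame_mat n m e g * ?C) $$ (k, c) = (\<Sum>a<?N. ?F a * ?c a)"
      using kc by (simp add: frame_mat_def scalar_prod_def lessThan_atLeast0)
    also have "\<dots> = ?F c + (\<Sum>a\<in>{..<?N} - {c}. ?F a * ?c a)"
      using kc by (subst sum.remove[of _ c]) auto
    also have "(\<Sum>a\<in>{..<?N} - {c}. ?F a * ?c a) = (if c = n + r then - (\<Sum>l<r. t l * g l k) else 0)"
    proof (cases "c = n + r")
      case True
      have "(\<Sum>a\<in>{..<?N} - {c}. ?F a * ?c a) = (\<Sum>a\<in>{n..<n + r}. ?F a * ?c a)"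
        using True r by (intro sum.mono_neutral_right) auto
      also have "\<dots> = (\<Sum>l<r. ?F (n + l) * ?c (n + l))"
        by (rule sum.reindex_bij_witness[of _ "\<lambda>l. n + l" "\<lambda>a. a - n"]) auto
      also have "\<dots> = (\<Sum>l<r. - (t l * g l k))"
        using True by (intro sum.cong) auto
      finally show ?thesis using True by (simp add: sum_negf)
    qed (auto intro!: sum.neutral)
    finally show "frame_mat n m e (g(r := \<lambda>k. g r k - (\<Sum>l<r. t l * g l k))) $$ (k, c) =
        (frame_mat n m e g * ?C) $$ (k, c)"
      using kc by (auto simp: frame_mat_def)
  qed (simp_all add: frame_mat_def)
  then show ?thesis using det_mult[OF FC CC] dC by simp
qed

text \<open>
  Gram-Schmidt without normalization: it only uses shears, so that the determinant of the frame
  and the measure on the coefficients are unchanged.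
\<close>

lemma orthogonalization:
  obtains b :: "nat \<Rightarrow> rvec" and S :: "rvec \<Rightarrow> rvec"
  where "S \<in> (\<Pi>\<^sub>M j\<in>{q..<q+m}. lborel) \<rightarrow>\<^sub>M (\<Pi>\<^sub>M j\<in>{q..<q+m}. lborel)"
    and "distr (\<Pi>\<^sub>M j\<in>{q..<q+m}. lborel) (\<Pi>\<^sub>M j\<in>{q..<q+m}. lborel) S = (\<Pi>\<^sub>M j\<in>{q..<q+m}. lborel)"
    and "\<And>w k. (\<Sum>j<m. w (q + j) * g j k) = (\<Sum>j<m. S w (q + j) * b j k)"
    and "\<And>i j. i < j \<Longrightarrow> j < m \<Longrightarrow> ip N (b i) (b j) = 0"
    and "\<And>x j. (\<And>j. j < m \<Longrightarrow> ip N x (g j) = 0) \<Longrightarrow> j < m \<Longrightarrow> ip N x (b j) = 0"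
    and "Determinant.det (frame_mat n m e b) = Determinant.det (frame_mat n m e g)"
proof -
  let ?M = "\<Pi>\<^sub>M j\<in>{q..<q+m}. lborel :: real measure"
  have "\<exists>b S. S \<in> ?M \<rightarrow>\<^sub>M ?M \<and> distr ?M ?M S = ?M \<and>
      (\<forall>w k. (\<Sum>j<m. w (q + j) * g j k) = (\<Sum>j<m. S w (q + j) * b j k)) \<and>
      (\<forall>i j. i < j \<longrightarrow> j < r \<longrightarrow> ip N (b i) (b j) = 0) \<and>
      (\<forall>x. (\<forall>j<m. ip N x (g j) = 0) \<longrightarrow> (\<forall>j<m. ip N x (b j) = 0)) \<and>
      Determinant.det (frame_mat n m e b) = Determinant.det (frame_mat n m e g)" if "r \<le> m" for r
    using that
  proof (induction r)
    case 0
    have "distr ?M ?M (\<lambda>w. w) = ?M" by (rule distr_id)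
    then show ?case by (intro exI[of _ g] exI[of _ "\<lambda>w. w"]) auto
  next
    case (Suc r)
    then have r: "r < m" by simp
    obtain b S where S: "S \<in> ?M \<rightarrow>\<^sub>M ?M" "distr ?M ?M S = ?M"
      and wb: "\<And>w k. (\<Sum>j<m. w (q + j) * g j k) = (\<Sum>j<m. S w (q + j) * b j k)"
      and orth: "\<And>i j. i < j \<Longrightarrow> j < r \<Longrightarrow> ip N (b i) (b j) = 0"
      and perp: "\<And>x. (\<forall>j<m. ip N x (g j) = 0) \<Longrightarrow> (\<forall>j<m. ip N x (b j) = 0)"
      and dt: "Determinant.det (frame_mat n m e b) = Determinant.det (frame_mat n m e g)"
      using Suc by (auto simp: Suc_le_eq)
    \<comment> \<open>If \<open>b l\<close> vanishes, then \<open>t l = 0\<close>, and \<open>b r\<close> is already orthogonal to \<open>b l\<close>.\<close>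
    define t where "t l = ip N (b l) (b r) / ip N (b l) (b l)" for l
    define b' where "b' = b(r := \<lambda>k. b r k - (\<Sum>l<r. t l * b l k))"
    \<comment> \<open>\<open>R\<close> adds to the earlier coefficients what \<open>b r\<close> loses.\<close>
    define R where "R = shear {q..<q + r} (q + r) (\<lambda>l. t (l - q))"
    have R: "R \<in> ?M \<rightarrow>\<^sub>M ?M" "distr ?M ?M R = ?M"
      unfolding R_def by (rule shear_preserves_lborel; use r in auto)+
    have ipb': "ip N x (b' r) = ip N x (b r) - (\<Sum>l<r. t l * ip N x (b l))" for x
      by (simp add: b'_def ip_diff_right ip_sum_right)
    have "(\<Sum>j<m. u (q + j) * b j k) = (\<Sum>j<m. R u (q + j) * b' j k)" for u k
    proof -
      have "(\<Sum>j\<in>{..<m} - {r}. R u (q + j) * b' j k) =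
          (\<Sum>j\<in>{..<m} - {r}. u (q + j) * b j k + (if j < r then u (q + r) * (t j * b j k) else 0))"
        by (intro sum.cong) (auto simp: R_def shear_def b'_def algebra_simps)
      also have "\<dots> = (\<Sum>j\<in>{..<m} - {r}. u (q + j) * b j k) + u (q + r) * (\<Sum>l<r. t l * b l k)"
      proof -
        have "(\<Sum>j\<in>{..<m} - {r}. if j < r then u (q + r) * (t j * b j k) else 0) =
            (\<Sum>l<r. u (q + r) * (t l * b l k))"
          using r by (intro sum.mono_neutral_cong_right) auto
        then show ?thesis by (simp add: sum.distrib sum_distrib_left)
      qed
      finally show ?thesis
        using r by (subst (1 2) sum.remove[of "{..<m}" r]) (auto simp: R_def shear_def b'_def algebra_simps)
    qed
    note Rb = this
    have "ip N (b' i) (b' j) = 0" if "i < j" "j < Suc r" for i j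
    proof (cases "j = r")
      case True
      then have i: "i < r" using that by simp
      have "(\<Sum>l<r. t l * ip N (b i) (b l)) = t i * ip N (b i) (b i)"
      proof -
        have "(\<Sum>l<r. t l * ip N (b i) (b l)) = (\<Sum>l<r. if l = i then t i * ip N (b i) (b i) else 0)"
          using orth i by (intro sum.cong refl) (metis ip_commute lessThan_iff linorder_neqE_nat mult_zero_right)
        then show ?thesis using i by simp
      qed
      also have "\<dots> = ip N (b i) (b r)"
        by (cases "ip N (b i) (b i) = 0") (simp_all add: t_def ip_zero_imp[of N "b i" "b r"] ip_commute[of N "b i" "b r"])
      finally have "ip N (b i) (b' r) = 0" by (simp add: ipb')
      then show ?thesis using True i by (simp add: b'_def)
    next
      case False
      then show ?thesis using that orth by (simp add: b'_def)
    qed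
    moreover have "\<forall>j<m. ip N x (b' j) = 0" if "\<forall>j<m. ip N x (g j) = 0" for x
    proof (intro allI impI)
      fix j assume "j < m"
      then show "ip N x (b' j) = 0"
        using perp[OF that] r ipb'[of x] by (cases "j = r") (auto simp: b'_def)
    qed
    moreover have "Determinant.det (frame_mat n m e b') = Determinant.det (frame_mat n m e g)"
      unfolding b'_def det_frame_mat_shear[OF r] by (rule dt)
    moreover have "R \<circ> S \<in> ?M \<rightarrow>\<^sub>M ?M" by (rule measurable_comp[OF S(1) R(1)])
    moreover have "distr ?M ?M (R \<circ> S) = ?M"
      using distr_distr[OF R(1) S(1)] S(2) R(2) by simp
    moreover have "(\<Sum>j<m. w (q + j) * g j k) = (\<Sum>j<m. (R \<circ> S) w (q + j) * b' j k)" for w k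
      using wb Rb by simp
    ultimately show ?case by blast
  qed
  from this[of m] show thesis using that by auto
qed

section \<open>Gaussian integrals over the span of a frame\<close>

text \<open>
  A frame of \<open>R^(n+m)\<close> at a single point: \<open>e\<close> is a frame of the fiber of \<open>V\<close> and \<open>g\<close> one of the
  fiber of \<open>W\<close>.
\<close>

locale split_frame =
  fixes n m :: nat and e g :: "nat \<Rightarrow> rvec"
  assumes e_orthonormal: "\<And>i j. i < n \<Longrightarrow> j < n \<Longrightarrow> ip (n + m) (e i) (e j) = (if i = j then 1 else 0)"
    and e_perp_g: "\<And>i j. i < n \<Longrightarrow> j < m \<Longrightarrow> ip (n + m) (e i) (g j) = 0"
    and det_nonzero: "Determinant.det (frame_mat n m e g) \<noteq> 0"
begin

lemma frame_mat_ip: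
  assumes "a < n + m" "c < n + m"
  shows "(transpose_mat (frame_mat n m e g) * frame_mat n m e' g') $$ (a, c) =
    ip (n + m) (if a < n then e a else g (a - n)) (if c < n then e' c else g' (c - n))"
  using assms by (simp add: frame_mat_def scalar_prod_def ip_def lessThan_atLeast0 if_distrib if_distribR)

text \<open>
  Multiplying by the transpose of the frame matrix replaces the columns by their inner products
  with the frame. The result is block triangular, because \<open>e\<close> is orthogonal to \<open>g\<close>; for
  \<open>x = e\<close> it is the Gram matrix.
\<close>

lemma det_project:
  "Determinant.det (frame_mat n m x g) = Determinant.det (frame_mat n m e g) *
    Determinant.det (Matrix.mat n n (\<lambda>(i, b). ip (n + m) (e i) (x b)))"
proof -
  let ?F = "frame_mat n m e g"
  let ?A = "\<lambda>x. Matrix.mat n n (\<lambda>(i, b). ip (n + m) (e i) (x b))"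
  let ?C = "\<lambda>x. Matrix.mat m n (\<lambda>(i, b). ip (n + m) (g i) (x b))"
  let ?G = "Matrix.mat m m (\<lambda>(i, b). ip (n + m) (g i) (g b))"
  have car: "frame_mat n m x g \<in> carrier_mat (n + m) (n + m)" for x by (simp add: frame_mat_def)
  have blk: "transpose_mat ?F * frame_mat n m x g = four_block_mat (?A x) (0\<^sub>m n m) (?C x) ?G" for x
  proof (rule eq_matI)
    fix a c assume "a < dim_row (four_block_mat (?A x) (0\<^sub>m n m) (?C x) ?G)"
      "c < dim_col (four_block_mat (?A x) (0\<^sub>m n m) (?C x) ?G)"
    then have ac: "a < n + m" "c < n + m" by auto
    then show "(transpose_mat ?F * frame_mat n m x g) $$ (a, c) =
        four_block_mat (?A x) (0\<^sub>m n m) (?C x) ?G $$ (a, c)"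
      unfolding frame_mat_ip[OF ac] using e_perp_g by auto
  qed (simp_all add: frame_mat_def)
  have "Determinant.det ?F * Determinant.det (frame_mat n m x g) =
      Determinant.det (?A x) * Determinant.det ?G" for x
  proof -
    have "Determinant.det ?F * Determinant.det (frame_mat n m x g) =
        Determinant.det (transpose_mat ?F * frame_mat n m x g)"
      using car by (simp add: det_mult[of _ "n + m"] det_transpose[OF car])
    also have "\<dots> = Determinant.det (?A x) * Determinant.det ?G"
      unfolding blk by (rule det_four_block_mat_upper_right_zero) auto
    finally show ?thesis .
  qed
  note D = this
  have "?A e = 1\<^sub>m n" by (rule eq_matI) (auto simp: e_orthonormal)
  then have "Determinant.det ?F * Determinant.det ?F = Determinant.det ?G"
    using D[of e] by simp
  then have "Determinant.det ?F * Determinant.det (frame_mat n m x g) =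
      Determinant.det ?F * (Determinant.det ?F * Determinant.det (?A x))"
    using D[of x] by (simp add: mult_ac)
  then show ?thesis using det_nonzero by simp
qed

end

locale orthogonal_split_frame = split_frame +
  assumes g_orthogonal: "\<And>i j. i < m \<Longrightarrow> j < m \<Longrightarrow> i \<noteq> j \<Longrightarrow> ip (n + m) (g i) (g j) = 0"
begin

lemma gram_diagonal:
  "transpose_mat (frame_mat n m e g) * frame_mat n m e g =
    Matrix.mat (n + m) (n + m) (\<lambda>(a, c). if a = c then if a < n then 1 else ip (n + m) (g (a - n)) (g (a - n)) else 0)"
proof (rule eq_matI)
  fix a c assume "a < dim_row (Matrix.mat (n + m) (n + m) (\<lambda>(a, c). if a = c then if a < n then 1 else ip (n + m) (g (a - n)) (g (a - n)) else 0 :: real))"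
    "c < dim_col (Matrix.mat (n + m) (n + m) (\<lambda>(a, c). if a = c then if a < n then 1 else ip (n + m) (g (a - n)) (g (a - n)) else 0 :: real))"
  then have ac: "a < n + m" "c < n + m" by auto
  have "ip (n + m) (g i) (e j) = 0" if "i < m" "j < n" for i j
    using e_perp_g[OF that(2,1)] by (simp add: ip_commute)
  moreover have "a - n \<noteq> c - n" if "\<not> a < n" "\<not> c < n" "a \<noteq> c" using that by linarith
  ultimately show "(transpose_mat (frame_mat n m e g) * frame_mat n m e g) $$ (a, c) =
      Matrix.mat (n + m) (n + m) (\<lambda>(a, c). if a = c then if a < n then 1 else ip (n + m) (g (a - n)) (g (a - n)) else 0) $$ (a, c)"
    unfolding frame_mat_ip[OF ac] using ac by (auto simp: e_orthonormal e_perp_g g_orthogonal)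
qed (simp_all add: frame_mat_def)

lemma det_squared:
  "(Determinant.det (frame_mat n m e g))\<^sup>2 = (\<Prod>j<m. ip (n + m) (g j) (g j))"
proof -
  have car: "frame_mat n m e g \<in> carrier_mat (n + m) (n + m)" by (simp add: frame_mat_def)
  let ?D = "\<lambda>a. if a < n then 1 else ip (n + m) (g (a - n)) (g (a - n))"
  have "(Determinant.det (frame_mat n m e g))\<^sup>2 =
      Determinant.det (transpose_mat (frame_mat n m e g) * frame_mat n m e g)"
    using car by (simp add: det_mult[of _ "n + m"] det_transpose[OF car] power2_eq_square)
  also have "\<dots> = prod_list (diag_mat (transpose_mat (frame_mat n m e g) * frame_mat n m e g))"
    by (rule det_upper_triangular[of _ "n + m"]) (simp_all add: gram_diagonal upper_triangular_def)
  also have "\<dots> = (\<Prod>a\<in>{0..<n + m}. ?D a)"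
  proof -
    have "diag_mat (transpose_mat (frame_mat n m e g) * frame_mat n m e g) = map ?D [0..<n + m]"
      by (simp add: gram_diagonal diag_mat_def)
    then show ?thesis using prod.distinct_set_conv_list[of "[0..<n + m]" ?D] by simp
  qed
  also have "{0..<n + m} = {0..<n} \<union> {n..<n + m}" by auto
  also have "(\<Prod>a\<in>{0..<n} \<union> {n..<n + m}. ?D a) = (\<Prod>a\<in>{n..<n + m}. ip (n + m) (g (a - n)) (g (a - n)))"
    by (subst prod.union_disjoint) auto
  also have "\<dots> = (\<Prod>j<m. ip (n + m) (g j) (g j))"
    by (rule prod.reindex_bij_witness[of _ "\<lambda>l. n + l" "\<lambda>a. a - n"]) auto
  finally show ?thesis .
qed

lemma ip_pos: "j < m \<Longrightarrow> ip (n + m) (g j) (g j) > 0"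
proof -
  assume j: "j < m"
  have "(\<Prod>j<m. ip (n + m) (g j) (g j)) \<noteq> 0"
    using det_nonzero unfolding det_squared[symmetric] by simp
  then have "ip (n + m) (g j) (g j) \<noteq> 0" using j by auto
  moreover have "ip (n + m) (g j) (g j) \<ge> 0" by (simp add: ip_def sum_nonneg)
  ultimately show ?thesis by linarith
qed

text \<open>
  The Gram matrix \<open>F\<^sup>T F\<close> is the diagonal matrix \<open>D\<close>, so that \<open>D\<^sup>-\<^sup>1 F\<^sup>T\<close> is a left inverse of
  \<open>F\<close>, hence also a right inverse.
\<close>

lemma parseval:
  "(\<Sum>j<m. ip (n + m) x (g j) * ip (n + m) y (g j) / ip (n + m) (g j) (g j)) =
    ip (n + m) x y - (\<Sum>i<n. ip (n + m) x (e i) * ip (n + m) (e i) y)"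
proof -
  let ?N = "n + m" and ?F = "frame_mat n m e g"
  define f where "f a = (if a < n then e a else g (a - n))" for a
  define d where "d a = (if a < n then 1 else ip (n + m) (g (a - n)) (g (a - n)))" for a
  let ?I = "Matrix.mat ?N ?N (\<lambda>(a, c). if a = c then 1 / d a else 0)"
  have Ff: "?F = Matrix.mat ?N ?N (\<lambda>(k, a). f a k)"
    by (rule eq_matI) (simp_all add: frame_mat_def f_def)
  have d0: "d a \<noteq> 0" if "a < ?N" for a
  proof (cases "a < n")
    case False
    then have "a - n < m" using that by linarith
    from ip_pos[OF this] show ?thesis using False by (simp add: d_def)
  qed (simp add: d_def)
  have gd: "transpose_mat ?F * ?F = Matrix.mat ?N ?N (\<lambda>(a, c). if a = c then d a else 0)"
    unfolding gram_diagonal by (rule eq_matI) (simp_all add: d_def)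
  have F: "?F \<in> carrier_mat ?N ?N" by (simp add: frame_mat_def)
  have "?I * (transpose_mat ?F * ?F) = 1\<^sub>m ?N"
  proof (rule eq_matI)
    fix a c assume "a < dim_row (1\<^sub>m ?N :: real mat)" "c < dim_col (1\<^sub>m ?N :: real mat)"
    then have ac: "a < ?N" "c < ?N" by auto
    have "(?I * (transpose_mat ?F * ?F)) $$ (a, c) =
        (\<Sum>b<?N. (if a = b then 1 / d a else 0) * (if b = c then d b else 0))"
      using ac unfolding gd by (simp add: scalar_prod_def lessThan_atLeast0)
    also have "\<dots> = (\<Sum>b<?N. if b = a then (if a = c then d a / d a else 0) else 0)"
      by (intro sum.cong) auto
    also have "\<dots> = (if a = c then 1 else 0)"
      using ac d0[of a] by auto
    finally show "(?I * (transpose_mat ?F * ?F)) $$ (a, c) = 1\<^sub>m ?N $$ (a, c)" using ac by simp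
  qed (simp_all add: frame_mat_def)
  moreover have "?I * (transpose_mat ?F * ?F) = (?I * transpose_mat ?F) * ?F"
    using F by (intro assoc_mult_mat[symmetric, of _ ?N ?N _ ?N _ ?N]) auto
  ultimately have "?F * (?I * transpose_mat ?F) = 1\<^sub>m ?N"
    using F by (intro mat_mult_left_right_inverse[of "?I * transpose_mat ?F" ?N ?F]) auto
  note inverse = this
  have entry: "(?F * (?I * transpose_mat ?F)) $$ (k, l) = (\<Sum>a<?N. f a k * f a l / d a)"
    if "k < ?N" "l < ?N" for k l
  proof -
    have "(?I * transpose_mat ?F) $$ (a, l) = f a l / d a" if a: "a < ?N" for a
    proof -
      have "(?I * transpose_mat ?F) $$ (a, l) = (\<Sum>b<?N. (if a = b then 1 / d a else 0) * f b l)"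
        using a \<open>l < ?N\<close> by (simp add: Ff scalar_prod_def lessThan_atLeast0)
      also have "\<dots> = (\<Sum>b<?N. if b = a then f a l / d a else 0)"
        by (intro sum.cong) auto
      finally show ?thesis using a by simp
    qed
    then show ?thesis
      using that by (simp add: Ff scalar_prod_def lessThan_atLeast0)
  qed
  have *: "(\<Sum>a<?N. f a k * f a l / d a) = (if k = l then 1 else 0)"
    if "k < ?N" "l < ?N" for k l
    using entry[OF that] that unfolding inverse by simp
  have s1: "ip ?N x y = (\<Sum>k<?N. \<Sum>l<?N. x k * y l * (if k = l then 1 else 0))"
    by (simp add: ip_def if_distrib cong: if_cong)
  have s2: "(\<Sum>k<?N. \<Sum>l<?N. x k * y l * (if k = l then 1 else 0)) = (\<Sum>k<?N. \<Sum>l<?N. x k * y l * (\<Sum>a<?N. f a k * f a l / d a))"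
    by (intro sum.cong refl) (simp add: *)
  have s3: "(\<Sum>k<?N. \<Sum>l<?N. x k * y l * (\<Sum>a<?N. f a k * f a l / d a)) = (\<Sum>a<?N. ip ?N x (f a) * ip ?N y (f a) / d a)"
  proof -
    have "(\<Sum>k<?N. \<Sum>l<?N. x k * y l * (\<Sum>a<?N. f a k * f a l / d a)) =
        (\<Sum>k<?N. \<Sum>l<?N. \<Sum>a<?N. x k * f a k * (y l * f a l) / d a)"
      by (simp add: sum_distrib_left mult_ac)
    also have "\<dots> = (\<Sum>k<?N. \<Sum>a<?N. \<Sum>l<?N. x k * f a k * (y l * f a l) / d a)"
      by (rule sum.cong[OF refl], rule sum.swap)
    also have "\<dots> = (\<Sum>a<?N. \<Sum>k<?N. \<Sum>l<?N. x k * f a k * (y l * f a l) / d a)"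
      by (rule sum.swap)
    finally show ?thesis by (simp only: ip_def sum_product sum_divide_distrib)
  qed
  have s4: "(\<Sum>a<?N. ip ?N x (f a) * ip ?N y (f a) / d a) = (\<Sum>a\<in>{0..<n} \<union> {n..<n + m}. ip ?N x (f a) * ip ?N y (f a) / d a)"
    by (intro sum.cong) auto
  have s5: "(\<Sum>a\<in>{0..<n} \<union> {n..<n + m}. ip ?N x (f a) * ip ?N y (f a) / d a) = (\<Sum>i<n. ip ?N x (e i) * ip ?N (e i) y) +
      (\<Sum>a\<in>{n..<n + m}. ip ?N x (g (a - n)) * ip ?N y (g (a - n)) / ip ?N (g (a - n)) (g (a - n)))"
  proof -
    have 1: "(\<Sum>a\<in>{0..<n}. ip ?N x (f a) * ip ?N y (f a) / d a) = (\<Sum>i<n. ip ?N x (e i) * ip ?N (e i) y)"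
      unfolding lessThan_atLeast0 by (intro sum.cong refl) (simp add: f_def d_def ip_commute[of _ y])
    have 2: "(\<Sum>a\<in>{n..<n + m}. ip ?N x (f a) * ip ?N y (f a) / d a) =
        (\<Sum>a\<in>{n..<n + m}. ip ?N x (g (a - n)) * ip ?N y (g (a - n)) / ip ?N (g (a - n)) (g (a - n)))"
      by (intro sum.cong refl) (simp add: f_def d_def)
    have 3: "(\<Sum>a\<in>{0..<n} \<union> {n..<n + m}. ip ?N x (f a) * ip ?N y (f a) / d a) =
        (\<Sum>a\<in>{0..<n}. ip ?N x (f a) * ip ?N y (f a) / d a) +
        (\<Sum>a\<in>{n..<n + m}. ip ?N x (f a) * ip ?N y (f a) / d a)"
      by (rule sum.union_disjoint) auto
    show ?thesis unfolding 3 1 2 ..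
  qed
  have "ip ?N x y = (\<Sum>i<n. ip ?N x (e i) * ip ?N (e i) y) +
      (\<Sum>a\<in>{n..<n + m}. ip ?N x (g (a - n)) * ip ?N y (g (a - n)) / ip ?N (g (a - n)) (g (a - n)))"
    by (rule trans[OF s1 trans[OF s2 trans[OF s3 trans[OF s4 s5]]]])
  moreover have "(\<Sum>a\<in>{n..<n + m}. ip ?N x (g (a - n)) * ip ?N y (g (a - n)) / ip ?N (g (a - n)) (g (a - n))) =
      (\<Sum>j<m. ip ?N x (g j) * ip ?N y (g j) / ip ?N (g j) (g j))"
    by (rule sum.reindex_bij_witness[of _ "\<lambda>l. n + l" "\<lambda>a. a - n"]) auto
  ultimately show ?thesis by linarith
qed

end

text \<open>The weight \<open>e\<close> to the power \<open>- r x\<^sup>2\<close> has variance \<open>1 / (2 r)\<close>.\<close>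

lemma normal_density_exp:
  assumes "r > 0"
  shows "exp (- (r * x\<^sup>2)) = sqrt (pi / r) * normal_density 0 (1 / sqrt (2 * r)) x"
proof -
  have "(1 / sqrt (2 * r))\<^sup>2 = 1 / (2 * r)" using assms by (simp add: power_divide)
  moreover have "sqrt (pi / r) * (1 / sqrt (pi / r)) = 1" using assms by simp
  ultimately show ?thesis
    using assms by (simp add: normal_density_def field_simps)
qed

text \<open>
  After orthogonalization the Gaussian density is a product, and Wick's formula applies. The
  covariance of two linear functionals \<open>ip x\<close> and \<open>ip y\<close> is half the inner product of the
  projections of \<open>x\<close> and \<open>y\<close> to the span of \<open>g\<close>.
\<close>

lemma (in split_frame) gaussian_frame_integral:
  "\<bar>Determinant.det (frame_mat n m e g)\<bar> *
    (LINT w | (\<Pi>\<^sub>M j\<in>{q..<q+m}. lborel). exp (- (\<Sum>k<n + m. (\<Sum>j<m. w (q + j) * g j k)\<^sup>2)) *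
      alternate n (\<lambda>us. \<Prod>i<n. a i (us ! i) + ip (n + m) (c i (us ! i)) (\<lambda>k. \<Sum>j<m. w (q + j) * g j k)) vs) =
    pi powr (real m / 2) * alternate n (\<lambda>us. \<Sum>I\<in>Pow {..<n}. (\<Prod>i\<in>I. a i (us ! i)) *
      pairing_sum (\<lambda>i j. (ip (n + m) (c i (us ! i)) (c j (us ! j)) -
        (\<Sum>l<n. ip (n + m) (c i (us ! i)) (e l) * ip (n + m) (e l) (c j (us ! j)))) / 2)
      ({..<n} - I)) vs"
proof -
  let ?M = "\<Pi>\<^sub>M j\<in>{q..<q+m}. lborel :: real measure" and ?J = "{q..<q+m}" and ?N = "n + m"
  obtain b S where S: "S \<in> ?M \<rightarrow>\<^sub>M ?M" "distr ?M ?M S = ?M"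
    and wb: "\<And>w k. (\<Sum>j<m. w (q + j) * g j k) = (\<Sum>j<m. S w (q + j) * b j k)"
    and orth: "\<And>i j. i < j \<Longrightarrow> j < m \<Longrightarrow> ip ?N (b i) (b j) = 0"
    and perp: "\<And>x j. (\<And>j. j < m \<Longrightarrow> ip ?N x (g j) = 0) \<Longrightarrow> j < m \<Longrightarrow> ip ?N x (b j) = 0"
    and dt: "Determinant.det (frame_mat n m e b) = Determinant.det (frame_mat n m e g)"
    by (rule orthogonalization[of q m g ?N n e]) blast
  interpret B: orthogonal_split_frame n m e b
  proof
    show "Determinant.det (frame_mat n m e b) \<noteq> 0" using dt det_nonzero by simp
    show "ip ?N (b i) (b j) = 0" if "i < m" "j < m" "i \<noteq> j" for i j
      using orth[of i j] orth[of j i] that by (cases "i < j") (auto simp: ip_commute)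
  qed (use e_orthonormal e_perp_g perp in auto)
  define r where "r j = ip ?N (b j) (b j)" for j
  have r: "r j > 0" if "j < m" for j using B.ip_pos[OF that] by (simp add: r_def)
  define \<sigma> where "\<sigma> j = 1 / sqrt (2 * r (j - q))" for j
  interpret gaussian ?J \<sigma>
  proof
    fix j assume "j \<in> ?J"
    then have "j - q < m" by auto
    then show "\<sigma> j > 0" using r by (simp add: \<sigma>_def)
  qed simp
  let ?y = "\<lambda>h w k. \<Sum>j<m. w (q + j) * h j k"
  let ?A = "\<lambda>h w. alternate n (\<lambda>us. \<Prod>i<n. a i (us ! i) + ip ?N (c i (us ! i)) (?y h w)) vs"
  let ?F = "\<lambda>h w. exp (- (\<Sum>k<?N. (?y h w k)\<^sup>2)) * ?A h w"
  have [measurable]: "(\<lambda>w. w (q + j)) \<in> borel_measurable ?M" if "j < m" for j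
    using measurable_component_singleton[of "q + j" ?J "\<lambda>_. lborel"] that by (simp add: measurable_lborel2)
  have meas: "?F b \<in> borel_measurable ?M"
    unfolding alternate_def ip_def by measurable
  have "integral\<^sup>L ?M (?F g) = (LINT w|?M. ?F b (S w))"
    using wb by simp
  also have "\<dots> = integral\<^sup>L (distr ?M ?M S) (?F b)"
    by (rule integral_distr[OF S(1) meas, symmetric])
  finally have gb: "integral\<^sup>L ?M (?F g) = integral\<^sup>L ?M (?F b)" using S(2) by simp
  have exp_eq: "exp (- (\<Sum>k<?N. (?y b w k)\<^sup>2)) =
      (\<Prod>j<m. sqrt (pi / r j)) * (\<Prod>j\<in>?J. normal_density 0 (\<sigma> j) (w j))" for w
  proof -
    have "(\<Sum>k<?N. (?y b w k)\<^sup>2) = ip ?N (?y b w) (?y b w)"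
      by (simp add: ip_def power2_eq_square)
    also have "\<dots> = (\<Sum>i<m. w (q + i) * (\<Sum>j<m. w (q + j) * ip ?N (b i) (b j)))"
      by (simp only: ip_sum_left ip_sum_right)
    also have "\<dots> = (\<Sum>i<m. r i * (w (q + i))\<^sup>2)"
    proof (intro sum.cong refl)
      fix i assume i: "i \<in> {..<m}"
      have "(\<Sum>j<m. w (q + j) * ip ?N (b i) (b j)) = (\<Sum>j<m. if j = i then w (q + i) * r i else 0)"
        using i B.g_orthogonal by (intro sum.cong refl) (auto simp: r_def)
      then show "w (q + i) * (\<Sum>j<m. w (q + j) * ip ?N (b i) (b j)) = r i * (w (q + i))\<^sup>2"
        using i by (simp add: power2_eq_square)
    qed
    finally have "exp (- (\<Sum>k<?N. (?y b w k)\<^sup>2)) = (\<Prod>j<m. exp (- (r j * (w (q + j))\<^sup>2)))"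
      by (simp add: exp_sum sum_negf[symmetric])
    also have "\<dots> = (\<Prod>j<m. sqrt (pi / r j) * normal_density 0 (\<sigma> (q + j)) (w (q + j)))"
      by (intro prod.cong refl) (simp add: normal_density_exp r \<sigma>_def)
    also have "\<dots> = (\<Prod>j<m. sqrt (pi / r j)) * (\<Prod>j<m. normal_density 0 (\<sigma> (q + j)) (w (q + j)))"
      by (rule prod.distrib)
    also have "(\<Prod>j<m. normal_density 0 (\<sigma> (q + j)) (w (q + j))) = (\<Prod>j\<in>?J. normal_density 0 (\<sigma> j) (w j))"
      by (rule prod.reindex_bij_witness[of _ "\<lambda>j. j - q" "\<lambda>j. q + j"]) auto
    finally show ?thesis .
  qed
  let ?x = "\<lambda>i v j. ip ?N (c i v) (b (j - q))"
  have lin_eq: "ip ?N x (?y b w) = lin (\<lambda>j. ip ?N x (b (j - q))) w" for x w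
  proof -
    have "ip ?N x (?y b w) = (\<Sum>j<m. ip ?N x (b j) * w (q + j))"
      by (simp add: ip_sum_right mult.commute[of "ip _ _ _"])
    also have "\<dots> = lin (\<lambda>j. ip ?N x (b (j - q))) w"
      unfolding lin_def by (rule sum.reindex_bij_witness[of _ "\<lambda>j. j - q" "\<lambda>j. q + j"]) auto
    finally show ?thesis .
  qed
  have cov_eq: "cov (\<lambda>j. ip ?N x (b (j - q))) (\<lambda>j. ip ?N y (b (j - q))) =
      (ip ?N x y - (\<Sum>l<n. ip ?N x (e l) * ip ?N (e l) y)) / 2" for x y
  proof -
    have "cov (\<lambda>j. ip ?N x (b (j - q))) (\<lambda>j. ip ?N y (b (j - q))) =
        (\<Sum>j<m. ip ?N x (b j) * ip ?N y (b j) * (\<sigma> (q + j))\<^sup>2)"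
      unfolding cov_def by (rule sum.reindex_bij_witness[of _ "\<lambda>j. q + j" "\<lambda>j. j - q"]) auto
    also have "\<dots> = (\<Sum>j<m. ip ?N x (b j) * ip ?N y (b j) / ip ?N (b j) (b j) / 2)"
    proof (intro sum.cong refl)
      fix j assume "j \<in> {..<m}"
      then have "(\<sigma> (q + j))\<^sup>2 = 1 / (2 * r j)" using r[of j] by (simp add: \<sigma>_def power_divide)
      then show "ip ?N x (b j) * ip ?N y (b j) * (\<sigma> (q + j))\<^sup>2 =
          ip ?N x (b j) * ip ?N y (b j) / ip ?N (b j) (b j) / 2"
        by (simp add: r_def)
    qed
    also have "\<dots> = (\<Sum>j<m. ip ?N x (b j) * ip ?N y (b j) / ip ?N (b j) (b j)) / 2"
      by (rule sum_divide_distrib[symmetric])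
    finally show ?thesis by (simp only: B.parseval)
  qed
  have sqrt_prod: "sqrt (\<Prod>j<k. f j) = (\<Prod>j<k. sqrt (f j))" for k :: nat and f
    by (induction k) (simp_all add: real_sqrt_mult)
  have "\<bar>Determinant.det (frame_mat n m e b)\<bar> = sqrt ((Determinant.det (frame_mat n m e b))\<^sup>2)"
    by simp
  also have "\<dots> = (\<Prod>j<m. sqrt (r j))"
    unfolding B.det_squared r_def
    using sqrt_prod .
  finally have "\<bar>Determinant.det (frame_mat n m e b)\<bar> * (\<Prod>j<m. sqrt (pi / r j)) =
      (\<Prod>j<m. sqrt (r j) * sqrt (pi / r j))" by (simp add: prod.distrib)
  also have "\<dots> = (\<Prod>j<m. sqrt pi)"
    using r by (intro prod.cong refl) (simp add: real_sqrt_mult[symmetric] less_imp_neq[THEN not_sym])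
  also have "\<dots> = pi powr (real m / 2)"
    by (simp add: powr_half_sqrt[symmetric] powr_power)
  finally have const: "\<bar>Determinant.det (frame_mat n m e b)\<bar> * (\<Prod>j<m. sqrt (pi / r j)) = pi powr (real m / 2)" .
  have "integral\<^sup>L ?M (?F b) = (\<Prod>j<m. sqrt (pi / r j)) * gauss_expect ?J \<sigma> (?A b)"
    unfolding exp_eq gauss_expect_def by (simp add: mult.assoc)
  also have "gauss_expect ?J \<sigma> (?A b) = alternate n (\<lambda>us. \<Sum>I\<in>Pow {..<n}. (\<Prod>i\<in>I. a i (us ! i)) *
      pairing_sum (\<lambda>i j. cov (?x i (us ! i)) (?x j (us ! j))) ({..<n} - I)) vs"
    unfolding lin_eq by (rule expect_alternate)
  finally show ?thesis
    using gb dt const unfolding cov_eq by (simp flip: mult.assoc)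
qed

section \<open>Directional derivatives\<close>

definition dirD :: "nat \<Rightarrow> (rvec \<Rightarrow> real) \<Rightarrow> rvec \<Rightarrow> rvec \<Rightarrow> real"
  where "dirD d f z v = (\<Sum>i<d. v i * partial i f z)"

text \<open>
  Existence of the partial derivatives at one point, which is what the rules below preserve: they
  differentiate along coordinate lines.
\<close>

definition diffable :: "nat \<Rightarrow> (rvec \<Rightarrow> real) \<Rightarrow> rvec \<Rightarrow> bool"
  where "diffable d f z \<longleftrightarrow> (\<forall>i<d. has_partial i f z (partial i f z))"

lemma diffable_intro:
  assumes "\<And>i. i < d \<Longrightarrow> has_partial i f z (F i)"
  shows "diffable d f z" "dirD d f z v = (\<Sum>i<d. v i * F i)"
proof -
  have "partial i f z = F i" if "i < d" for i using assms[OF that] by (rule has_partial_partial)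
  then show "diffable d f z" "dirD d f z v = (\<Sum>i<d. v i * F i)"
    using assms by (auto simp: diffable_def dirD_def)
qed

lemma smooth_on_diffable: "smooth_on d S f \<Longrightarrow> z \<in> S \<Longrightarrow> diffable d f z"
  unfolding diffable_def by (blast intro: smooth_on_has_partial)

lemma diffable_const: "diffable d (\<lambda>_. c) z" "dirD d (\<lambda>_. c) z v = 0"
  using diffable_intro[OF has_partial_const] by simp_all

lemma diffable_mult:
  assumes "diffable d f z" "diffable d g z"
  shows "diffable d (\<lambda>z. f z * g z) z"
    and "dirD d (\<lambda>z. f z * g z) z v = dirD d f z v * g z + f z * dirD d g z v"
proof -
  have p: "has_partial i (\<lambda>z. f z * g z) z (partial i f z * g z + f z * partial i g z)" if "i < d" for i
    using assms that unfolding diffable_def by (blast intro: has_partial_mult)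
  show "diffable d (\<lambda>z. f z * g z) z" by (rule diffable_intro[OF p])
  show "dirD d (\<lambda>z. f z * g z) z v = dirD d f z v * g z + f z * dirD d g z v"
    by (subst diffable_intro(2)[of d "\<lambda>z. f z * g z" z "\<lambda>i. partial i f z * g z + f z * partial i g z", OF p])
      (simp_all add: dirD_def algebra_simps sum.distrib sum_distrib_left)
qed

lemma diffable_sum:
  assumes "\<And>k. k \<in> K \<Longrightarrow> diffable d (f k) z"
  shows "diffable d (\<lambda>z. \<Sum>k\<in>K. f k z) z"
    and "dirD d (\<lambda>z. \<Sum>k\<in>K. f k z) z v = (\<Sum>k\<in>K. dirD d (f k) z v)"
proof -
  have p: "has_partial i (\<lambda>z. \<Sum>k\<in>K. f k z) z (\<Sum>k\<in>K. partial i (f k) z)" if "i < d" for i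
    using assms that unfolding diffable_def by (blast intro: has_partial_sum)
  show "diffable d (\<lambda>z. \<Sum>k\<in>K. f k z) z" by (rule diffable_intro[OF p])
  show "dirD d (\<lambda>z. \<Sum>k\<in>K. f k z) z v = (\<Sum>k\<in>K. dirD d (f k) z v)"
    by (subst diffable_intro(2)[of d "\<lambda>z. \<Sum>k\<in>K. f k z" z "\<lambda>i. \<Sum>k\<in>K. partial i (f k) z", OF p], assumption)
      (simp add: dirD_def sum_distrib_left, rule sum.swap)
qed

lemma diffable_cmult:
  assumes "diffable d f z"
  shows "diffable d (\<lambda>z. c * f z) z" "dirD d (\<lambda>z. c * f z) z v = c * dirD d f z v"
  using diffable_mult[OF diffable_const(1) assms] by (simp_all add: diffable_const)

lemma diffable_sum_prod:
  assumes "\<And>k. k \<in> K \<Longrightarrow> diffable d (f k) z" "\<And>k. k \<in> K \<Longrightarrow> diffable d (g k) z"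
  shows "dirD d (\<lambda>z. \<Sum>k\<in>K. f k z * g k z) z v =
    (\<Sum>k\<in>K. dirD d (f k) z v * g k z) + (\<Sum>k\<in>K. f k z * dirD d (g k) z v)"
  using assms by (simp add: diffable_sum(2) diffable_mult sum.distrib)

lemma dirD_cong_open:
  assumes "openin (Euclidean_space d) S" "z \<in> S" "\<And>z. z \<in> S \<Longrightarrow> f z = g z"
  shows "dirD d f z v = dirD d g z v"
  unfolding dirD_def using partial_cong_open[OF assms(1,2) _ assms(3)] by (intro sum.cong) auto

lemma dirD_zero_vec: "(\<And>i. i < d \<Longrightarrow> v i = 0) \<Longrightarrow> dirD d f z v = 0"
  by (simp add: dirD_def)

lemma dirD_proj: "dirD d f z (proj d v) = dirD d f z v"
  by (simp add: dirD_def proj_def)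

lemma diffable_dirD:
  assumes "smooth_on d S f" "z \<in> S"
  shows "diffable d (\<lambda>z. dirD d f z v) z"
  unfolding dirD_def
  using assms by (intro diffable_sum(1) diffable_cmult(1)) (auto intro: smooth_on_diffable smooth_on_partial)

lemma dirD_commute:
  assumes S: "openin (Euclidean_space d) S" and f: "smooth_on d S f" and z: "z \<in> S"
  shows "dirD d (\<lambda>z. dirD d f z v) z w = dirD d (\<lambda>z. dirD d f z w) z v"
proof -
  have p: "diffable d (partial i f) z" if "i < d" for i
    using smooth_on_diffable[OF smooth_on_partial[OF f that] z] .
  have e: "dirD d (\<lambda>z. dirD d f z v) z w = (\<Sum>i<d. \<Sum>j<d. v i * w j * partial j (partial i f) z)" for v w
  proof -
    have "dirD d (\<lambda>z. dirD d f z v) z w = (\<Sum>i<d. v i * dirD d (partial i f) z w)"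
      unfolding dirD_def[of d f]
      by (subst diffable_sum(2)) (auto simp: diffable_cmult p)
    then show ?thesis by (simp add: dirD_def sum_distrib_left mult.assoc)
  qed
  have "dirD d (\<lambda>z. dirD d f z v) z w = (\<Sum>j<d. \<Sum>i<d. v i * w j * partial j (partial i f) z)"
    unfolding e by (rule sum.swap)
  also have "\<dots> = dirD d (\<lambda>z. dirD d f z w) z v"
    unfolding e using partial_commute[OF S f z] by (intro sum.cong refl) (simp add: mult.commute[of "v _"])
  finally show ?thesis .
qed

text \<open>
  The exterior derivatives of forms of degree 0 and 1 on constant vector fields, including the
  value 0 on lists of a wrong length.
\<close>

lemma ext_d_fun_form: "ext_d d (fun_form f) z vs = (case vs of [v] \<Rightarrow> dirD d f z v | _ \<Rightarrow> 0)"
proof (cases "\<exists>v. vs = [v]")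
  case True
  then show ?thesis by (auto simp: ext_d_def fun_form_def dirD_def)
next
  case False
  have p0: "partial i (\<lambda>z. 0) z = 0" for i by (rule has_partial_partial[OF has_partial_const])
  have "take j vs @ drop (Suc j) vs \<noteq> []" if "j < length vs" for j
  proof
    assume "take j vs @ drop (Suc j) vs = []"
    then have "j = 0" "length vs \<le> 1" using that by auto
    then have "length vs = 1" using that by simp
    then show False using False by (auto simp: length_Suc_conv)
  qed
  then have "(\<lambda>z. fun_form f z (take j vs @ drop (Suc j) vs)) = (\<lambda>_. 0)" if "j < length vs" for j
    unfolding fun_form_def using that by meson
  then have "ext_d d (fun_form f) z vs = 0"
    unfolding ext_d_def by (intro sum.neutral ballI) (simp add: p0)
  then show ?thesis using False by (auto split: list.split)
qed

lemma ext_d_1_form: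
  assumes S: "openin (Euclidean_space d) S" and z: "z \<in> S"
    and \<theta>: "\<And>z us. z \<in> S \<Longrightarrow> \<theta> z us = (case us of [v] \<Rightarrow> t z v | _ \<Rightarrow> 0)"
  shows "ext_d d \<theta> z vs =
    (case vs of [v, w] \<Rightarrow> dirD d (\<lambda>z. t z w) z v - dirD d (\<lambda>z. t z v) z w | _ \<Rightarrow> 0)"
proof -
  have ext: "ext_d d \<theta> z vs = (\<Sum>j<length vs. (-1) ^ j *
      dirD d (\<lambda>z. case take j vs @ drop (Suc j) vs of [v] \<Rightarrow> t z v | _ \<Rightarrow> 0) z (vs ! j))"
    unfolding ext_d_def
  proof (intro sum.cong refl arg_cong2[where f="(*)"])
    fix j
    have "dirD d (\<lambda>z. \<theta> z (take j vs @ drop (Suc j) vs)) z (vs ! j) =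
        dirD d (\<lambda>z. case take j vs @ drop (Suc j) vs of [v] \<Rightarrow> t z v | _ \<Rightarrow> 0) z (vs ! j)"
      by (rule dirD_cong_open[OF S z]) (rule \<theta>)
    then show "(\<Sum>i<d. (vs ! j) i * partial i (\<lambda>z. \<theta> z (take j vs @ drop (Suc j) vs)) z) =
        dirD d (\<lambda>z. case take j vs @ drop (Suc j) vs of [v] \<Rightarrow> t z v | _ \<Rightarrow> 0) z (vs ! j)"
      by (simp add: dirD_def)
  qed
  show ?thesis
  proof (cases "length vs = 2")
    case True
    then obtain v w where vs: "vs = [v, w]"
      by (metis (no_types, opaque_lifting) One_nat_def Suc_1 length_0_conv length_Suc_conv)
    show ?thesis using ext unfolding vs by simp
  next
    case False
    have "(\<lambda>z. case take j vs @ drop (Suc j) vs of [v] \<Rightarrow> t z v | _ \<Rightarrow> 0) = (\<lambda>_. 0)"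
      if j: "j < length vs" for j
    proof -
      have "(case ws of [v] \<Rightarrow> t z v | _ \<Rightarrow> 0) = 0" if "length ws \<noteq> 1" for ws z
        using that by (auto split: list.split)
      moreover have "length (take j vs @ drop (Suc j) vs) \<noteq> 1" using j False by simp
      ultimately show ?thesis by simp
    qed
    then have "ext_d d \<theta> z vs = 0"
      unfolding ext by (intro sum.neutral ballI) (simp add: diffable_const)
    then show ?thesis using False by (auto split: list.split)
  qed
qed

section \<open>The connection of an involution\<close>

text \<open>
  The local expression of \<open>Q\<close> in a chart: a field of orthogonal involutions of R^N over an open
  subset of R^d.
\<close>

locale local_involution =
  fixes d N :: nat and S :: "rvec set" and q :: "nat \<Rightarrow> nat \<Rightarrow> rvec \<Rightarrow> real"
  assumes S_open: "openin (Euclidean_space d) S"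
    and q_smooth: "\<And>k l. k < N \<Longrightarrow> l < N \<Longrightarrow> smooth_on d S (q k l)"
    and q_square: "\<And>z k l. z \<in> S \<Longrightarrow> k < N \<Longrightarrow> l < N \<Longrightarrow>
      (\<Sum>r<N. q k r z * q r l z) = (if k = l then 1 else 0)"
    and q_sym: "\<And>z k l. z \<in> S \<Longrightarrow> k < N \<Longrightarrow> l < N \<Longrightarrow> q k l z = q l k z"
begin

definition cov_deriv :: "(nat \<Rightarrow> rvec \<Rightarrow> real) \<Rightarrow> rvec \<Rightarrow> rvec \<Rightarrow> nat \<Rightarrow> real"
  where "cov_deriv s z v k =
    dirD d (s k) z v + 1/2 * (\<Sum>l<N. \<Sum>r<N. q k l z * dirD d (q l r) z v * s r z)"

text \<open>Differentiating \<open>q\<^sup>2 = 1\<close> gives \<open>q dq = - dq q\<close>, and \<open>q\<close> and \<open>dq\<close> are symmetric.\<close>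

lemma q_dq_antisym:
  assumes z: "z \<in> S" and kr: "k < N" "r < N"
  shows "(\<Sum>l<N. q k l z * dirD d (q l r) z v) = - (\<Sum>l<N. q r l z * dirD d (q l k) z v)"
proof -
  have diff: "diffable d (q k l) z" if "k < N" "l < N" for k l
    using smooth_on_diffable[OF q_smooth[OF that] z] .
  have "dirD d (\<lambda>z. \<Sum>l<N. q k l z * q l r z) z v = dirD d (\<lambda>_. if k = r then 1 else 0) z v"
    by (rule dirD_cong_open[OF S_open z]) (use q_square kr in auto)
  moreover have "dirD d (\<lambda>z. \<Sum>l<N. q k l z * q l r z) z v =
      (\<Sum>l<N. dirD d (q k l) z v * q l r z) + (\<Sum>l<N. q k l z * dirD d (q l r) z v)"
    by (rule diffable_sum_prod) (use diff kr in auto)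
  ultimately have "(\<Sum>l<N. dirD d (q k l) z v * q l r z) + (\<Sum>l<N. q k l z * dirD d (q l r) z v) = 0"
    by (simp add: diffable_const)
  moreover have "(\<Sum>l<N. dirD d (q k l) z v * q l r z) = (\<Sum>l<N. q r l z * dirD d (q l k) z v)"
  proof (intro sum.cong refl)
    fix l assume l: "l \<in> {..<N}"
    have "dirD d (q k l) z v = dirD d (q l k) z v"
      by (rule dirD_cong_open[OF S_open z]) (use q_sym kr l in auto)
    then show "dirD d (q k l) z v * q l r z = q r l z * dirD d (q l k) z v"
      using q_sym[OF z, of l r] kr l by simp
  qed
  ultimately show ?thesis by linarith
qed

text \<open>The terms with \<open>q dq\<close> cancel by antisymmetry, which leaves the product rule.\<close>

lemma cov_deriv_metric:
  assumes z: "z \<in> S" and s: "\<And>k. k < N \<Longrightarrow> smooth_on d S (s k)" and t: "\<And>k. k < N \<Longrightarrow> smooth_on d S (t k)"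
  shows "dirD d (\<lambda>z. \<Sum>k<N. s k z * t k z) z v =
    (\<Sum>k<N. cov_deriv s z v k * t k z) + (\<Sum>k<N. s k z * cov_deriv t z v k)"
proof -
  define A where "A k r = (\<Sum>l<N. q k l z * dirD d (q l r) z v)" for k r
  have c: "cov_deriv u z v k = dirD d (u k) z v + 1/2 * (\<Sum>r<N. A k r * u r z)" for u k
    unfolding cov_deriv_def A_def by (subst sum.swap) (simp add: sum_distrib_right)
  have anti: "A k r = - A r k" if "k < N" "r < N" for k r
    unfolding A_def by (rule q_dq_antisym[OF z that])
  have "(\<Sum>k<N. (\<Sum>r<N. A k r * s r z) * t k z) = (\<Sum>k<N. \<Sum>r<N. s r z * A k r * t k z)"
    unfolding sum_distrib_right by (simp add: mult_ac)
  also have "\<dots> = (\<Sum>r<N. \<Sum>k<N. s r z * A k r * t k z)" by (rule sum.swap)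
  also have "\<dots> = (\<Sum>r<N. \<Sum>k<N. - (s r z * (A r k * t k z)))"
  proof (rule sum.cong[OF refl], rule sum.cong[OF refl])
    fix r k assume "r \<in> {..<N}" "k \<in> {..<N}"
    then have "A k r = - A r k" by (intro anti) auto
    then show "s r z * A k r * t k z = - (s r z * (A r k * t k z))" by simp
  qed
  also have "\<dots> = - (\<Sum>k<N. s k z * (\<Sum>r<N. A k r * t r z))"
    by (simp add: sum_negf sum_distrib_left)
  finally have "(\<Sum>k<N. (\<Sum>r<N. A k r * s r z) * t k z) + (\<Sum>k<N. s k z * (\<Sum>r<N. A k r * t r z)) = 0"
    by simp
  moreover have "dirD d (\<lambda>z. \<Sum>k<N. s k z * t k z) z v =
      (\<Sum>k<N. dirD d (s k) z v * t k z) + (\<Sum>k<N. s k z * dirD d (t k) z v)"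
    by (rule diffable_sum_prod) (use s t z in \<open>auto intro: smooth_on_diffable\<close>)
  ultimately show ?thesis
    unfolding c by (simp add: distrib_left distrib_right sum.distrib flip: sum_divide_distrib)
qed

text \<open>
  Differentiating \<open>q s = a s\<close> expresses \<open>dq s\<close> by \<open>ds\<close>. This turns \<open>ds + 1/2 q dq s\<close> into the
  projection \<open>(1 + a q) / 2\<close> to the eigenspace, applied to \<open>ds\<close>.
\<close>

lemma cov_deriv_eigen:
  assumes z: "z \<in> S" and s: "\<And>k. k < N \<Longrightarrow> smooth_on d S (s k)" and a: "a * a = 1"
    and eig: "\<And>z k. z \<in> S \<Longrightarrow> k < N \<Longrightarrow> (\<Sum>l<N. q k l z * s l z) = a * s k z" and k: "k < N"
  shows "cov_deriv s z v k = 1/2 * (dirD d (s k) z v + a * (\<Sum>l<N. q k l z * dirD d (s l) z v))"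
proof -
  have qs: "(\<Sum>r<N. dirD d (q l r) z v * s r z) = a * dirD d (s l) z v - (\<Sum>r<N. q l r z * dirD d (s r) z v)"
    if l: "l < N" for l
  proof -
    have "dirD d (\<lambda>z. \<Sum>r<N. q l r z * s r z) z v = dirD d (\<lambda>z. a * s l z) z v"
      by (rule dirD_cong_open[OF S_open z]) (use eig l in auto)
    moreover have "dirD d (\<lambda>z. \<Sum>r<N. q l r z * s r z) z v =
        (\<Sum>r<N. dirD d (q l r) z v * s r z) + (\<Sum>r<N. q l r z * dirD d (s r) z v)"
      by (rule diffable_sum_prod) (use q_smooth s z l in \<open>auto intro: smooth_on_diffable\<close>)
    moreover have "dirD d (\<lambda>z. a * s l z) z v = a * dirD d (s l) z v"
      by (rule diffable_cmult(2)) (use s z l in \<open>auto intro: smooth_on_diffable\<close>)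
    ultimately show ?thesis by linarith
  qed
  have "(\<Sum>l<N. q k l z * (\<Sum>r<N. q l r z * dirD d (s r) z v)) =
      (\<Sum>r<N. (\<Sum>l<N. q k l z * q l r z) * dirD d (s r) z v)"
    unfolding sum_distrib_left sum_distrib_right by (subst sum.swap) (simp add: mult.assoc)
  also have "\<dots> = (\<Sum>r<N. if r = k then dirD d (s k) z v else 0)"
    using q_square[OF z k] by (intro sum.cong) auto
  finally have qq: "(\<Sum>l<N. q k l z * (\<Sum>r<N. q l r z * dirD d (s r) z v)) = dirD d (s k) z v"
    using k by simp
  have "(\<Sum>l<N. \<Sum>r<N. q k l z * dirD d (q l r) z v * s r z) =
      (\<Sum>l<N. q k l z * (\<Sum>r<N. dirD d (q l r) z v * s r z))"
    by (simp add: sum_distrib_left mult.assoc)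
  also have "\<dots> = (\<Sum>l<N. a * (q k l z * dirD d (s l) z v) - q k l z * (\<Sum>r<N. q l r z * dirD d (s r) z v))"
  proof (intro sum.cong refl)
    fix l assume "l \<in> {..<N}"
    then show "q k l z * (\<Sum>r<N. dirD d (q l r) z v * s r z) =
        a * (q k l z * dirD d (s l) z v) - q k l z * (\<Sum>r<N. q l r z * dirD d (s r) z v)"
      by (simp only: qs lessThan_iff right_diff_distrib mult.left_commute)
  qed
  also have "\<dots> = a * (\<Sum>l<N. q k l z * dirD d (s l) z v) - dirD d (s k) z v"
    by (simp only: sum_subtractf sum_distrib_left[symmetric] qq)
  finally show ?thesis unfolding cov_deriv_def by (simp add: algebra_simps)
qed

lemma cov_deriv_preserves:
  assumes z: "z \<in> S" and s: "\<And>k. k < N \<Longrightarrow> smooth_on d S (s k)" and a: "a * a = 1"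
    and eig: "\<And>z k. z \<in> S \<Longrightarrow> k < N \<Longrightarrow> (\<Sum>l<N. q k l z * s l z) = a * s k z" and j: "j < N"
  shows "(\<Sum>k<N. q j k z * cov_deriv s z v k) = a * cov_deriv s z v j"
proof -
  let ?D = "\<lambda>k. dirD d (s k) z v" and ?QD = "\<lambda>k. \<Sum>l<N. q k l z * dirD d (s l) z v"
  have c: "cov_deriv s z v k = 1/2 * (?D k + a * ?QD k)" if "k < N" for k
    by (rule cov_deriv_eigen[OF z s a eig that])
  have "(\<Sum>k<N. q j k z * ?QD k) = (\<Sum>r<N. (\<Sum>l<N. q j l z * q l r z) * ?D r)"
    unfolding sum_distrib_left sum_distrib_right by (subst sum.swap) (simp add: mult.assoc)
  also have "\<dots> = (\<Sum>r<N. if r = j then ?D j else 0)"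
    using q_square[OF z j] by (intro sum.cong) auto
  finally have qq: "(\<Sum>k<N. q j k z * ?QD k) = ?D j" using j by simp
  have "(\<Sum>k<N. q j k z * cov_deriv s z v k) = (\<Sum>k<N. 1/2 * (q j k z * ?D k) + 1/2 * a * (q j k z * ?QD k))"
    by (intro sum.cong refl) (simp add: c algebra_simps)
  also have "\<dots> = 1/2 * ?QD j + 1/2 * a * ?D j"
    by (simp only: sum.distrib sum_distrib_left[symmetric] qq)
  also have "\<dots> = a * (1/2 * (?D j + a * ?QD j))"
    using a by (simp add: algebra_simps flip: mult.assoc)
  finally show ?thesis by (simp only: c[OF j])
qed

end

section \<open>Charts and frames\<close>

lemma openin_chart_image:
  assumes "smooth_manifold M d A" "c \<in> A" "openin M U" "U \<subseteq> fst c"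
  shows "openin (Euclidean_space d) (snd c ` U)"
proof -
  obtain C \<phi> where c: "c = (C, \<phi>)" by (cases c)
  have C: "openin M C" "openin (Euclidean_space d) (\<phi> ` C)"
    and h: "homeomorphic_map (subtopology M C) (subtopology (Euclidean_space d) (\<phi> ` C)) \<phi>"
    using assms(1,2) unfolding smooth_manifold_def c by auto
  have "openin (subtopology M C) U"
    using assms(3,4) by (auto simp: c openin_subtopology)
  then have "openin (subtopology (Euclidean_space d) (\<phi> ` C)) (\<phi> ` U)"
    using homeomorphic_imp_open_map[OF h] by (auto simp: open_map_def)
  then show ?thesis using C(2) by (simp add: c openin_open_subtopology)
qed

lemma chart_domain:
  assumes "smooth_manifold M d A" "c \<in> A"
  shows "openin M (fst c)" "fst c \<subseteq> topspace M"
proof -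
  show "openin M (fst c)" using assms unfolding smooth_manifold_def by fastforce
  then show "fst c \<subseteq> topspace M" by (rule openin_subset)
qed

lemma chart_inv_left:
  assumes "smooth_manifold M d A" "c \<in> A" "p \<in> fst c"
  shows "chart_inv c (snd c p) = p"
proof -
  obtain C \<phi> where c: "c = (C, \<phi>)" by (cases c)
  have h: "homeomorphic_map (subtopology M C) (subtopology (Euclidean_space d) (\<phi> ` C)) \<phi>"
    using assms(1,2) unfolding smooth_manifold_def c by auto
  have "inj_on \<phi> (topspace M \<inter> C)"
    using homeomorphic_imp_injective_map[OF h] by simp
  moreover have "C \<subseteq> topspace M" using chart_domain(2)[OF assms(1,2)] by (simp add: c)
  ultimately have "inj_on \<phi> C" by (simp add: Int_absorb1)
  then show ?thesis using assms(3) by (simp add: chart_inv_def c inv_into_f_f)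
qed

lemma chart_inv_image:
  assumes "smooth_manifold M d A" "c \<in> A" "U \<subseteq> fst c" "z \<in> snd c ` U"
  shows "chart_inv c z \<in> U" "snd c (chart_inv c z) = z"
proof -
  obtain p where p: "p \<in> U" "z = snd c p" using assms(4) by blast
  then have "chart_inv c z = p" using chart_inv_left[OF assms(1,2)] assms(3) by blast
  then show "chart_inv c z \<in> U" "snd c (chart_inv c z) = z" using p by auto
qed

lemma smooth_fun_local:
  assumes "smooth_fun d A U f" "c \<in> A" "T \<subseteq> U \<inter> fst c"
  shows "smooth_on d (snd c ` T) (\<lambda>z. f (chart_inv c z))"
proof -
  have "smooth_on d (snd c ` (U \<inter> fst c)) (\<lambda>z. f (chart_inv c z))"
    using assms(1,2) unfolding smooth_fun_def by blast
  then show ?thesis by (rule smooth_on_subset) (use assms(3) in blast)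
qed

lemma smooth_fun_subset: "smooth_fun d A U f \<Longrightarrow> T \<subseteq> U \<Longrightarrow> smooth_fun d A T f"
  unfolding smooth_fun_def by (blast intro: smooth_on_subset)

lemma smooth_frame_subset:
  assumes "smooth_frame M d A N n V U e" "openin M T" "T \<subseteq> U"
  shows "smooth_frame M d A N n V T e"
  using assms unfolding smooth_frame_def smooth_section_def by (blast intro: smooth_fun_subset)

lemma eigspace_iff:
  assumes "B \<in> carrier_mat N N"
  shows "y \<in> eigspace N B a \<longleftrightarrow> y \<in> Rn N \<and> (\<forall>k<N. (\<Sum>l<N. B $$ (k, l) * y l) = a * y k)"
proof -
  have "B *\<^sub>v Matrix.vec N y = a \<cdot>\<^sub>v Matrix.vec N y \<longleftrightarrow>
      (\<forall>k<N. (B *\<^sub>v Matrix.vec N y) $ k = (a \<cdot>\<^sub>v Matrix.vec N y) $ k)"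
    using assms by (auto simp: vec_eq_iff)
  also have "\<dots> \<longleftrightarrow> (\<forall>k<N. (\<Sum>l<N. B $$ (k, l) * y l) = a * y k)"
    using assms by (auto simp: scalar_prod_def lessThan_atLeast0)
  finally show ?thesis by (simp add: eigspace_def)
qed



lemma lincomb_std_vec: "i < length b \<Longrightarrow> lincomb b (std_vec i) = b ! i"
  by (simp add: lincomb_def std_vec_def if_distrib if_distribR cong: if_cong)

lemma basis_of_nth:
  assumes b: "basis_of n S b" and i: "i < n"
  shows "b ! i \<in> S"
proof -
  have "std_vec i \<in> Rn n" using i by (auto simp: std_vec_def topspace_Euclidean_space)
  moreover have "lincomb b (std_vec i) = b ! i"
    using b i by (simp add: lincomb_std_vec basis_of_def)
  moreover have "bij_betw (lincomb b) (Rn n) S" using b by (simp add: basis_of_def)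
  ultimately show ?thesis by (metis bij_betwE)
qed

lemma lincomb_coords:
  assumes "basis_of n S b" "y \<in> S"
  shows "coords b y \<in> Rn n" "lincomb b (coords b y) = y"
  using assms unfolding basis_of_def coords_def
  by (auto intro: inv_into_into simp: f_inv_into_f bij_betw_def)

lemma coords_lincomb:
  assumes "basis_of n S b" "x \<in> Rn n"
  shows "coords b (lincomb b x) = x"
  using assms unfolding basis_of_def coords_def by (auto simp: bij_betw_def inv_into_f_f)

text \<open>
  Polarization: the metric condition is tested on the coordinate vectors and on sums of two of
  them.
\<close>

lemma orthonormal_of_metric:
  assumes b: "length b = n"
    and met: "\<And>x. x \<in> Rn n \<Longrightarrow> (\<Sum>k<N. (lincomb b x k)\<^sup>2) = (\<Sum>i<n. (x i)\<^sup>2)"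
    and ij: "i < n" "j < n"
  shows "ip N (b ! i) (b ! j) = (if i = j then 1 else 0)"
proof -
  have one: "ip N (b ! i) (b ! i) = 1" if i: "i < n" for i
  proof -
    have "std_vec i \<in> Rn n" using i by (auto simp: std_vec_def topspace_Euclidean_space)
    from met[OF this] have "(\<Sum>k<N. ((b ! i) k)\<^sup>2) = (\<Sum>k<n. (std_vec i k)\<^sup>2)"
      using i b by (simp add: lincomb_std_vec)
    also have "\<dots> = (\<Sum>k<n. if k = i then 1 else 0)"
      by (intro sum.cong) (auto simp: std_vec_def)
    finally show ?thesis using i by (simp add: ip_def power2_eq_square)
  qed
  show ?thesis
  proof (cases "i = j")
    case False
    let ?x = "\<lambda>k. std_vec i k + std_vec j k"
    have "?x \<in> Rn n" using ij by (auto simp: std_vec_def topspace_Euclidean_space)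
    moreover have "lincomb b ?x = (\<lambda>k. (b ! i) k + (b ! j) k)"
    proof -
      have "lincomb b ?x = (\<lambda>k. lincomb b (std_vec i) k + lincomb b (std_vec j) k)"
        by (simp add: lincomb_def distrib_right sum.distrib)
      then show ?thesis using ij b by (simp add: lincomb_std_vec)
    qed
    ultimately have "(\<Sum>k<N. ((b ! i) k + (b ! j) k)\<^sup>2) = (\<Sum>k<n. (?x k)\<^sup>2)"
      using met[of ?x] by simp
    also have "\<dots> = (\<Sum>k<n. (if k = i then 1 else 0) + (if k = j then 1 else 0))"
      using False by (intro sum.cong) (auto simp: std_vec_def)
    also have "\<dots> = 2" using ij by (simp add: sum.distrib)
    finally have "(\<Sum>k<N. ((b ! i) k + (b ! j) k)\<^sup>2) = 2" .
    moreover have "(\<Sum>k<N. ((b ! i) k + (b ! j) k)\<^sup>2) =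
        ip N (b ! i) (b ! i) + ip N (b ! j) (b ! j) + 2 * ip N (b ! i) (b ! j)"
      by (simp add: ip_def power2_sum sum.distrib sum_distrib_left mult.assoc)
        (simp add: power2_eq_square)
    ultimately show ?thesis using one ij False by simp
  qed (use one ij in simp)
qed

lemma ip_lincomb_right: "ip N x (lincomb b w) = (\<Sum>j<length b. w j * ip N x (b ! j))"
  unfolding lincomb_def by (rule ip_sum_right)

locale involution_bundle =
  fixes M :: "'p topology" and A :: "'p chart set" and d n m :: nat
    and Q :: "'p \<Rightarrow> real mat" and V W :: "'p \<Rightarrow> rvec set"
  assumes manifold: "smooth_manifold M d A"
    and Q_carrier: "\<And>p. p \<in> topspace M \<Longrightarrow> Q p \<in> carrier_mat (n + m) (n + m)"
    and Q_square: "\<And>p. p \<in> topspace M \<Longrightarrow> Q p * Q p = 1\<^sub>m (n + m)"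
    and Q_transpose: "\<And>p. p \<in> topspace M \<Longrightarrow> transpose_mat (Q p) = Q p"
    and Q_smooth: "\<And>i j. i < n + m \<Longrightarrow> j < n + m \<Longrightarrow>
      smooth_fun d A (topspace M) (\<lambda>p. Q p $$ (i, j))"
    and V_eq: "V = (\<lambda>p. eigspace (n + m) (Q p) (-1))"
    and W_eq: "W = (\<lambda>p. eigspace (n + m) (Q p) 1)"
begin

abbreviation N :: nat where "N \<equiv> n + m"

lemma V_iff: "p \<in> topspace M \<Longrightarrow> y \<in> V p \<longleftrightarrow> y \<in> Rn N \<and> (\<forall>k<N. (\<Sum>l<N. Q p $$ (k, l) * y l) = - y k)"
  using eigspace_iff[OF Q_carrier, of p y "-1"] by (simp add: V_eq)

lemma W_iff: "p \<in> topspace M \<Longrightarrow> y \<in> W p \<longleftrightarrow> y \<in> Rn N \<and> (\<forall>k<N. (\<Sum>l<N. Q p $$ (k, l) * y l) = y k)"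
  using eigspace_iff[OF Q_carrier, of p y 1] by (simp add: W_eq)

lemma Q_entries:
  assumes p: "p \<in> topspace M" and kl: "k < N" "l < N"
  shows "(\<Sum>r<N. Q p $$ (k, r) * Q p $$ (r, l)) = (if k = l then 1 else 0)"
    and "Q p $$ (k, l) = Q p $$ (l, k)"
proof -
  have dims: "dim_row (Q p) = N" "dim_col (Q p) = N" using Q_carrier[OF p] by auto
  have "(Q p * Q p) $$ (k, l) = (\<Sum>r<N. Q p $$ (k, r) * Q p $$ (r, l))"
    using kl by (simp add: scalar_prod_def lessThan_atLeast0 dims)
  then show "(\<Sum>r<N. Q p $$ (k, r) * Q p $$ (r, l)) = (if k = l then 1 else 0)"
    unfolding Q_square[OF p] using kl by simp
  have "transpose_mat (Q p) $$ (k, l) = Q p $$ (l, k)" using kl dims by simp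
  then show "Q p $$ (k, l) = Q p $$ (l, k)" unfolding Q_transpose[OF p] .
qed

text \<open>Eigenspaces of a symmetric matrix for different eigenvalues.\<close>

lemma V_perp_W:
  assumes p: "p \<in> topspace M" and x: "x \<in> V p" and y: "y \<in> W p"
  shows "ip N x y = 0"
proof -
  have "ip N x y = (\<Sum>k<N. \<Sum>l<N. x k * (Q p $$ (k, l) * y l))"
    using y p by (simp add: ip_def W_iff sum_distrib_left[symmetric])
  also have "\<dots> = (\<Sum>l<N. \<Sum>k<N. x k * (Q p $$ (k, l) * y l))" by (rule sum.swap)
  also have "\<dots> = (\<Sum>l<N. (\<Sum>k<N. Q p $$ (l, k) * x k) * y l)"
    unfolding sum_distrib_right
    by (intro sum.cong refl) (simp add: Q_entries(2)[OF p] mult_ac)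
  also have "\<dots> = - ip N x y"
    using x p by (simp add: ip_def V_iff sum_negf)
  finally show ?thesis by simp
qed

lemma local_involution:
  assumes c: "c \<in> A" and U: "openin M U" "U \<subseteq> fst c"
  shows "local_involution d N (snd c ` U) (\<lambda>k l z. Q (chart_inv c z) $$ (k, l))"
proof (rule local_involution.intro)
  show "openin (Euclidean_space d) (snd c ` U)" by (rule openin_chart_image[OF manifold c U])
  have UM: "U \<subseteq> topspace M" using U(1) by (rule openin_subset)
  show "smooth_on d (snd c ` U) (\<lambda>z. Q (chart_inv c z) $$ (k, l))" if kl: "k < N" "l < N" for k l
    by (rule smooth_fun_local[OF Q_smooth[OF kl] c]) (use UM U in blast)
  have mem: "chart_inv c z \<in> topspace M" if "z \<in> snd c ` U" for z
    using chart_inv_image(1)[OF manifold c U(2) that] UM by blast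
  show "(\<Sum>r<N. Q (chart_inv c z) $$ (k, r) * Q (chart_inv c z) $$ (r, l)) = (if k = l then 1 else 0)"
    if "z \<in> snd c ` U" "k < N" "l < N" for z k l
    by (rule Q_entries(1)[OF mem[OF that(1)] that(2,3)])
  show "Q (chart_inv c z) $$ (k, l) = Q (chart_inv c z) $$ (l, k)"
    if "z \<in> snd c ` U" "k < N" "l < N" for z k l
    by (rule Q_entries(2)[OF mem[OF that(1)] that(2,3)])
qed

lemma nabla0_cov_deriv:
  assumes "local_involution d N S (\<lambda>k l z. Q (chart_inv c z) $$ (k, l))"
  shows "nabla0 d N Q c s z vs k = (if k < N then case vs of [v] \<Rightarrow>
    local_involution.cov_deriv d N (\<lambda>k l z. Q (chart_inv c z) $$ (k, l))
      (\<lambda>k z. s (chart_inv c z) k) z v k | _ \<Rightarrow> 0 else 0)"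
  unfolding nabla0_def ext_d_fun_form local_involution.cov_deriv_def[OF assms]
  by (simp split: list.split)

lemma section_local:
  assumes "smooth_section d A N U s" "c \<in> A" "U \<subseteq> fst c" "k < N"
  shows "smooth_on d (snd c ` U) (\<lambda>z. s (chart_inv c z) k)"
  using assms by (intro smooth_fun_local[of d A U]) (auto simp: smooth_section_def)

lemma nabla0_metric: "nabla0_metric M d A N Q"
  unfolding nabla0_metric_def
proof (intro ballI allI impI, elim conjE)
  fix c U s t z v
  assume c: "c \<in> A" and U: "openin M U" "U \<subseteq> fst c"
    and s: "smooth_section d A N U s" and t: "smooth_section d A N U t" and z: "z \<in> snd c ` U"
  note li = local_involution[OF c U]
  interpret local_involution d N "snd c ` U" "\<lambda>k l z. Q (chart_inv c z) $$ (k, l)" by (rule li)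
  show "ext_d d (fun_form (\<lambda>z. \<Sum>k<N. s (chart_inv c z) k * t (chart_inv c z) k)) z [v] =
      (\<Sum>k<N. nabla0 d N Q c s z [v] k * t (chart_inv c z) k) +
      (\<Sum>k<N. s (chart_inv c z) k * nabla0 d N Q c t z [v] k)"
    unfolding ext_d_fun_form nabla0_cov_deriv[OF li]
    using cov_deriv_metric[of z "\<lambda>k z. s (chart_inv c z) k" "\<lambda>k z. t (chart_inv c z) k" v]
      section_local[OF s c U(2)] section_local[OF t c U(2)] z
    by simp
qed

text \<open>The eigenvalue \<open>a = -1\<close> gives the statements for \<open>V\<close>, and \<open>a = 1\<close> those for \<open>W\<close>.\<close>

lemma nabla0_eigenvalue:
  assumes a: "a * a = 1" and c: "c \<in> A" and U: "openin M U" "U \<subseteq> fst c"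
    and s: "smooth_section d A N U s"
    and eig: "\<And>p k. p \<in> U \<Longrightarrow> k < N \<Longrightarrow> (\<Sum>l<N. Q p $$ (k, l) * s p l) = a * s p k"
    and z: "z \<in> snd c ` U" and k: "k < N"
  shows "(\<Sum>l<N. Q (chart_inv c z) $$ (k, l) * nabla0 d N Q c s z [v] l) = a * nabla0 d N Q c s z [v] k"
    and "nabla0 d N Q c s z [v] k = 1/2 * (dirD d (\<lambda>z. s (chart_inv c z) k) z v +
      a * (\<Sum>l<N. Q (chart_inv c z) $$ (k, l) * dirD d (\<lambda>z. s (chart_inv c z) l) z v))"
proof -
  note li = local_involution[OF c U]
  interpret local_involution d N "snd c ` U" "\<lambda>k l z. Q (chart_inv c z) $$ (k, l)" by (rule li)
  have eig': "(\<Sum>l<N. Q (chart_inv c z) $$ (k, l) * s (chart_inv c z) l) = a * s (chart_inv c z) k"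
    if "z \<in> snd c ` U" "k < N" for z k
    using eig chart_inv_image(1)[OF manifold c U(2) that(1)] that(2) by blast
  note * = section_local[OF s c U(2)]
  show "(\<Sum>l<N. Q (chart_inv c z) $$ (k, l) * nabla0 d N Q c s z [v] l) = a * nabla0 d N Q c s z [v] k"
    using cov_deriv_preserves[OF z * a eig' k, of v] k by (simp add: nabla0_cov_deriv[OF li])
  show "nabla0 d N Q c s z [v] k = 1/2 * (dirD d (\<lambda>z. s (chart_inv c z) k) z v +
      a * (\<Sum>l<N. Q (chart_inv c z) $$ (k, l) * dirD d (\<lambda>z. s (chart_inv c z) l) z v))"
    using cov_deriv_eigen[OF z * a eig' k, of v] k by (simp add: nabla0_cov_deriv[OF li])
qed

lemma nabla0_Rn: "nabla0 d N Q c s z vs \<in> Rn N"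
  by (auto simp: nabla0_def topspace_Euclidean_space)

lemma nabla0_preserves_V: "nabla0_preserves M d A N Q V"
  unfolding nabla0_preserves_def
proof (intro ballI allI impI, elim conjE)
  fix c U s z v
  assume c: "c \<in> A" and U: "openin M U" "U \<subseteq> fst c" and s: "smooth_section d A N U s"
    and sV: "\<forall>p\<in>U. s p \<in> V p" and z: "z \<in> snd c ` U"
  have UM: "U \<subseteq> topspace M" using U(1) by (rule openin_subset)
  have eig: "(\<Sum>l<N. Q p $$ (k, l) * s p l) = (-1) * s p k" if "p \<in> U" "k < N" for p k
    using sV UM that V_iff[of p "s p"] by auto
  have "chart_inv c z \<in> topspace M" using chart_inv_image(1)[OF manifold c U(2) z] UM by blast
  then show "nabla0 d N Q c s z [v] \<in> V (chart_inv c z)"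
    using nabla0_eigenvalue(1)[where a="-1" and v=v, OF _ c U s eig z] nabla0_Rn[of c s z "[v]"]
    by (subst V_iff) simp_all
qed

lemma nabla0_preserves_W: "nabla0_preserves M d A N Q W"
  unfolding nabla0_preserves_def
proof (intro ballI allI impI, elim conjE)
  fix c U s z v
  assume c: "c \<in> A" and U: "openin M U" "U \<subseteq> fst c" and s: "smooth_section d A N U s"
    and sW: "\<forall>p\<in>U. s p \<in> W p" and z: "z \<in> snd c ` U"
  have UM: "U \<subseteq> topspace M" using U(1) by (rule openin_subset)
  have eig: "(\<Sum>l<N. Q p $$ (k, l) * s p l) = 1 * s p k" if "p \<in> U" "k < N" for p k
    using sW UM that W_iff[of p "s p"] by auto
  have "chart_inv c z \<in> topspace M" using chart_inv_image(1)[OF manifold c U(2) z] UM by blast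
  then show "nabla0 d N Q c s z [v] \<in> W (chart_inv c z)"
    using nabla0_eigenvalue(1)[where a="1" and v=v, OF _ c U s eig z] nabla0_Rn[of c s z "[v]"]
    by (subst W_iff) simp_all
qed

end

section \<open>The Mathai-Quillen form in an orthonormal frame\<close>

locale frame_chart = involution_bundle M A d n m Q V W
  for M :: "'p topology" and A d n m Q V W +
  fixes c :: "'p chart" and U :: "'p set" and e :: "'p \<Rightarrow> rvec list"
  assumes c: "c \<in> A" and U: "openin M U" "U \<subseteq> fst c"
    and frame: "smooth_frame M d A (n + m) n V U e"
    and metric: "\<And>p x. p \<in> U \<Longrightarrow> x \<in> Rn n \<Longrightarrow> (\<Sum>k<n + m. (lincomb (e p) x k)\<^sup>2) = (\<Sum>i<n. (x i)\<^sup>2)"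
begin

abbreviation S :: "rvec set" where "S \<equiv> snd c ` U"

abbreviation pt :: "rvec \<Rightarrow> 'p" where "pt \<equiv> chart_inv c"

abbreviation ev :: "nat \<Rightarrow> rvec \<Rightarrow> rvec" where "ev i z \<equiv> e (pt z) ! i"

definition De :: "nat \<Rightarrow> rvec \<Rightarrow> rvec \<Rightarrow> rvec"
  where "De i z v k = dirD d (\<lambda>z. ev i z k) z v"

lemma S_open: "openin (Euclidean_space d) S"
  by (rule openin_chart_image[OF manifold c U])

lemma pt_mem: "z \<in> S \<Longrightarrow> pt z \<in> U" "z \<in> S \<Longrightarrow> pt z \<in> topspace M"
  using chart_inv_image(1)[OF manifold c U(2)] openin_subset[OF U(1)] by auto

lemma e_basis: "p \<in> U \<Longrightarrow> basis_of n (V p) (e p)"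
  using frame by (simp add: smooth_frame_def)

lemma e_length: "p \<in> U \<Longrightarrow> length (e p) = n"
  using e_basis by (auto simp: basis_of_def)

lemma e_section: "i < n \<Longrightarrow> smooth_section d A N U (\<lambda>p. e p ! i)"
  using frame by (simp add: smooth_frame_def)

lemma e_smooth: "i < n \<Longrightarrow> k < N \<Longrightarrow> smooth_on d S (\<lambda>z. ev i z k)"
  by (rule section_local[OF e_section c U(2)])

lemma e_diffable: "z \<in> S \<Longrightarrow> i < n \<Longrightarrow> k < N \<Longrightarrow> diffable d (\<lambda>z. ev i z k) z"
  by (rule smooth_on_diffable[OF e_smooth])

lemma e_in_V: "p \<in> U \<Longrightarrow> i < n \<Longrightarrow> e p ! i \<in> V p"
  by (rule basis_of_nth[OF e_basis])

lemma e_orthonormal: "p \<in> U \<Longrightarrow> i < n \<Longrightarrow> j < n \<Longrightarrow> ip N (e p ! i) (e p ! j) = (if i = j then 1 else 0)"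
  by (rule orthonormal_of_metric[OF e_length metric])

text \<open>The inner products of the frame are constant.\<close>

lemma De_antisym:
  assumes z: "z \<in> S" and ij: "i < n" "j < n"
  shows "ip N (ev i z) (De j z v) = - ip N (De i z v) (ev j z)"
proof -
  have "dirD d (\<lambda>z. \<Sum>k<N. ev i z k * ev j z k) z v = dirD d (\<lambda>_. if i = j then 1 else 0) z v"
    using e_orthonormal[OF pt_mem(1) ij] by (intro dirD_cong_open[OF S_open z]) (auto simp: ip_def)
  moreover have "dirD d (\<lambda>z. \<Sum>k<N. ev i z k * ev j z k) z v =
      (\<Sum>k<N. De i z v k * ev j z k) + (\<Sum>k<N. ev i z k * De j z v k)"
    unfolding De_def by (rule diffable_sum_prod) (use e_diffable[OF z] ij in auto)
  ultimately show ?thesis by (simp add: ip_def diffable_const)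
qed

text \<open>
  The coordinates of \<open>\<nabla>e\<^sub>j\<close>, which lies in \<open>V\<close>, are its inner products with the orthonormal frame,
  and these do not see the projection to \<open>V\<close>.
\<close>

lemma theta0_eq:
  assumes z: "z \<in> S" and ij: "i < n" "j < n"
  shows "theta0 d N Q c e i j z vs = (case vs of [v] \<Rightarrow> ip N (ev i z) (De j z v) | _ \<Rightarrow> 0)"
proof (cases "\<exists>v. vs = [v]")
  case True
  then obtain v where vs: "vs = [v]" by blast
  let ?p = "pt z" and ?y = "nabla0 d N Q c (\<lambda>p. e p ! j) z [v]"
  have p: "?p \<in> U" "?p \<in> topspace M" using pt_mem[OF z] by auto
  have eig: "(\<Sum>l<N. Q p $$ (k, l) * (e p ! j) l) = (-1) * (e p ! j) k" if "p \<in> U" "k < N" for p k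
    using e_in_V[OF that(1) ij(2)] that V_iff[of p] openin_subset[OF U(1)] by auto
  have yV: "?y \<in> V ?p"
    using nabla0_eigenvalue(1)[where a="-1" and v=v, OF _ c U e_section[OF ij(2)] eig z]
      nabla0_Rn[of c "\<lambda>p. e p ! j" z "[v]"] V_iff[OF p(2)] by simp
  note x = lincomb_coords[OF e_basis[OF p(1)] yV]
  have "ip N (ev i z) (lincomb (e ?p) (coords (e ?p) ?y)) = (\<Sum>l<n. if l = i then coords (e ?p) ?y i else 0)"
    unfolding ip_lincomb_right e_length[OF p(1)]
    using ij by (intro sum.cong refl) (simp add: e_orthonormal[OF p(1)])
  then have "coords (e ?p) ?y i = ip N (ev i z) ?y" using x(2) ij by simp
  also have "\<dots> = (\<Sum>k<N. 1/2 * (ev i z k * De j z v k) - 1/2 * (\<Sum>l<N. ev i z k * Q ?p $$ (k, l) * De j z v l))"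
    unfolding ip_def
  proof (intro sum.cong refl)
    fix k assume "k \<in> {..<N}"
    then have "?y k = 1/2 * (De j z v k + (-1) * (\<Sum>l<N. Q ?p $$ (k, l) * De j z v l))"
      unfolding De_def
      using nabla0_eigenvalue(2)[where a="-1" and v=v, OF _ c U e_section[OF ij(2)] eig z] by simp
    then show "ev i z k * ?y k =
        1/2 * (ev i z k * De j z v k) - 1/2 * (\<Sum>l<N. ev i z k * Q ?p $$ (k, l) * De j z v l)"
      by (simp add: right_diff_distrib mult.assoc flip: sum_distrib_left)
  qed
  also have "\<dots> = 1/2 * ip N (ev i z) (De j z v) -
      1/2 * (\<Sum>k<N. \<Sum>l<N. ev i z k * Q ?p $$ (k, l) * De j z v l)"
    by (simp only: sum_subtractf ip_def flip: sum_distrib_left)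
  also have "(\<Sum>k<N. \<Sum>l<N. ev i z k * Q ?p $$ (k, l) * De j z v l) =
      (\<Sum>l<N. (\<Sum>k<N. Q ?p $$ (l, k) * ev i z k) * De j z v l)"
    unfolding sum_distrib_right
    by (subst sum.swap) (intro sum.cong refl, simp add: Q_entries(2)[OF p(2)])
  also have "\<dots> = - ip N (ev i z) (De j z v)"
    using e_in_V[OF p(1) ij(1)] p(2) by (simp add: ip_def V_iff sum_negf)
  finally show ?thesis by (simp add: vs theta0_def)
next
  case False
  have "nabla0 d N Q c (\<lambda>p. e p ! j) z vs = (\<lambda>k. 0)"
    unfolding nabla0_def ext_d_fun_form using False by (auto split: list.split)
  moreover have "coords (e (pt z)) (\<lambda>k. 0) = (\<lambda>k. 0)"
    using coords_lincomb[OF e_basis[OF pt_mem(1)[OF z]], of "\<lambda>_. 0"]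
    by (simp add: lincomb_def topspace_Euclidean_space)
  ultimately show ?thesis using False by (auto simp: theta0_def split: list.split)
qed

text \<open>
  The covariance of the functionals \<open>\<langle>de\<^sub>i(v), y\<rangle>\<close> and \<open>\<langle>de\<^sub>j(w), y\<rangle>\<close> on the fiber of \<open>W\<close> with
  Gaussian weight: half the inner product of the projections to \<open>W\<close>, computed by subtracting the
  projections to \<open>V\<close>.
\<close>

definition W_cov :: "rvec \<Rightarrow> nat \<Rightarrow> rvec \<Rightarrow> nat \<Rightarrow> rvec \<Rightarrow> real"
  where "W_cov z i v j w = (ip N (De i z v) (De j z w) -
    (\<Sum>l<n. ip N (De i z v) (ev l z) * ip N (ev l z) (De j z w))) / 2"

text \<open>
  Second derivatives of the frame cancel in \<open>d\<theta>\<close>. What remains of \<open>d\<theta> + \<theta> \<theta>\<close> is the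
  antisymmetrization of the inner product of the projections of \<open>de\<^sub>i\<close> and \<open>de\<^sub>j\<close> to \<open>W\<close>, which
  is twice a covariance of Gaussian variables.
\<close>

lemma curvature_eq:
  assumes z: "z \<in> S" and ij: "i < n" "j < n"
  shows "curvature d n (theta0 d N Q c e) i j z vs =
    alternate 2 (\<lambda>us. 2 * W_cov z i (us ! 0) j (us ! 1)) vs"
proof -
  let ?t = "\<lambda>i j z v. ip N (ev i z) (De j z v)"
  have D: "dirD d (\<lambda>z. ?t i j z w) z v = ip N (De i z v) (De j z w) +
      (\<Sum>k<N. ev i z k * dirD d (\<lambda>z. dirD d (\<lambda>z. ev j z k) z w) z v)" for v w
    unfolding ip_def De_def
    by (rule diffable_sum_prod) (use e_diffable[OF z] diffable_dirD[OF e_smooth z] ij in auto)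
  have comm: "(\<Sum>k<N. ev i z k * dirD d (\<lambda>z. dirD d (\<lambda>z. ev j z k) z w) z v) =
      (\<Sum>k<N. ev i z k * dirD d (\<lambda>z. dirD d (\<lambda>z. ev j z k) z v) z w)" for v w
    using ij by (intro sum.cong refl) (simp add: dirD_commute[OF S_open e_smooth z, of j _ w v])
  have ext: "ext_d d (theta0 d N Q c e i j) z vs =
      (case vs of [v, w] \<Rightarrow> dirD d (\<lambda>z. ?t i j z w) z v - dirD d (\<lambda>z. ?t i j z v) z w | _ \<Rightarrow> 0)"
    by (rule ext_d_1_form[OF S_open z]) (rule theta0_eq[OF _ ij])
  have wed: "wedge (theta0 d N Q c e i l) (theta0 d N Q c e l j) z vs =
      (case vs of [v, w] \<Rightarrow> ?t i l z v * ?t l j z w - ?t i l z w * ?t l j z v | _ \<Rightarrow> 0)" if l: "l < n" for l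
  proof -
    have "theta0 d N Q c e i l z us = alternate 1 (\<lambda>us. ?t i l z (us ! 0)) us" for us
      unfolding theta0_eq[OF z ij(1) l] alternate_1 by (simp split: list.split)
    moreover have "theta0 d N Q c e l j z us = alternate 1 (\<lambda>us. ?t l j z (us ! 0)) us" for us
      unfolding theta0_eq[OF z l ij(2)] alternate_1 by (simp split: list.split)
    ultimately have "wedge (theta0 d N Q c e i l) (theta0 d N Q c e l j) z vs =
        alternate (1 + 1) (\<lambda>us. ?t i l z (take 1 us ! 0) * ?t l j z (drop 1 us ! 0)) vs"
      by (rule wedge_alternate)
    then show ?thesis by (simp only: one_add_one alternate_2) (simp split: list.split)
  qed
  have "curvature d n (theta0 d N Q c e) i j z vs =
      (case vs of [v, w] \<Rightarrow> 2 * W_cov z i v j w - 2 * W_cov z i w j v | _ \<Rightarrow> 0)"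
  proof (cases "\<exists>v w. vs = [v, w]")
    case True
    then obtain v w where vs: "vs = [v, w]" by blast
    have "(\<Sum>l<n. ?t i l z v * ?t l j z w - ?t i l z w * ?t l j z v) =
        (\<Sum>l<n. ip N (De i z w) (ev l z) * ip N (ev l z) (De j z v)) -
        (\<Sum>l<n. ip N (De i z v) (ev l z) * ip N (ev l z) (De j z w))"
      unfolding sum_subtractf[symmetric]
      using ij by (intro sum.cong refl) (simp add: De_antisym[OF z, of i])
    moreover have "curvature d n (theta0 d N Q c e) i j z vs =
        ip N (De i z v) (De j z w) - ip N (De i z w) (De j z v) +
        (\<Sum>l<n. ?t i l z v * ?t l j z w - ?t i l z w * ?t l j z v)"
      using comm[of w v] by (simp add: curvature_def vs ext[unfolded vs] wed[unfolded vs] D)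
    ultimately show ?thesis by (simp add: W_cov_def vs diff_divide_distrib)
  next
    case False
    then have "(case vs of [v, w] \<Rightarrow> f v w | _ \<Rightarrow> 0) = 0" for f :: "rvec \<Rightarrow> rvec \<Rightarrow> real"
      by (auto split: list.split)
    then show ?thesis by (simp add: curvature_def ext wed)
  qed
  then show ?thesis unfolding alternate_2 by (simp split: list.split)
qed

text \<open>The 1-form \<open>(dx + \<theta> x)\<^sub>i\<close> at the point \<open>w\<close> of the total space.\<close>

definition dx_theta_val :: "rvec \<Rightarrow> nat \<Rightarrow> rvec \<Rightarrow> real"
  where "dx_theta_val w i v = v (d + i) + (\<Sum>j<n. ip N (ev i (proj d w)) (De j (proj d w) v) * w (d + j))"

lemma De_proj: "De i z (proj d v) = De i z v"
  by (rule ext) (simp add: De_def dirD_proj)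

lemma dx_theta_eq:
  assumes w: "proj d w \<in> S" and i: "i < n"
  shows "dx_theta d n (theta0 d N Q c e) i w us = alternate 1 (\<lambda>us. dx_theta_val w i (us ! 0)) us"
proof -
  have lift: "lift_form d n (theta0 d N Q c e i j) w us =
      (case us of [v] \<Rightarrow> ip N (ev i (proj d w)) (De j (proj d w) v) | _ \<Rightarrow> 0)" if "j < n" for j us
    unfolding lift_form_def pullback_proj theta0_eq[OF w i that]
    by (cases us; cases "tl us") (auto simp: De_proj)
  have "coord_form (d + n) (d + i) w us = (case us of [v] \<Rightarrow> v (d + i) | _ \<Rightarrow> 0)"
    using i by (simp add: coord_form_eq)
  then show ?thesis
    by (cases us; cases "tl us")
      (auto simp: dx_theta_def lift alternate_1[simplified] dx_theta_val_def intro!: sum.cong sum.neutral)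
qed

lemma lift_curvature_eq:
  assumes w: "proj d w \<in> S" and ij: "i < n" "j < n"
  shows "lift_form d n (curvature d n (theta0 d N Q c e) i j) w us =
    alternate 2 (\<lambda>us. 2 * W_cov (proj d w) i (us ! 0) j (us ! 1)) us"
  unfolding lift_form_def pullback_proj curvature_eq[OF w ij] alternate_map
  by (rule alternate_cong) (simp add: W_cov_def De_proj)

text \<open>
  The sum may run over all subsets \<open>I\<close>, because \<^const>\<open>pairing_sum\<close> vanishes on complements of odd
  size.
\<close>

lemma TMQ_eq:
  assumes w: "proj d w \<in> S"
  shows "TMQ d n (theta0 d N Q c e) w vs = pi powr (- real n / 2) * exp (- (\<Sum>i<n. (w (d + i))\<^sup>2)) *
    alternate n (\<lambda>us. \<Sum>I\<in>Pow {..<n}. (\<Prod>i\<in>I. dx_theta_val w i (us ! i)) *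
      pairing_sum (\<lambda>i j. W_cov (proj d w) i (us ! i) j (us ! j)) ({..<n} - I)) vs"
proof -
  let ?f = "\<lambda>I us. (\<Prod>i\<in>I. dx_theta_val w i (us ! i)) *
      pairing_sum (\<lambda>i j. W_cov (proj d w) i (us ! i) j (us ! j)) ({..<n} - I)"
  have "(\<Sum>I | I \<subseteq> {..<n} \<and> even (card ({..<n} - I)). shuffle_sign n I *
      wedge (wedge_list (map (dx_theta d n (theta0 d N Q c e)) (sorted_list_of_set I)))
        (Omega_part d n (curvature d n (theta0 d N Q c e)) ({..<n} - I)) w vs) =
      (\<Sum>I | I \<subseteq> {..<n} \<and> even (card ({..<n} - I)). alternate n (?f I) vs)"
  proof (intro sum.cong refl)
    fix I assume "I \<in> {I. I \<subseteq> {..<n} \<and> even (card ({..<n} - I))}"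
    then have I: "I \<subseteq> {..<n}" "even (card ({..<n} - I))" by auto
    show "shuffle_sign n I *
      wedge (wedge_list (map (dx_theta d n (theta0 d N Q c e)) (sorted_list_of_set I)))
        (Omega_part d n (curvature d n (theta0 d N Q c e)) ({..<n} - I)) w vs = alternate n (?f I) vs"
    proof (rule wedge_Omega_part_alternate[where a="dx_theta_val w" and K="W_cov (proj d w)"])
      show "dx_theta d n (theta0 d N Q c e) i w us = alternate 1 (\<lambda>us. dx_theta_val w i (us ! 0)) us"
        if "i < n" for i us using w that by (rule dx_theta_eq)
      show "lift_form d n (curvature d n (theta0 d N Q c e) i j) w us =
          alternate 2 (\<lambda>us. 2 * W_cov (proj d w) i (us ! 0) j (us ! 1)) us"
        if "i < n" "j < n" for i j us using w that by (rule lift_curvature_eq)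
    qed (rule I)+
  qed
  also have "\<dots> = (\<Sum>I\<in>Pow {..<n}. alternate n (?f I) vs)"
  proof (rule sum.mono_neutral_left)
    have "?f I = (\<lambda>us. 0)" if "odd (card ({..<n} - I))" for I
      using that by (simp add: pairing_sum_def)
    then show "\<forall>I\<in>Pow {..<n} - {I. I \<subseteq> {..<n} \<and> even (card ({..<n} - I))}. alternate n (?f I) vs = 0"
      by (auto simp: alternate_def)
  qed auto
  also have "\<dots> = alternate n (\<lambda>us. \<Sum>I\<in>Pow {..<n}. ?f I us) vs"
    by (rule alternate_sum[symmetric])
  finally show ?thesis unfolding TMQ_def by simp
qed

end

section \<open>Fiber integration in a frame\<close>

lemma has_partial_proj:
  "i < d \<Longrightarrow> has_partial i (\<lambda>z. f (proj d z)) z D \<longleftrightarrow> has_partial i f (proj d z) D"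
  "\<not> i < d \<Longrightarrow> has_partial i (\<lambda>z. f (proj d z)) z 0"
proof -
  assume "i < d"
  then have "proj d (z(i := t)) = (proj d z)(i := t)" "proj d z i = z i" for t
    by (auto simp: proj_def)
  then show "has_partial i (\<lambda>z. f (proj d z)) z D \<longleftrightarrow> has_partial i f (proj d z) D"
    by (simp add: has_partial_def)
next
  assume "\<not> i < d"
  then have "proj d (z(i := t)) = proj d z" for t by (auto simp: proj_def)
  then show "has_partial i (\<lambda>z. f (proj d z)) z 0" by (simp add: has_partial_def)
qed

lemma has_partial_coord: "has_partial i (\<lambda>z. z j) z (if i = j then 1 else 0)"
  by (auto simp: has_partial_def fun_upd_def)

text \<open>
  The position vector in R^N and the transition functions of the total space are affine in the
  fiber coordinates. Only points that agree with \<open>z\<close> beyond the coordinates \<open>i < d + r\<close> matter,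
  since these are the ones that partial derivatives at \<open>z\<close> see.
\<close>

lemma fiber_affine_differential:
  assumes S: "openin (Euclidean_space d) S" and z: "proj d z \<in> S"
    and h: "diffable d h (proj d z)"
    and B: "\<And>j. j < r \<Longrightarrow> diffable d (B j) (proj d z)"
    and f: "\<And>z'. proj d z' \<in> S \<Longrightarrow> (\<And>i. i \<ge> d + r \<Longrightarrow> z' i = z i) \<Longrightarrow>
      f z' = h (proj d z') + (\<Sum>j<r. z' (d + j) * B j (proj d z'))"
  shows "(\<Sum>i<d + r. partial i f z * v i) = dirD d h (proj d z) v +
    (\<Sum>j<r. v (d + j) * B j (proj d z)) + (\<Sum>j<r. z (d + j) * dirD d (B j) (proj d z) v)"
proof -
  let ?u = "proj d z" and ?f = "\<lambda>z. h (proj d z) + (\<Sum>j<r. z (d + j) * B j (proj d z))"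
  let ?H = "\<lambda>i h. if i < d then partial i h ?u else 0"
  let ?P = "\<lambda>i. ?H i h + (\<Sum>j<r. (if i = d + j then 1 else 0) * B j ?u + z (d + j) * ?H i (B j))"
  have part: "partial i f z = ?P i" if i: "i < d + r" for i
  proof -
    have base: "has_partial i (\<lambda>z. k (proj d z)) z (?H i k)" if "diffable d k ?u" for k
      using that has_partial_proj(1)[of i d k z "?H i k"] has_partial_proj(2)[of i d k z]
      by (auto simp: diffable_def)
    have "has_partial i ?f z (?P i)"
      by (intro has_partial_add has_partial_sum has_partial_mult has_partial_coord base h B) auto
    then have "partial i ?f z = ?P i" by (rule has_partial_partial)
    moreover have "\<forall>\<^sub>F t in nhds (z i). proj d (z(i := t)) \<in> S"
    proof (cases "i < d")
      case True
      then have "proj d (z(i := t)) = ?u(i := t)" "?u i = z i" for t by (auto simp: proj_def)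
      then show ?thesis using eventually_upd_mem[OF S z True] by simp
    next
      case False
      then have "proj d (z(i := t)) = ?u" for t by (auto simp: proj_def)
      then show ?thesis using z by simp
    qed
    then have "\<forall>\<^sub>F t in nhds (z i). f (z(i := t)) = ?f (z(i := t))"
      by (rule eventually_mono) (rule f, use i in auto)
    then have "partial i f z = partial i ?f z" by (rule partial_cong_ev)
    ultimately show ?thesis by simp
  qed
  have "(\<Sum>i<d + r. partial i f z * v i) = (\<Sum>i<d + r. ?H i h * v i + (\<Sum>j<r.
      (if i = d + j then v i * B j ?u else 0) + (if i < d then z (d + j) * (v i * partial i (B j) ?u) else 0)))"
    by (intro sum.cong refl) (auto simp: part distrib_right sum_distrib_right intro!: sum.cong)
  also have "\<dots> = (\<Sum>i<d + r. ?H i h * v i) + (\<Sum>j<r. \<Sum>i<d + r.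
      (if i = d + j then v i * B j ?u else 0) + (if i < d then z (d + j) * (v i * partial i (B j) ?u) else 0))"
    by (subst sum.distrib) (intro arg_cong2[where f="(+)"] refl sum.swap)
  finally have split: "(\<Sum>i<d + r. partial i f z * v i) = (\<Sum>i<d + r. ?H i h * v i) + (\<Sum>j<r. \<Sum>i<d + r.
      (if i = d + j then v i * B j ?u else 0) + (if i < d then z (d + j) * (v i * partial i (B j) ?u) else 0))" .
  have low: "(\<Sum>i<d + r. if i < d then F i else 0) = (\<Sum>i<d. F i)" for F :: "nat \<Rightarrow> real"
    by (rule sum.mono_neutral_cong_right) auto
  have "(\<Sum>i<d + r. ?H i h * v i) = (\<Sum>i<d + r. if i < d then v i * partial i h ?u else 0)"
    by (intro sum.cong) auto
  then have 1: "(\<Sum>i<d + r. ?H i h * v i) = dirD d h ?u v" by (simp add: low dirD_def)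
  have 2: "(\<Sum>j<r. \<Sum>i<d + r.
      (if i = d + j then v i * B j ?u else 0) + (if i < d then z (d + j) * (v i * partial i (B j) ?u) else 0)) =
      (\<Sum>j<r. v (d + j) * B j ?u + z (d + j) * dirD d (B j) ?u v)"
  proof (intro sum.cong refl)
    fix j assume j: "j \<in> {..<r}"
    then show "(\<Sum>i<d + r. (if i = d + j then v i * B j ?u else 0) +
        (if i < d then z (d + j) * (v i * partial i (B j) ?u) else 0)) =
        v (d + j) * B j ?u + z (d + j) * dirD d (B j) ?u v"
      by (simp add: sum.distrib low dirD_def sum_distrib_left)
  qed
  show ?thesis unfolding split 1 2 by (simp add: sum.distrib)
qed

lemma Phi0_alternate:
  "Phi0 d N z us = pi powr (- real N / 2) * exp (- (\<Sum>i<N. (z (d + i))\<^sup>2)) *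
    alternate N (\<lambda>us. \<Prod>k<N. (us ! k) (d + k)) us"
proof -
  let ?\<alpha> = "map (\<lambda>i. coord_form (d + N) (d + i)) [0..<N]"
  have "wedge_list ?\<alpha> z us = alternate (length ?\<alpha>) (\<lambda>us. \<Prod>k<length ?\<alpha>. (us ! k) (d + k)) us"
    by (rule wedge_list_1_forms[where h="\<lambda>k v. v (d + k)"])
      (auto simp: coord_form_eq alternate_1[simplified] split: list.split)
  then show ?thesis by (simp add: Phi0_def)
qed

lemma sum_lessThan_add:
  "(\<Sum>j<n + m. f j) = (\<Sum>j<n. f j) + (\<Sum>j<m. f (n + j))" for f :: "nat \<Rightarrow> real"
  by (induction m) simp_all

lemma sum_squares_add:
  "(\<Sum>k<N. (x k + y k)\<^sup>2) = ip N x x + 2 * ip N x y + ip N y y"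
  by (simp add: ip_def power2_sum sum.distrib sum_distrib_left mult.assoc) (simp add: power2_eq_square)

locale split_frame_chart = frame_chart M A d n m Q V W c U e
  for M :: "'p topology" and A d n m Q V W c U e +
  fixes g :: "'p \<Rightarrow> rvec list"
  assumes g_frame: "smooth_frame M d A (n + m) m W U g"
begin

abbreviation gv :: "nat \<Rightarrow> rvec \<Rightarrow> rvec" where "gv j z \<equiv> g (pt z) ! j"

definition Dg :: "nat \<Rightarrow> rvec \<Rightarrow> rvec \<Rightarrow> rvec"
  where "Dg j z v k = dirD d (\<lambda>z. gv j z k) z v"

lemma g_basis: "p \<in> U \<Longrightarrow> basis_of m (W p) (g p)"
  using g_frame by (simp add: smooth_frame_def)

lemma g_length: "p \<in> U \<Longrightarrow> length (g p) = m"
  using g_basis by (auto simp: basis_of_def)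

lemma g_section: "j < m \<Longrightarrow> smooth_section d A N U (\<lambda>p. g p ! j)"
  using g_frame by (simp add: smooth_frame_def)

lemma g_diffable: "z \<in> S \<Longrightarrow> j < m \<Longrightarrow> k < N \<Longrightarrow> diffable d (\<lambda>z. gv j z k) z"
  by (rule smooth_on_diffable[OF section_local[OF g_section c U(2)]])

lemma U_sub: "p \<in> U \<Longrightarrow> p \<in> topspace M"
  using openin_subset[OF U(1)] by auto

lemma g_in_W: "p \<in> U \<Longrightarrow> j < m \<Longrightarrow> g p ! j \<in> W p"
  by (rule basis_of_nth[OF g_basis])

lemma e_perp_g: "p \<in> U \<Longrightarrow> i < n \<Longrightarrow> j < m \<Longrightarrow> ip N (e p ! i) (g p ! j) = 0"
  by (rule V_perp_W[OF U_sub e_in_V g_in_W])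

text \<open>
  A linear relation between the vectors of \<open>e\<close> and \<open>g\<close> has zero coefficients at \<open>e\<close>, by
  orthogonality, and then also at the basis \<open>g\<close> of \<open>W\<close>.
\<close>

lemma split_frame_at:
  assumes p: "p \<in> U"
  shows "split_frame n m (\<lambda>i. e p ! i) (\<lambda>j. g p ! j)"
proof
  let ?F = "frame_mat n m (\<lambda>i. e p ! i) (\<lambda>j. g p ! j)"
  have car: "?F \<in> carrier_mat N N" by (simp add: frame_mat_def)
  show "Determinant.det ?F \<noteq> 0"
  proof
    assume "Determinant.det ?F = 0"
    then obtain x where x: "x \<in> carrier_vec N" "x \<noteq> 0\<^sub>v N" "?F *\<^sub>v x = 0\<^sub>v N"
      using det_0_iff_vec_prod_zero[OF car] by blast
    let ?y = "\<lambda>k. \<Sum>i<n. x $ i * (e p ! i) k" and ?w = "\<lambda>k. \<Sum>j<m. x $ (n + j) * (g p ! j) k"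
    have rel: "?y k + ?w k = 0" if k: "k < N" for k
    proof -
      have "(?F *\<^sub>v x) $ k = (\<Sum>c<N. (if c < n then (e p ! c) k else (g p ! (c - n)) k) * x $ c)"
        using x(1) k by (simp add: frame_mat_def scalar_prod_def lessThan_atLeast0)
      also have "\<dots> = ?y k + ?w k"
        by (simp add: sum_lessThan_add mult.commute[of "x $ _"])
      finally show ?thesis using x(3) k by simp
    qed
    have x1: "x $ i = 0" if i: "i < n" for i
    proof -
      have "ip N (e p ! i) (\<lambda>k. ?y k + ?w k) = 0"
        unfolding ip_def by (intro sum.neutral) (simp add: rel)
      then have "ip N (e p ! i) ?y + ip N (e p ! i) ?w = 0" by (simp only: ip_add_right)
      moreover have "ip N (e p ! i) ?w = 0"
        using i by (simp add: ip_sum_right e_perp_g[OF p])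
      moreover have "ip N (e p ! i) ?y = (\<Sum>l<n. if l = i then x $ i else 0)"
        unfolding ip_sum_right using i by (intro sum.cong refl) (simp add: e_orthonormal[OF p])
      ultimately show ?thesis using i by simp
    qed
    let ?c = "\<lambda>j. if j < m then x $ (n + j) else 0"
    have "lincomb (g p) ?c k = 0" for k
    proof (cases "k < N")
      case True
      then show ?thesis using rel[OF True] x1 by (simp add: lincomb_def g_length[OF p])
    next
      case False
      have "(g p ! j) k = 0" if "j < m" for j
        using g_in_W[OF p that] W_iff[OF U_sub[OF p]] False by (auto simp: topspace_Euclidean_space)
      then show ?thesis by (simp add: lincomb_def g_length[OF p])
    qed
    then have lc: "lincomb (g p) ?c = lincomb (g p) (\<lambda>_. 0)" by (auto simp: lincomb_def)
    have inj: "inj_on (lincomb (g p)) (Rn m)"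
      using g_basis[OF p] by (auto simp: basis_of_def bij_betw_def)
    have "?c \<in> Rn m" "(\<lambda>_. 0) \<in> Rn m" by (auto simp: topspace_Euclidean_space)
    then have "?c = (\<lambda>_. 0)" using inj lc unfolding inj_on_def by blast
    then have x2: "x $ (n + j) = 0" if "j < m" for j using that by (metis (full_types))
    have "x = 0\<^sub>v N"
    proof (rule eq_vecI)
      fix i assume "i < dim_vec (0\<^sub>v N :: real Matrix.vec)"
      then have i: "i < N" by simp
      show "x $ i = 0\<^sub>v N $ i"
        using x1[of i] x2[of "i - n"] i by (cases "i < n") auto
    qed (use x(1) in simp)
    then show False using x(2) by simp
  qed
qed (use e_orthonormal[OF p] e_perp_g[OF p] in auto)

text \<open>
  The position vector in R^N at the point of \<open>V \<oplus> W\<close> with coordinates \<open>z\<close> on \<open>V\<close> and \<open>w\<close> on \<open>W\<close>,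
  and its differential along a tangent vector \<open>v\<close> of \<open>V\<close> with \<open>w\<close> held fixed.
\<close>

definition total :: "rvec \<Rightarrow> rvec \<Rightarrow> rvec"
  where "total z w k = (\<Sum>j<n. z (d + j) * ev j (proj d z) k) +
    (\<Sum>j<m. w (d + n + j) * gv j (proj d z) k)"

definition dtotal :: "rvec \<Rightarrow> rvec \<Rightarrow> rvec \<Rightarrow> rvec"
  where "dtotal z w v k = (\<Sum>j<n. v (d + j) * ev j (proj d z) k) +
    (\<Sum>j<n. z (d + j) * De j (proj d z) v k) + (\<Sum>j<m. w (d + n + j) * Dg j (proj d z) v k)"

text \<open>
  The form \<open>\<Phi>\<close> evaluated on the tangent vectors \<open>vs\<close> followed by the coordinate vectors of the
  fiber of \<open>W\<close>: the former are mapped to their images under the differential of the position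
  vector \<open>total\<close> in R^N, the latter to the frame \<open>g\<close>.
\<close>

lemma pullback_Phi0:
  assumes z: "proj d z \<in> S" and vs: "set vs \<subseteq> Rn (d + n)"
  shows "pullback (d + N) (d + N) (frame_to_std d N c (\<lambda>p. e p @ g p)) (Phi0 d N)
      (override_on z w {d + n..<d + n + m}) (vs @ map std_vec [d + n..<d + n + m]) =
    pi powr (- real N / 2) * exp (- (\<Sum>k<N. (total z w k)\<^sup>2)) *
      (if length vs = n then Determinant.det (frame_mat n m (\<lambda>b. dtotal z w (vs ! b))
        (\<lambda>j. gv j (proj d z))) else 0)"
proof -
  let ?zw = "override_on z w {d + n..<d + n + m}" and ?u = "proj d z"
  let ?F = "frame_to_std d N c (\<lambda>p. e p @ g p)"
  let ?us = "vs @ map std_vec [d + n..<d + n + m]"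
  define B where "B k j u = ((e (pt u) @ g (pt u)) ! j) k" for k j u
  have proj_zw: "proj d ?zw = ?u" by (auto simp: proj_def override_on_def)
  have B1: "B k j u = ev j u k" if "j < n" "u \<in> S" for k j u
    using that e_length[OF pt_mem(1)] by (simp add: B_def nth_append)
  have B2: "B k (n + j) u = gv j u k" if "u \<in> S" for k j u
    using that e_length[OF pt_mem(1)] by (simp add: B_def nth_append)
  have FB: "?F z' (d + k) = (\<Sum>j<N. z' (d + j) * B k j (proj d z'))" if "proj d z' \<in> S" "k < N" for z' k
    using that e_length[OF pt_mem(1)] g_length[OF pt_mem(1)]
    by (simp add: frame_to_std_def lincomb_def B_def)
  have dirB: "dirD d (B k j) ?u v = De j ?u v k" "diffable d (B k j) ?u" if "j < n" "k < N" for k j v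
  proof -
    show "dirD d (B k j) ?u v = De j ?u v k"
      unfolding De_def by (rule dirD_cong_open[OF S_open z]) (use B1 that in simp)
    have "has_partial i (B k j) ?u (partial i (\<lambda>z. ev j z k) ?u)" if "i < d" for i
      using e_diffable[OF z \<open>j < n\<close> \<open>k < N\<close>] B1[OF \<open>j < n\<close>] that
      by (subst has_partial_cong_open[OF S_open z that, of _ "\<lambda>z. ev j z k"]) (auto simp: diffable_def)
    then show "diffable d (B k j) ?u" by (rule diffable_intro(1))
  qed
  have dirB2: "dirD d (B k (n + j)) ?u v = Dg j ?u v k" "diffable d (B k (n + j)) ?u" if "j < m" "k < N" for k j v
  proof -
    show "dirD d (B k (n + j)) ?u v = Dg j ?u v k"
      unfolding Dg_def by (rule dirD_cong_open[OF S_open z]) (use B2 that in simp)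
    have "has_partial i (B k (n + j)) ?u (partial i (\<lambda>z. gv j z k) ?u)" if "i < d" for i
      using g_diffable[OF z \<open>j < m\<close> \<open>k < N\<close>] B2 that
      by (subst has_partial_cong_open[OF S_open z that, of _ "\<lambda>z. gv j z k"]) (auto simp: diffable_def)
    then show "diffable d (B k (n + j)) ?u" by (rule diffable_intro(1))
  qed
  have diffB: "diffable d (B k j) ?u" if "j < N" "k < N" for k j
    using dirB(2)[of j k] dirB2(2)[of "j - n" k] that by (cases "j < n") auto
  have zw: "?zw (d + j) = z (d + j)" if "j < n" for j using that by (simp add: override_on_def)
  have zw2: "?zw (d + (n + j)) = w (d + n + j)" if "j < m" for j
    using that by (simp add: override_on_def add.assoc)
  have F_total: "?F ?zw (d + k) = total z w k" if "k < N" for k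
    using FB[of ?zw k] that z unfolding proj_zw
    by (simp add: sum_lessThan_add total_def zw zw2 B1 B2 add.assoc[of d n])
  have dF: "(\<Sum>i<d + N. partial i (\<lambda>z. ?F z (d + k)) ?zw * v i) =
      (\<Sum>j<N. v (d + j) * B k j ?u) + ((\<Sum>j<n. z (d + j) * De j ?u v k) + (\<Sum>j<m. w (d + n + j) * Dg j ?u v k))"
    if k: "k < N" for k v
  proof -
    have "(\<Sum>i<d + N. partial i (\<lambda>z. ?F z (d + k)) ?zw * v i) = dirD d (\<lambda>_. 0) (proj d ?zw) v +
      (\<Sum>j<N. v (d + j) * B k j (proj d ?zw)) + (\<Sum>j<N. ?zw (d + j) * dirD d (B k j) (proj d ?zw) v)"
      by (rule fiber_affine_differential[OF S_open])
        (use z diffB FB k in \<open>auto simp: proj_zw diffable_const\<close>)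
    then show ?thesis
      unfolding proj_zw using k
      by (simp add: sum_lessThan_add zw zw2 dirB dirB2 diffable_const add.assoc[of d n])
  qed
  have dF_vs: "(\<Sum>i<d + N. partial i (\<lambda>z. ?F z (d + k)) ?zw * v i) = dtotal z w v k"
    if k: "k < N" and v: "v \<in> set vs" for k v
  proof -
    have "v (d + (n + j)) = 0" for j using v vs by (auto simp: topspace_Euclidean_space)
    then show ?thesis unfolding dF[OF k] using z by (simp add: sum_lessThan_add dtotal_def B1)
  qed
  have dF_std: "(\<Sum>i<d + N. partial i (\<lambda>z. ?F z (d + k)) ?zw * std_vec (d + n + j) i) = gv j ?u k"
    if k: "k < N" and j: "j < m" for k j
  proof -
    have 0: "De l ?u (std_vec (d + n + j)) k = 0" "Dg l ?u (std_vec (d + n + j)) k = 0" for l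
      unfolding De_def Dg_def by (rule dirD_zero_vec, simp add: std_vec_def)+
    have "(\<Sum>l<N. std_vec (d + n + j) (d + l) * B k l ?u) = (\<Sum>l<N. if l = n + j then B k (n + j) ?u else 0)"
      by (intro sum.cong) (auto simp: std_vec_def)
    then show ?thesis unfolding dF[OF k] 0 using j z by (simp add: B2)
  qed
  let ?push = "\<lambda>v j. if j < d + N then (\<Sum>i<d + N. partial i (\<lambda>z. ?F z j) ?zw * v i) else 0"
  have "pullback (d + N) (d + N) ?F (Phi0 d N) ?zw ?us =
      pi powr (- real N / 2) * exp (- (\<Sum>k<N. (total z w k)\<^sup>2)) *
      alternate N (\<lambda>us. \<Prod>k<N. ?push (us ! k) (d + k)) ?us"
  proof -
    have "alternate N (\<lambda>us. \<Prod>k<N. (us ! k) (d + k)) (map ?push ?us) =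
        alternate N (\<lambda>us. \<Prod>k<N. ?push (us ! k) (d + k)) ?us"
      unfolding alternate_map by (rule alternate_cong) simp
    then show ?thesis unfolding pullback_def Phi0_alternate by (simp add: F_total)
  qed
  also have "alternate N (\<lambda>us. \<Prod>k<N. ?push (us ! k) (d + k)) ?us =
      (if length vs = n then Determinant.det (frame_mat n m (\<lambda>b. dtotal z w (vs ! b)) (\<lambda>j. gv j ?u)) else 0)"
  proof (cases "length vs = n")
    case True
    then have "length ?us = N" by simp
    from det_alternate[OF this, of "\<lambda>k v. ?push v (d + k)"]
    have "alternate N (\<lambda>us. \<Prod>k<N. ?push (us ! k) (d + k)) ?us =
        Determinant.det (Matrix.mat N N (\<lambda>(k, b). ?push (?us ! b) (d + k)))" .
    also have "Matrix.mat N N (\<lambda>(k, b). ?push (?us ! b) (d + k)) =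
        frame_mat n m (\<lambda>b. dtotal z w (vs ! b)) (\<lambda>j. gv j ?u)"
    proof (rule eq_matI)
      fix k b assume "k < dim_row (frame_mat n m (\<lambda>b. dtotal z w (vs ! b)) (\<lambda>j. gv j ?u))"
        "b < dim_col (frame_mat n m (\<lambda>b. dtotal z w (vs ! b)) (\<lambda>j. gv j ?u))"
      then have kb: "k < N" "b < N" by (auto simp: frame_mat_def)
      have "?push (?us ! b) (d + k) = (if b < n then dtotal z w (vs ! b) k else gv (b - n) ?u k)"
      proof (cases "b < n")
        case b: True
        then have "?us ! b = vs ! b" "vs ! b \<in> set vs" using True by (auto simp: nth_append)
        then show ?thesis using dF_vs[OF kb(1), of "vs ! b"] b kb(1) by simp
      next
        case False
        then have "?us ! b = std_vec (d + n + (b - n))" using True kb by (simp add: nth_append)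
        then show ?thesis using dF_std[OF kb(1), of "b - n"] False kb by simp
      qed
      then show "Matrix.mat N N (\<lambda>(k, b). ?push (?us ! b) (d + k)) $$ (k, b) =
          frame_mat n m (\<lambda>b. dtotal z w (vs ! b)) (\<lambda>j. gv j ?u) $$ (k, b)"
        using kb by (simp add: frame_mat_def)
    qed (simp_all add: frame_mat_def)
    finally show ?thesis using True by simp
  next
    case False
    then show ?thesis by (simp add: alternate_length)
  qed
  finally show ?thesis .
qed

lemma pushforward_eq:
  assumes z: "proj d z \<in> S" and vs: "set vs \<subseteq> Rn (d + n)"
  shows "pushforward d n m oW (Phi0 d N) c e g z vs = oW (pt (proj d z)) (g (pt (proj d z))) *
    (LINT w | (\<Pi>\<^sub>M j\<in>{d + n..<d + n + m}. lborel).
      pi powr (- real N / 2) * exp (- (\<Sum>k<N. (total z w k)\<^sup>2)) *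
      (if length vs = n then Determinant.det (frame_mat n m (\<lambda>b. dtotal z w (vs ! b))
        (\<lambda>j. gv j (proj d z))) else 0))"
  unfolding pushforward_def fiber_integral_def
  using pullback_Phi0[OF z vs] by simp

text \<open>
  The derivatives of \<open>g\<close> enter only through their components along \<open>e\<close>, which are components
  of the derivatives of \<open>e\<close> along \<open>g\<close> because \<open>e\<close> and \<open>g\<close> are orthogonal. The integrand is
  therefore a determinant of affine functions of the Gaussian vector.
\<close>

lemma pushforward_eq_TMQ:
  assumes z: "proj d z \<in> S" and vs: "set vs \<subseteq> Rn (d + n)"
    and o: "oW (pt (proj d z)) (g (pt (proj d z))) =
      sgn (Determinant.det (frame_mat n m (\<lambda>i. ev i (proj d z)) (\<lambda>j. gv j (proj d z))))"
  shows "pushforward d n m oW (Phi0 d N) c e g z vs = TMQ d n (theta0 d N Q c e) z vs"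
proof -
  let ?u = "proj d z" and ?M = "\<Pi>\<^sub>M j\<in>{d + n..<d + n + m}. lborel :: real measure"
  let ?D = "Determinant.det (frame_mat n m (\<lambda>i. ev i ?u) (\<lambda>j. gv j ?u))"
  let ?y = "\<lambda>w k. \<Sum>j<m. w (d + n + j) * gv j ?u k"
  \<comment> \<open>The sign comes from \<open>\<langle>e\<^sub>i, dg\<^sub>j\<rangle> = - \<langle>de\<^sub>i, g\<^sub>j\<rangle>\<close>.\<close>
  define cv where "cv i v = (\<lambda>k. - De i ?u v k)" for i v
  have p: "pt ?u \<in> U" using z by (rule pt_mem)
  interpret split_frame n m "\<lambda>i. ev i ?u" "\<lambda>j. gv j ?u" by (rule split_frame_at[OF p])
  have e_Dg: "ip N (ev i ?u) (Dg j ?u v) = ip N (cv i v) (gv j ?u)" if ij: "i < n" "j < m" for i j v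
  proof -
    have "dirD d (\<lambda>z. \<Sum>k<N. ev i z k * gv j z k) ?u v = dirD d (\<lambda>_. 0) ?u v"
    proof (rule dirD_cong_open[OF S_open z])
      fix z' assume "z' \<in> S"
      then show "(\<Sum>k<N. ev i z' k * gv j z' k) = 0"
        using split_frame.e_perp_g[OF split_frame_at[OF pt_mem(1)[OF \<open>z' \<in> S\<close>]] ij] by (simp add: ip_def)
    qed
    moreover have "dirD d (\<lambda>z. \<Sum>k<N. ev i z k * gv j z k) ?u v =
        (\<Sum>k<N. De i ?u v k * gv j ?u k) + (\<Sum>k<N. ev i ?u k * Dg j ?u v k)"
      unfolding De_def Dg_def
      by (rule diffable_sum_prod) (use e_diffable[OF z] g_diffable[OF z] ij in auto)
    ultimately show ?thesis by (simp add: ip_def cv_def sum_negf diffable_const)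
  qed
  have ip_dtotal: "ip N (ev i ?u) (dtotal z w v) = dx_theta_val z i v + ip N (cv i v) (?y w)" if i: "i < n" for i v w
  proof -
    have "ip N (ev i ?u) (dtotal z w v) = (\<Sum>j<n. v (d + j) * ip N (ev i ?u) (ev j ?u)) +
        (\<Sum>j<n. z (d + j) * ip N (ev i ?u) (De j ?u v)) +
        (\<Sum>j<m. w (d + n + j) * ip N (ev i ?u) (Dg j ?u v))"
      unfolding dtotal_def[abs_def] ip_add_right ip_sum_right ..
    also have "(\<Sum>j<n. v (d + j) * ip N (ev i ?u) (ev j ?u)) = (\<Sum>j<n. if j = i then v (d + i) else 0)"
      using i by (intro sum.cong refl) (simp add: e_orthonormal)
    finally show ?thesis
      using i by (simp add: dx_theta_val_def ip_sum_right e_Dg mult.commute)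
  qed
  have norm: "(\<Sum>k<N. (total z w k)\<^sup>2) = (\<Sum>i<n. (z (d + i))\<^sup>2) + (\<Sum>k<N. (?y w k)\<^sup>2)" for w
  proof -
    let ?x = "\<lambda>k. \<Sum>i<n. z (d + i) * ev i ?u k"
    have "(\<Sum>k<N. (total z w k)\<^sup>2) = ip N ?x ?x + 2 * ip N ?x (?y w) + ip N (?y w) (?y w)"
      unfolding total_def by (rule sum_squares_add)
    moreover have "ip N ?x (?y w) = 0"
      unfolding ip_sum_left ip_sum_right by (simp add: e_perp_g)
    moreover have "ip N ?x ?x = (\<Sum>i<n. (z (d + i))\<^sup>2)"
      unfolding ip_sum_left
    proof (intro sum.cong refl)
      fix i assume i: "i \<in> {..<n}"
      have "ip N (ev i ?u) ?x = (\<Sum>j<n. if j = i then z (d + i) else 0)"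
        unfolding ip_sum_right using i by (intro sum.cong refl) (simp add: e_orthonormal)
      then show "z (d + i) * ip N (ev i ?u) ?x = (z (d + i))\<^sup>2"
        using i by (simp add: power2_eq_square)
    qed
    moreover have "ip N (?y w) (?y w) = (\<Sum>k<N. (?y w k)\<^sup>2)"
      by (simp add: ip_def power2_eq_square)
    ultimately show ?thesis by linarith
  qed
  have det: "(if length vs = n then Determinant.det (frame_mat n m (\<lambda>b. dtotal z w (vs ! b)) (\<lambda>j. gv j ?u)) else 0) =
      ?D * alternate n (\<lambda>us. \<Prod>i<n. dx_theta_val z i (us ! i) + ip N (cv i (us ! i)) (?y w)) vs" for w
  proof (cases "length vs = n")
    case True
    have "alternate n (\<lambda>us. \<Prod>i<n. dx_theta_val z i (us ! i) + ip N (cv i (us ! i)) (?y w)) vs =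
        alternate n (\<lambda>us. \<Prod>i<n. ip N (ev i ?u) (dtotal z w (us ! i))) vs"
      by (intro alternate_cong prod.cong refl) (simp add: ip_dtotal)
    also have "\<dots> = Determinant.det (Matrix.mat n n (\<lambda>(i, b). ip N (ev i ?u) (dtotal z w (vs ! b))))"
      by (rule det_alternate[OF True])
    finally show ?thesis using True det_project[of "\<lambda>b. dtotal z w (vs ! b)"] by simp
  next
    case False
    then show ?thesis by (simp add: alternate_length)
  qed
  let ?G = "\<lambda>w. exp (- (\<Sum>k<N. (?y w k)\<^sup>2)) *
      alternate n (\<lambda>us. \<Prod>i<n. dx_theta_val z i (us ! i) + ip N (cv i (us ! i)) (?y w)) vs"
  let ?x2 = "exp (- (\<Sum>i<n. (z (d + i))\<^sup>2))"
  have integrand: "pi powr (- real N / 2) * exp (- (\<Sum>k<N. (total z w k)\<^sup>2)) *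
      (if length vs = n then Determinant.det (frame_mat n m (\<lambda>b. dtotal z w (vs ! b)) (\<lambda>j. gv j ?u)) else 0) =
      (pi powr (- real N / 2) * ?x2 * ?D) * ?G w" for w
  proof -
    have "exp (- (a + b)) = exp (- a) * exp (- b)" for a b :: real
      by (simp add: exp_add[symmetric])
    then show ?thesis unfolding det norm by (simp only: mult_ac)
  qed
  have "pushforward d n m oW (Phi0 d N) c e g z vs =
      sgn ?D * ((pi powr (- real N / 2) * ?x2 * ?D) * integral\<^sup>L ?M ?G)"
    unfolding pushforward_eq[OF z vs] o integrand integral_mult_right_zero ..
  also have "\<dots> = pi powr (- real N / 2) * ?x2 * (\<bar>?D\<bar> * integral\<^sup>L ?M ?G)"
    by (simp add: abs_sgn mult_ac)
  finally have push: "pushforward d n m oW (Phi0 d N) c e g z vs =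
      pi powr (- real N / 2) * ?x2 * (\<bar>?D\<bar> * integral\<^sup>L ?M ?G)" .
  have K: "W_cov ?u i v j w = (ip N (cv i v) (cv j w) -
      (\<Sum>l<n. ip N (cv i v) (ev l ?u) * ip N (ev l ?u) (cv j w))) / 2" for i j v w
    by (simp add: W_cov_def cv_def ip_def sum_negf)
  have "pi powr (- real N / 2) * pi powr (real m / 2) = pi powr (- real n / 2)"
    by (simp add: powr_add[symmetric] field_simps)
  then have "pi powr (- real N / 2) * x * (pi powr (real m / 2) * y) = pi powr (- real n / 2) * x * y"
    for x y :: real by (metis mult.assoc mult.left_commute)
  then show ?thesis
    unfolding push gaussian_frame_integral TMQ_eq[OF z] K .
qed

end

section \<open>Change of trivialization\<close>

context frame_chart
begin

lemma coords_ip: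
  assumes p: "p \<in> U" and y: "y \<in> V p" and i: "i < n"
  shows "coords (e p) y i = ip N (e p ! i) y"
proof -
  note x = lincomb_coords[OF e_basis[OF p] y]
  have "ip N (e p ! i) (lincomb (e p) (coords (e p) y)) = (\<Sum>l<n. if l = i then coords (e p) y i else 0)"
    unfolding ip_lincomb_right e_length[OF p]
    using i by (intro sum.cong refl) (simp add: e_orthonormal[OF p])
  then show ?thesis using x(2) i by simp
qed

lemma V_expand:
  assumes p: "p \<in> U" and y: "y \<in> V p"
  shows "y k = (\<Sum>i<n. ip N (e p ! i) y * (e p ! i) k)"
proof -
  have "y k = lincomb (e p) (coords (e p) y) k" using lincomb_coords[OF e_basis[OF p] y] by simp
  also have "\<dots> = (\<Sum>i<n. ip N (e p ! i) y * (e p ! i) k)"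
    unfolding lincomb_def e_length[OF p] by (intro sum.cong refl) (simp add: coords_ip[OF p y])
  finally show ?thesis .
qed

lemma lincomb_in_V:
  assumes p: "p \<in> U"
  shows "lincomb (e p) x \<in> V p"
proof -
  have "lincomb (e p) x = lincomb (e p) (\<lambda>i. if i < n then x i else 0)"
    by (simp add: lincomb_def e_length[OF p])
  moreover have "(\<lambda>i. if i < n then x i else 0) \<in> Rn n" by (auto simp: topspace_Euclidean_space)
  ultimately show ?thesis using e_basis[OF p] by (auto simp: basis_of_def bij_betw_def)
qed

lemma total_chart_image:
  assumes z: "z \<in> snd (total_chart d V c U e) ` fst (total_chart d V c U e)"
  shows "z \<in> Rn (d + n)" "proj d z \<in> S"
proof -
  obtain p y where p: "p \<in> U" "y \<in> V p" and zp: "z = (\<lambda>i. if i < d then snd c p i else coords (e p) y (i - d))"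
    using z by (auto simp: total_chart_def)
  have "snd c p \<in> Rn d" using openin_Euclidean_space_subset[OF S_open] p by blast
  then have "proj d z = snd c p" by (auto simp: zp proj_def topspace_Euclidean_space)
  then show "proj d z \<in> S" using p by simp
  have "coords (e p) y \<in> Rn n" by (rule lincomb_coords(1)[OF e_basis[OF p(1)] p(2)])
  then show "z \<in> Rn (d + n)" by (auto simp: zp topspace_Euclidean_space)
qed

lemma total_chart_inj: "inj_on (snd (total_chart d V c U e)) (fst (total_chart d V c U e))"
proof -
  let ?\<phi> = "\<lambda>(p, y) i. if i < d then snd c p i else coords (e p) y (i - d)"
  have "inj_on ?\<phi> {(p, y). p \<in> U \<and> y \<in> V p}"
  proof (rule inj_onI, clarify)
    fix p y p' y' assume *: "p \<in> U" "y \<in> V p" "p' \<in> U" "y' \<in> V p'"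
      and eq: "(\<lambda>i. if i < d then snd c p i else coords (e p) y (i - d)) =
        (\<lambda>i. if i < d then snd c p' i else coords (e p') y' (i - d))"
    have R: "snd c p \<in> Rn d" "snd c p' \<in> Rn d"
      using openin_Euclidean_space_subset[OF S_open] * by auto
    have "snd c p i = snd c p' i" for i
      using R fun_cong[OF eq, of i] by (cases "i < d") (auto simp: topspace_Euclidean_space)
    then have "snd c p = snd c p'" by auto
    then have pp: "p = p'" using chart_inv_left[OF manifold c] * U(2) by (metis subsetD)
    have "coords (e p) y i = coords (e p) y' i" for i
      using fun_cong[OF eq, of "d + i"] pp by simp
    then have "coords (e p) y = coords (e p) y'" by auto
    then have "y = y'" using lincomb_coords(2)[OF e_basis] * pp by metis
    then show "p = p' \<and> y = y'" using pp by simp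
  qed
  then show ?thesis by (simp add: total_chart_def)
qed

text \<open>
  The inverse of a chart of the total space is defined by choice; injectivity identifies it.
\<close>

lemma total_chart_inv:
  assumes z: "z \<in> Rn (d + n)" "proj d z \<in> S"
  shows "chart_inv (total_chart d V c U e) z = (pt (proj d z), lincomb (e (pt (proj d z))) (\<lambda>j. z (d + j)))"
proof -
  let ?p = "pt (proj d z)" and ?x = "\<lambda>j. z (d + j)"
  let ?\<phi> = "\<lambda>(p, y) i. if i < d then snd c p i else coords (e p) y (i - d)"
  let ?D = "{(p, y). p \<in> U \<and> y \<in> V p}"
  have p: "?p \<in> U" "snd c ?p = proj d z" using chart_inv_image[OF manifold c U(2) z(2)] .
  have xR: "?x \<in> Rn n" using z(1) by (auto simp: topspace_Euclidean_space)
  have "?\<phi> (?p, lincomb (e ?p) ?x) = z"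
    using p(2) coords_lincomb[OF e_basis[OF p(1)] xR] by (auto simp: proj_def)
  moreover have "inj_on ?\<phi> ?D" using total_chart_inj by (simp add: total_chart_def)
  moreover have "(?p, lincomb (e ?p) ?x) \<in> ?D" using p(1) lincomb_in_V by simp
  ultimately show ?thesis
    unfolding chart_inv_def total_chart_def by (simp add: inv_into_f_eq)
qed

end

text \<open>
  Two trivializations of \<open>V\<close> over the same set, together with one frame \<open>g\<close> of \<open>W\<close>, which serves
  for both. \<open>T\<close> is the transition function of the total space.
\<close>

locale frame_change =
  X: split_frame_chart M A d n m Q V W c U e g + X': split_frame_chart M A d n m Q V W c' U e' g
  for M :: "'p topology" and A d n m Q V W c c' U e e' g +
  fixes T :: "rvec \<Rightarrow> rvec"
  assumes T: "\<And>z i. z \<in> Rn (d + n) \<Longrightarrow> proj d z \<in> snd c ` U \<Longrightarrow>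
    T z i = (if i < d then snd c' (chart_inv c (proj d z)) i
      else coords (e' (chart_inv c (proj d z)))
        (lincomb (e (chart_inv c (proj d z))) (\<lambda>j. z (d + j))) (i - d))"
begin

abbreviation dT :: "rvec \<Rightarrow> rvec \<Rightarrow> rvec"
  where "dT z v \<equiv> \<lambda>j. if j < d + n then (\<Sum>i<d + n. partial i (\<lambda>z. T z j) z * v i) else 0"

text \<open>The matrix of the change of frame, whose inverse is its transpose.\<close>

definition R :: "nat \<Rightarrow> nat \<Rightarrow> rvec \<Rightarrow> real"
  where "R i j u = (\<Sum>k<n + m. (e' (chart_inv c u) ! i) k * (e (chart_inv c u) ! j) k)"

lemma pt_eq: "u \<in> X.S \<Longrightarrow> X'.pt (snd c' (X.pt u)) = X.pt u"
  using chart_inv_left[OF X.manifold X'.c] X'.U X.pt_mem(1) by blast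

lemma base_point_mem: "u \<in> X.S \<Longrightarrow> snd c' (X.pt u) \<in> X'.S"
  using X.pt_mem(1) by blast

lemma base_smooth:
  assumes "k < d"
  shows "smooth_on d X.S (\<lambda>u. snd c' (X.pt u) k)"
proof -
  have "smooth_on d (snd c ` (fst c \<inter> fst c')) (\<lambda>z. transition c c' z k)"
    using X.manifold X.c X'.c assms unfolding smooth_manifold_def by blast
  then show ?thesis
    unfolding transition_def o_def by (rule smooth_on_subset) (use X.U X'.U in blast)
qed

lemma T_base:
  assumes z: "z \<in> Rn (d + n)" "proj d z \<in> X.S"
  shows "proj d (T z) = snd c' (X.pt (proj d z))"
proof -
  have "snd c' (X.pt (proj d z)) \<in> Rn d"
    using openin_Euclidean_space_subset[OF X'.S_open] base_point_mem[OF z(2)] by blast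
  then show ?thesis by (auto simp: proj_def T[OF z] topspace_Euclidean_space)
qed

lemma T_fiber:
  assumes z: "z \<in> Rn (d + n)" "proj d z \<in> X.S" and i: "i < n"
  shows "T z (d + i) = (\<Sum>j<n. z (d + j) * R i j (proj d z))"
proof -
  let ?p = "X.pt (proj d z)"
  have p: "?p \<in> U" by (rule X.pt_mem(1)[OF z(2)])
  have "T z (d + i) = ip (n + m) (e' ?p ! i) (lincomb (e ?p) (\<lambda>j. z (d + j)))"
    using T[OF z, of "d + i"] X'.coords_ip[OF p X.lincomb_in_V[OF p] i] by simp
  also have "\<dots> = (\<Sum>j<n. z (d + j) * R i j (proj d z))"
    unfolding ip_lincomb_right X.e_length[OF p] by (simp add: R_def ip_def)
  finally show ?thesis .
qed

text \<open>
  Moving along a coordinate line of \<open>c\<close> traces a curve in the coordinates of \<open>c'\<close> that is not a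
  coordinate line, so that the chain rule along curves applies.
\<close>

lemma dirD_change:
  assumes u: "u \<in> X.S" and f: "smooth_fun d A U f"
    and v': "\<And>k. k < d \<Longrightarrow> v' k = dirD d (\<lambda>u. snd c' (X.pt u) k) u v"
  shows "dirD d (\<lambda>z. f (X'.pt z)) (snd c' (X.pt u)) v' = dirD d (\<lambda>z. f (X.pt z)) u v"
proof -
  let ?\<tau> = "\<lambda>u. snd c' (X.pt u)" and ?f' = "\<lambda>z. f (X'.pt z)"
  have sm: "smooth_on d X'.S ?f'"
    by (rule smooth_fun_local[OF f X'.c]) (use X'.U in blast)
  have part: "partial a (\<lambda>z. f (X.pt z)) u =
      (\<Sum>k<d. partial k ?f' (?\<tau> u) * partial a (\<lambda>u. ?\<tau> u k) u)" if a: "a < d" for a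
  proof -
    have ev: "\<forall>\<^sub>F t in nhds (u a). u(a := t) \<in> X.S" by (rule eventually_upd_mem[OF X.S_open u a])
    have "((\<lambda>t. ?f' (?\<tau> (u(a := t)))) has_real_derivative
        (\<Sum>k<d. partial k ?f' (?\<tau> (u(a := u a))) * partial a (\<lambda>u. ?\<tau> u k) u)) (at (u a))"
    proof (rule DERIV_along_curve[OF X'.S_open sm])
      show "?\<tau> (u(a := u a)) \<in> X'.S" using base_point_mem[OF u] by simp
      show "((\<lambda>t. ?\<tau> (u(a := t)) k) has_real_derivative partial a (\<lambda>u. ?\<tau> u k) u) (at (u a))" if "k < d" for k
        using smooth_on_has_partial[OF base_smooth[OF that] u a] by (simp add: has_partial_def)
      show "\<forall>\<^sub>F t in nhds (u a). ?\<tau> (u(a := t)) \<in> Rn d"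
        using ev by (rule eventually_mono)
          (use base_point_mem openin_Euclidean_space_subset[OF X'.S_open] in blast)
    qed
    then have "has_partial a (\<lambda>u. ?f' (?\<tau> u)) u (\<Sum>k<d. partial k ?f' (?\<tau> u) * partial a (\<lambda>u. ?\<tau> u k) u)"
      by (simp add: has_partial_def)
    then have "partial a (\<lambda>u. ?f' (?\<tau> u)) u = (\<Sum>k<d. partial k ?f' (?\<tau> u) * partial a (\<lambda>u. ?\<tau> u k) u)"
      by (rule has_partial_partial)
    moreover have "partial a (\<lambda>u. ?f' (?\<tau> u)) u = partial a (\<lambda>z. f (X.pt z)) u"
      by (rule partial_cong_open[OF X.S_open u a]) (simp add: pt_eq)
    ultimately show ?thesis by simp
  qed
  have "dirD d (\<lambda>z. f (X.pt z)) u v = (\<Sum>a<d. \<Sum>k<d. partial k ?f' (?\<tau> u) * (v a * partial a (\<lambda>u. ?\<tau> u k) u))"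
    unfolding dirD_def by (intro sum.cong refl) (simp add: part sum_distrib_left mult_ac)
  also have "\<dots> = (\<Sum>k<d. \<Sum>a<d. partial k ?f' (?\<tau> u) * (v a * partial a (\<lambda>u. ?\<tau> u k) u))"
    by (rule sum.swap)
  also have "\<dots> = dirD d ?f' (?\<tau> u) v'"
    unfolding dirD_def[of d ?f'] by (intro sum.cong refl) (simp add: v' dirD_def sum_distrib_left sum_distrib_right mult_ac)
  finally show ?thesis by simp
qed

text \<open>
  Both trivializations describe the same map to R^N, so its differential is the same in both. The
  matrix \<open>R\<close> of the change of frame satisfies \<open>e\<^sub>l = \<Sum>\<^sub>i R\<^sub>i\<^sub>l e'\<^sub>i\<close>, and differentiating this
  relation matches the terms.
\<close>

lemma total_change:
  assumes z: "z \<in> Rn (d + n)" "proj d z \<in> X.S" and k: "k < n + m"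
  shows "X'.total (T z) w k = X.total z w k"
    and "X'.dtotal (T z) w (dT z v) k = X.dtotal z w v k"
proof -
  let ?u = "proj d z" and ?u' = "proj d (T z)"
  let ?p = "X.pt ?u"
  let ?R = "\<lambda>i l. R i l ?u" and ?dR = "\<lambda>i l. dirD d (R i l) ?u v"
  let ?E = "\<lambda>i. dirD d (\<lambda>u. (e' (X.pt u) ! i) k) ?u v"
  have p: "?p \<in> U" by (rule X.pt_mem(1)[OF z(2)])
  have u': "?u' = snd c' ?p" by (rule T_base[OF z])
  have pt': "X'.pt ?u' = ?p" unfolding u' by (rule pt_eq[OF z(2)])
  have expand: "(e (X.pt u) ! l) k = (\<Sum>i<n. R i l u * (e' (X.pt u) ! i) k)" if "u \<in> X.S" "l < n" for u l
    using X'.V_expand[OF X.pt_mem(1)[OF that(1)] X.e_in_V[OF X.pt_mem(1)[OF that(1)] that(2)], of k]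
    by (simp add: R_def ip_def)
  have e'_diff: "diffable d (\<lambda>u. (e' (X.pt u) ! i) l) ?u" if "i < n" "l < n + m" for i l
    by (rule smooth_on_diffable[OF X.section_local[OF X'.e_section[OF that(1)] X.c X.U(2) that(2)] z(2)])
  have R_diff: "diffable d (R i l) ?u" if "i < n" "l < n" for i l
    unfolding R_def[abs_def]
    by (intro diffable_sum(1) diffable_mult(1)) (use e'_diff X.e_diffable[OF z(2)] that in auto)
  have De: "X.De l ?u v k = (\<Sum>i<n. ?dR i l * (e' ?p ! i) k) + (\<Sum>i<n. ?R i l * ?E i)" if l: "l < n" for l
  proof -
    have "X.De l ?u v k = dirD d (\<lambda>u. \<Sum>i<n. R i l u * (e' (X.pt u) ! i) k) ?u v"
      unfolding X.De_def by (rule dirD_cong_open[OF X.S_open z(2)]) (rule expand[OF _ l])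
    also have "\<dots> = (\<Sum>i<n. ?dR i l * (e' ?p ! i) k) + (\<Sum>i<n. ?R i l * ?E i)"
      by (rule diffable_sum_prod) (use R_diff e'_diff k l in auto)
    finally show ?thesis .
  qed
  have mem: "z' \<in> Rn (d + n)" if "\<And>i. i \<ge> d + n \<Longrightarrow> z' i = z i" for z'
    using z(1) that by (auto simp: topspace_Euclidean_space)
  have dT_base: "dT z v i = dirD d (\<lambda>u. snd c' (X.pt u) i) ?u v" if i: "i < d" for i
  proof -
    have "(\<Sum>a<d + n. partial a (\<lambda>z. T z i) z * v a) = dirD d (\<lambda>u. snd c' (X.pt u) i) ?u v +
        (\<Sum>j<n. v (d + j) * 0) + (\<Sum>j<n. z (d + j) * dirD d (\<lambda>_. 0) ?u v)"
      by (rule fiber_affine_differential[OF X.S_open z(2)])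
        (use smooth_on_diffable[OF base_smooth[OF i] z(2)] T mem i in \<open>auto simp: diffable_const\<close>)
    then show ?thesis using i by (simp add: diffable_const)
  qed
  have dT_fiber: "dT z v (d + i) = (\<Sum>l<n. v (d + l) * ?R i l) + (\<Sum>l<n. z (d + l) * ?dR i l)" if i: "i < n" for i
  proof -
    have "(\<Sum>a<d + n. partial a (\<lambda>z. T z (d + i)) z * v a) = dirD d (\<lambda>_. 0) ?u v +
        (\<Sum>l<n. v (d + l) * ?R i l) + (\<Sum>l<n. z (d + l) * ?dR i l)"
      by (rule fiber_affine_differential[OF X.S_open z(2)])
        (use R_diff T_fiber mem i in \<open>auto simp: diffable_const\<close>)
    then show ?thesis using i by (simp add: diffable_const)
  qed
  have De': "X'.De i ?u' (dT z v) k = ?E i" if i: "i < n" for i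
    unfolding X'.De_def u'
    using dirD_change[OF z(2), of "\<lambda>p. (e' p ! i) k" "dT z v" v] X'.e_section[OF i] k dT_base
    by (simp add: smooth_section_def)
  have Dg': "X'.Dg j ?u' (dT z v) k = X.Dg j ?u v k" if j: "j < m" for j
    unfolding X'.Dg_def X.Dg_def u'
    using dirD_change[OF z(2), of "\<lambda>p. (g p ! j) k" "dT z v" v] X.g_section[OF j] k dT_base
    by (simp add: smooth_section_def)
  have sw: "(\<Sum>i<n. (\<Sum>l<n. x l * y i l) * b i) = (\<Sum>l<n. x l * (\<Sum>i<n. y i l * b i))"
    for x :: "nat \<Rightarrow> real" and y b
    unfolding sum_distrib_left sum_distrib_right by (subst sum.swap) (simp add: mult.assoc)
  have fib: "(\<Sum>i<n. T z (d + i) * b i) = (\<Sum>l<n. z (d + l) * (\<Sum>i<n. ?R i l * b i))" for b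
    using T_fiber[OF z] by (simp add: sw)
  show "X'.total (T z) w k = X.total z w k"
    unfolding X'.total_def X.total_def pt' fib using expand[OF z(2)] by simp
  have "(\<Sum>i<n. dT z v (d + i) * (e' ?p ! i) k) =
      (\<Sum>l<n. v (d + l) * (e ?p ! l) k) + (\<Sum>l<n. z (d + l) * (\<Sum>i<n. ?dR i l * (e' ?p ! i) k))"
  proof -
    have "(\<Sum>i<n. dT z v (d + i) * (e' ?p ! i) k) = (\<Sum>i<n. (\<Sum>l<n. v (d + l) * ?R i l) * (e' ?p ! i) k) +
        (\<Sum>i<n. (\<Sum>l<n. z (d + l) * ?dR i l) * (e' ?p ! i) k)"
      unfolding sum.distrib[symmetric]
    proof (intro sum.cong refl)
      fix i assume "i \<in> {..<n}"
      then have i: "i < n" by simp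
      show "dT z v (d + i) * (e' ?p ! i) k = (\<Sum>l<n. v (d + l) * ?R i l) * (e' ?p ! i) k +
          (\<Sum>l<n. z (d + l) * ?dR i l) * (e' ?p ! i) k"
        unfolding dT_fiber[OF i] by (rule distrib_right)
    qed
    then show ?thesis unfolding sw using expand[OF z(2)] by simp
  qed
  moreover have "(\<Sum>i<n. T z (d + i) * X'.De i ?u' (dT z v) k) = (\<Sum>l<n. z (d + l) * (\<Sum>i<n. ?R i l * ?E i))"
    using fib[of ?E] De' by simp
  moreover have "(\<Sum>j<m. w (d + n + j) * X'.Dg j ?u' (dT z v) k) = (\<Sum>j<m. w (d + n + j) * X.Dg j ?u v k)"
    using Dg' by simp
  moreover have "(\<Sum>l<n. z (d + l) * (\<Sum>i<n. ?dR i l * (e' ?p ! i) k)) + (\<Sum>l<n. z (d + l) * (\<Sum>i<n. ?R i l * ?E i)) =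
      (\<Sum>l<n. z (d + l) * X.De l ?u v k)"
    using De by (simp add: sum.distrib distrib_left)
  ultimately show "X'.dtotal (T z) w (dT z v) k = X.dtotal z w v k"
    unfolding X'.dtotal_def X.dtotal_def pt' by linarith
qed

text \<open>The integrands agree for every \<open>w\<close>, because \<open>T\<close> leaves \<open>w\<close> alone.\<close>

lemma pushforward_change:
  assumes z: "z \<in> Rn (d + n)" "proj d z \<in> X.S" and vs: "set vs \<subseteq> Rn (d + n)"
  shows "pushforward d n m oW (Phi0 d (n + m)) c' e' g (T z) (map (dT z) vs) =
    pushforward d n m oW (Phi0 d (n + m)) c e g z vs"
proof -
  have u': "proj d (T z) = snd c' (X.pt (proj d z))" by (rule T_base[OF z])
  have z': "proj d (T z) \<in> X'.S" unfolding u' by (rule base_point_mem[OF z(2)])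
  have pt': "X'.pt (proj d (T z)) = X.pt (proj d z)" unfolding u' by (rule pt_eq[OF z(2)])
  have vs': "set (map (dT z) vs) \<subseteq> Rn (d + n)" by (auto simp: topspace_Euclidean_space)
  have "frame_mat n m (\<lambda>b. X'.dtotal (T z) w (map (dT z) vs ! b)) (\<lambda>j. X.gv j (proj d z)) =
      frame_mat n m (\<lambda>b. X.dtotal z w (vs ! b)) (\<lambda>j. X.gv j (proj d z))" if "length vs = n" for w
    by (rule eq_matI) (use total_change(2)[OF z] that in \<open>auto simp: frame_mat_def\<close>)
  then have "(if length (map (dT z) vs) = n then Determinant.det (frame_mat n m
        (\<lambda>b. X'.dtotal (T z) w (map (dT z) vs ! b)) (\<lambda>j. X.gv j (proj d z))) else 0) =
      (if length vs = n then Determinant.det (frame_mat n m (\<lambda>b. X.dtotal z w (vs ! b))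
        (\<lambda>j. X.gv j (proj d z))) else 0)" for w
    by simp
  moreover have "(\<Sum>k<n + m. (X'.total (T z) w k)\<^sup>2) = (\<Sum>k<n + m. (X.total z w k)\<^sup>2)" for w
    using total_change(1)[OF z] by simp
  ultimately show ?thesis
    unfolding X'.pushforward_eq[OF z' vs'] X.pushforward_eq[OF z(2) vs] pt' by (simp only:)
qed

end

lemma compatible_triv_frame_chart:
  assumes "involution_bundle M A d n m Q V W" "compatible_triv M d A (n + m) n V oV c U e"
    "openin M T" "T \<subseteq> U"
  shows "frame_chart M A d n m Q V W c T e"
proof -
  interpret involution_bundle M A d n m Q V W by fact
  have "smooth_frame M d A (n + m) n V U e" using assms(2) by (simp add: compatible_triv_def)
  then have "smooth_frame M d A (n + m) n V T e" using assms(3,4) by (rule smooth_frame_subset)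
  with assms show ?thesis
    by unfold_locales (auto simp: compatible_triv_def)
qed

text \<open>
  For a positive frame \<open>e\<close> the sign of \<open>g\<close> is the one of \<open>det (e | g)\<close>. It makes this determinant
  in the fiber integral an absolute value, as in the integral of a density.
\<close>

lemma complementary_sign:
  assumes "split_frame_chart M A d n m Q V W c U e g"
    and "complementary_orientation M n m V oV W oW" and p: "p \<in> U" and o: "oV p (e p) = 1"
  shows "oW p (g p) = sgn (Determinant.det (frame_mat n m (\<lambda>i. e p ! i) (\<lambda>j. g p ! j)))"
proof -
  interpret split_frame_chart M A d n m Q V W c U e g by fact
  have "oV p (e p) * oW p (g p) =
      sgn (Determinant.det (Matrix.mat (n + m) (n + m) (\<lambda>(k, i). ((e p @ g p) ! i) k)))"
    using assms(2) U_sub[OF p] e_basis[OF p] g_basis[OF p]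
    unfolding complementary_orientation_def by blast
  moreover have "Matrix.mat (n + m) (n + m) (\<lambda>(k, i). ((e p @ g p) ! i) k) =
      frame_mat n m (\<lambda>i. e p ! i) (\<lambda>j. g p ! j)"
    by (rule eq_matI) (simp_all add: frame_mat_def nth_append e_length[OF p])
  ultimately show ?thesis using o by simp
qed

lemma TMQ_pushforward:
  assumes ib: "involution_bundle M A d n m Q V W"
    and triv: "compatible_triv M d A (n + m) n V oV c U e" and T: "openin M T" "T \<subseteq> U"
    and g: "smooth_frame M d A (n + m) m W T g"
    and compl: "complementary_orientation M n m V oV W oW"
    and z: "proj d z \<in> snd c ` T" and vs: "set vs \<subseteq> Rn (d + n)"
  shows "TMQ d n (theta0 d (n + m) Q c e) z vs = pushforward d n m oW (Phi0 d (n + m)) c e g z vs"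
proof -
  interpret frame_chart M A d n m Q V W c T e
    by (rule compatible_triv_frame_chart[OF ib triv T])
  interpret split_frame_chart M A d n m Q V W c T e g
    by unfold_locales (rule g)
  have "oV (pt (proj d z)) (e (pt (proj d z))) = 1"
    using triv T(2) pt_mem(1)[OF z] by (auto simp: compatible_triv_def)
  from complementary_sign[OF split_frame_chart_axioms compl pt_mem(1)[OF z] this]
  show ?thesis by (rule pushforward_eq_TMQ[OF z vs, symmetric])
qed

text \<open>
  Near a given point both local expressions are fiber integrals in a frame of \<open>V \<oplus> W\<close> that
  extends the given frame of \<open>V\<close> by the same frame \<open>g\<close> of \<open>W\<close>.
\<close>

lemma TMQ_forms_agree:
  assumes ib: "involution_bundle M A d n m Q V W"
    and triv: "compatible_triv M d A (n + m) n V oV c U e"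
    and triv': "compatible_triv M d A (n + m) n V oV c' U' e'"
    and subW: "subbundle M d A (n + m) m W"
    and compl: "complementary_orientation M n m V oV W oW"
  shows "forms_agree (d + n) (total_chart d V c U e) (TMQ d n (theta0 d (n + m) Q c e))
    (total_chart d V c' U' e') (TMQ d n (theta0 d (n + m) Q c' e'))"
  unfolding forms_agree_def
proof (intro ballI allI impI)
  let ?tc = "total_chart d V c U e" and ?tc' = "total_chart d V c' U' e'"
  let ?T = "transition ?tc ?tc'"
  fix z vs assume zz: "z \<in> snd ?tc ` (fst ?tc \<inter> fst ?tc')" and vs: "set vs \<subseteq> Rn (d + n)"
  have UM: "openin M U" "openin M U'"
    using triv triv' by (auto simp: compatible_triv_def smooth_frame_def)
  interpret C: frame_chart M A d n m Q V W c U e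
    by (rule compatible_triv_frame_chart[OF ib triv UM(1)]) simp
  interpret C': frame_chart M A d n m Q V W c' U' e'
    by (rule compatible_triv_frame_chart[OF ib triv' UM(2)]) simp
  have zim: "z \<in> snd ?tc ` fst ?tc" using zz by blast
  note zR = C.total_chart_image[OF zim]
  let ?p = "C.pt (proj d z)"
  have "chart_inv ?tc z \<in> fst ?tc \<inter> fst ?tc'"
  proof -
    obtain x where x: "x \<in> fst ?tc" "x \<in> fst ?tc'" "z = snd ?tc x" using zz by blast
    have "inj_on (snd ?tc) (fst ?tc)" by (rule C.total_chart_inj)
    then have "chart_inv ?tc z = x" unfolding chart_inv_def x(3) using x(1) by (rule inv_into_f_f)
    then show ?thesis using x by simp
  qed
  then have "?p \<in> U'" unfolding C.total_chart_inv[OF zR] by (simp add: total_chart_def)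
  moreover have "?p \<in> U" by (rule C.pt_mem(1)[OF zR(2)])
  ultimately have pUU: "?p \<in> U \<inter> U'" by blast
  obtain Ug g where Ug: "?p \<in> Ug" and g: "smooth_frame M d A (n + m) m W Ug g"
    using subW C.pt_mem(2)[OF zR(2)] unfolding subbundle_def by blast
  define T where "T = U \<inter> U' \<inter> Ug"
  have T: "openin M T" "T \<subseteq> U" "T \<subseteq> U'" "T \<subseteq> Ug"
    using UM g by (auto simp: T_def smooth_frame_def)
  have gT: "smooth_frame M d A (n + m) m W T g" by (rule smooth_frame_subset[OF g T(1,4)])
  have "?p \<in> T" using pUU Ug by (simp add: T_def)
  then have zT: "proj d z \<in> snd c ` T"
    using chart_inv_image(2)[OF C.manifold C.c C.U(2) zR(2)] by (metis imageI)
  interpret X: frame_chart M A d n m Q V W c T e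
    by (rule compatible_triv_frame_chart[OF ib triv T(1,2)])
  interpret X': frame_chart M A d n m Q V W c' T e'
    by (rule compatible_triv_frame_chart[OF ib triv' T(1,3)])
  interpret F: frame_change M A d n m Q V W c c' T e e' g ?T
  proof
    fix y i assume y: "y \<in> Rn (d + n)" "proj d y \<in> snd c ` T"
    have "proj d y \<in> C.S" using y(2) T(2) by blast
    from C.total_chart_inv[OF y(1) this]
    show "?T y i = (if i < d then snd c' (C.pt (proj d y)) i
        else coords (e' (C.pt (proj d y))) (lincomb (e (C.pt (proj d y))) (\<lambda>j. y (d + j))) (i - d))"
      by (simp add: transition_def) (simp add: total_chart_def)
  qed (rule gT)+
  have "proj d (?T z) \<in> snd c' ` T"
    unfolding F.T_base[OF zR(1) zT] by (rule F.base_point_mem[OF zT])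
  moreover have "set (map (F.dT z) vs) \<subseteq> Rn (d + n)" by (auto simp: topspace_Euclidean_space)
  ultimately have "TMQ d n (theta0 d (n + m) Q c' e') (?T z) (map (F.dT z) vs) =
      pushforward d n m oW (Phi0 d (n + m)) c' e' g (?T z) (map (F.dT z) vs)"
    by (rule TMQ_pushforward[OF ib triv' T(1,3) gT compl])
  also have "\<dots> = pushforward d n m oW (Phi0 d (n + m)) c e g z vs"
    by (rule F.pushforward_change[OF zR(1) zT vs])
  also have "\<dots> = TMQ d n (theta0 d (n + m) Q c e) z vs"
    by (rule TMQ_pushforward[OF ib triv T(1,2) gT compl zT vs, symmetric])
  finally show "TMQ d n (theta0 d (n + m) Q c e) z vs =
      pullback (d + n) (d + n) ?T (TMQ d n (theta0 d (n + m) Q c' e')) z vs"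
    by (simp add: pullback_def)
qed

theorem theorem2:
  fixes M :: "'p topology" and A :: "'p chart set" and d n m :: nat
    and Q :: "'p \<Rightarrow> real mat" and V W :: "'p \<Rightarrow> rvec set"
    and oV oW :: "'p \<Rightarrow> rvec list \<Rightarrow> real"
  assumes "smooth_manifold M d A"
    and "\<And>p. p \<in> topspace M \<Longrightarrow> Q p \<in> carrier_mat (n + m) (n + m)"
    and "\<And>p. p \<in> topspace M \<Longrightarrow> Q p * Q p = 1\<^sub>m (n + m)"
    and "\<And>p. p \<in> topspace M \<Longrightarrow> transpose_mat (Q p) = Q p"
    and "\<And>i j. i < n + m \<Longrightarrow> j < n + m \<Longrightarrow>
      smooth_fun d A (topspace M) (\<lambda>p. Q p $$ (i, j))"
    and "V = (\<lambda>p. eigspace (n + m) (Q p) (-1))"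
    and "W = (\<lambda>p. eigspace (n + m) (Q p) 1)"
    and "subbundle M d A (n + m) n V"
    and "subbundle M d A (n + m) m W"
    and "bundle_orientation M d A (n + m) n V oV"
    and "complementary_orientation M n m V oV W oW"
  shows
    "nabla0_metric M d A (n + m) Q \<and>
     nabla0_preserves M d A (n + m) Q V \<and>
     nabla0_preserves M d A (n + m) Q W \<and>
     (\<forall>c U e c' U' e'.
       compatible_triv M d A (n + m) n V oV c U e \<and>
       compatible_triv M d A (n + m) n V oV c' U' e' \<longrightarrow>
       forms_agree (d + n)
         (total_chart d V c U e) (TMQ d n (theta0 d (n + m) Q c e))
         (total_chart d V c' U' e') (TMQ d n (theta0 d (n + m) Q c' e'))) \<and>
     (\<forall>c U e g.
       compatible_triv M d A (n + m) n V oV c U e \<and>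
       smooth_frame M d A (n + m) m W U g \<longrightarrow>
       (\<forall>z \<in> snd (total_chart d V c U e) ` fst (total_chart d V c U e).
         \<forall>vs. set vs \<subseteq> Rn (d + n) \<longrightarrow>
           TMQ d n (theta0 d (n + m) Q c e) z vs =
           pushforward d n m oW (Phi0 d (n + m)) c e g z vs))"
proof -
  have ib: "involution_bundle M A d n m Q V W"
    by (rule involution_bundle.intro) (fact assms)+
  have "TMQ d n (theta0 d (n + m) Q c e) z vs = pushforward d n m oW (Phi0 d (n + m)) c e g z vs"
    if triv: "compatible_triv M d A (n + m) n V oV c U e" and g: "smooth_frame M d A (n + m) m W U g"
      and z: "z \<in> snd (total_chart d V c U e) ` fst (total_chart d V c U e)"
      and vs: "set vs \<subseteq> Rn (d + n)" for c U e g z vs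
  proof -
    have U: "openin M U" using g by (simp add: smooth_frame_def)
    have "proj d z \<in> snd c ` U"
      by (rule frame_chart.total_chart_image(2)[OF compatible_triv_frame_chart[OF ib triv U subset_refl] z])
    then show ?thesis
      by (rule TMQ_pushforward[OF ib triv U subset_refl g assms(11)]) (rule vs)
  qed
  moreover have "forms_agree (d + n)
      (total_chart d V c U e) (TMQ d n (theta0 d (n + m) Q c e))
      (total_chart d V c' U' e') (TMQ d n (theta0 d (n + m) Q c' e'))"
    if "compatible_triv M d A (n + m) n V oV c U e" "compatible_triv M d A (n + m) n V oV c' U' e'"
    for c U e c' U' e'
    using TMQ_forms_agree[OF ib that assms(9,11)] .
  ultimately show ?thesis
    using involution_bundle.nabla0_metric[OF ib] involution_bundle.nabla0_preserves_V[OF ib]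
      involution_bundle.nabla0_preserves_W[OF ib] by blast
qed

end
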